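(* Consider the singularly perturbed hybrid system \[ \dot\varphi=f^\delta_\varphi(\varphi,\chi),\ \ \dot\chi=\tfrac1\varepsilon f_\chi(\varphi,\chi),\quad(\varphi,\chi)\in C\times\Psi;\qquad \varphi^+\in G_\varphi(\varphi,\chi),\ \ \chi^+=\chi,\quad(\varphi,\chi)\in D\times\Psi, \] with $\varphi\in\mathbb{R}^{n_1}$, $\chi\in\mathbb{R}^{n_2}$, $\delta,\varepsilon>0$, and suppose: (A1) for each $\delta>0$: $C,D\subset\mathbb{R}^{n_1}$ are closed, $f^\delta_\varphi$ and $f_\chi$ are continuous on $C\times\Psi$, $G_\varphi$ is outer semicontinuous and locally bounded, $\Psi$ is compact, and $G_\varphi(\varphi,\chi)\neq\emptyset$ for all $(\varphi,\chi)\in D\times\Psi$; (A2) for each $\delta>0$ there is a continuous $f^\delta_A:\mathbb{R}^{n_1}\to\mathbb{R}^{n_1}$ such that for each compact $K\subset\mathbb{R}^{n_1}$ there is a class-$\mathcal{L}$ function $\sigma_{K,\delta}$ such that for each $L>0$, each $\varphi\in C\cap K$ and each $\chi_{bl}:[0,L]\to\Psi$ with $\dot\chi_{bl}=f_\chi(\varphi,\chi_{bl})$, $\left|\frac1L\int_0^L\big(f^\delta_\varphi(\varphi,\chi_{bl}(s))-f^\delta_A(\varphi)\big)ds\right|\le\sigma_{K,\delta}(L)$; (A3) there exist a nonempty compact $\mathcal{A}_\varphi\subset\mathbb{R}^{n_1}$, an open $\mathcal{B}\supset\mathcal{A}_\varphi$ and $\beta\in\mathcal{KL}$ such that for each proper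 indicator $\omega$ of $\mathcal{A}_\varphi$ on $\mathcal{B}$, each compact $K_0\subset\mathcal{B}$ and each $\nu>0$ there is $\delta^*>0$ such that for all $\delta\in(0,\delta^* )$ all solutions $y$ of the average system $\dot y=f^\delta_A(y)$, $y\in C$; $y^+\in G_A(y)$, $y\in D$, with $y(0,0)\in K_0$ satisfy $\omega(y(t,j))\le\beta(\omega(y(0,0)),t+j)+\nu$ for all $(t,j)\in\operatorname{dom}(y)$. Then for each proper indicator $\omega$ of $\mathcal{A}_\varphi$ on $\mathcal{B}$, each compact $K_0\subset\mathcal{B}$ and each $\nu>0$ there exists $\delta^*>0$ such that for each $\delta\in(0,\delta^* )$ there exists $\varepsilon^*>0$ such that for all $\varepsilon\in(0,\varepsilon^* )$ all solutions of the singularly perturbed system with $\varphi(0,0)\in K_0$ satisfy $\omega(\varphi(t,j))\le\beta(\omega(\varphi(0,0)),t+j)+\nu$ for all $(t,j)\in\operatorname{dom}(\varphi)$.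
   Context: $G_A(y):=\bigcup_{\chi\in\Psi}G_\varphi(y,\chi)$. A proper indicator of $\mathcal{A}_\varphi$ on $\mathcal{B}$ is a continuous $\omega:\mathcal{B}\to\mathbb{R}_{\ge0}$ with $\omega(\varphi)=0$ iff $\varphi\in\mathcal{A}_\varphi$, and $\omega(\varphi_i)\to\infty$ whenever $|\varphi_i|\to\infty$ or $\varphi_i$ approaches the boundary of $\mathcal{B}$. Outer semicontinuity and local boundedness of set-valued maps are in the usual sense (Goebel–Sanfelice–Teel). Solutions are hybrid arcs on hybrid time domains, indexed by $(t,j)$. *)

theory Defs
  imports "HOL-Analysis.Analysis"
begin

definition class_K :: "(real \<Rightarrow> real) \<Rightarrow> bool" where
  "class_K \<alpha> \<longleftrightarrow> continuous_on {0..} \<alpha> \<and> \<alpha> 0 = 0 \<and> strict_mono_on {0..} \<alpha>"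

definition class_L :: "(real \<Rightarrow> real) \<Rightarrow> bool" where
  "class_L \<sigma> \<longleftrightarrow> continuous_on {0..} \<sigma> \<and> (\<forall>s\<ge>0. \<sigma> s \<ge> 0)
     \<and> (\<forall>s1 s2. 0 \<le> s1 \<longrightarrow> s1 \<le> s2 \<longrightarrow> \<sigma> s2 \<le> \<sigma> s1)
     \<and> (\<sigma> \<longlongrightarrow> 0) at_top"

definition class_KL :: "(real \<Rightarrow> real \<Rightarrow> real) \<Rightarrow> bool" where
  "class_KL \<beta> \<longleftrightarrow> continuous_on ({0..} \<times> {0..}) (\<lambda>(r, s). \<beta> r s)
     \<and> (\<forall>s\<ge>0. class_K (\<lambda>r. \<beta> r s)) \<and> (\<forall>r\<ge>0. class_L (\<lambda>s. \<beta> r s))"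

definition outer_semicontinuous :: "('a::metric_space \<Rightarrow> 'b::metric_space set) \<Rightarrow> bool" where
  "outer_semicontinuous G \<longleftrightarrow>
     (\<forall>xs ys x y. xs \<longlonglongrightarrow> x \<longrightarrow> ys \<longlonglongrightarrow> y \<longrightarrow> (\<forall>i. ys i \<in> G (xs i)) \<longrightarrow> y \<in> G x)"

definition locally_bounded :: "('a::metric_space \<Rightarrow> 'b::metric_space set) \<Rightarrow> bool" where
  "locally_bounded G \<longleftrightarrow> (\<forall>x. \<exists>U. open U \<and> x \<in> U \<and> bounded (\<Union>(G ` U)))"

definition compact_hybrid_time_domain :: "(real \<times> nat) set \<Rightarrow> bool" where
  "compact_hybrid_time_domain E \<longleftrightarrow>
     (\<exists>(J::nat) (ts::nat \<Rightarrow> real). ts 0 = 0 \<and> (\<forall>k<J. ts k \<le> ts (Suc k))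
        \<and> E = (\<Union>j<J. {ts j..ts (Suc j)} \<times> {j}))"

definition hybrid_time_domain :: "(real \<times> nat) set \<Rightarrow> bool" where
  "hybrid_time_domain E \<longleftrightarrow> E \<subseteq> {0..} \<times> UNIV \<and>
     (\<forall>(T, J) \<in> E. compact_hybrid_time_domain (E \<inter> ({0..T} \<times> {..J})))"

definition jslice :: "(real \<times> nat) set \<Rightarrow> nat \<Rightarrow> real set" where
  "jslice E j = {t. (t, j) \<in> E}"

definition abs_continuous_on :: "real set \<Rightarrow> (real \<Rightarrow> 'a::real_normed_vector) \<Rightarrow> bool" where
  "abs_continuous_on S f \<longleftrightarrow>
     (\<forall>e>0. \<exists>d>0. \<forall>(n::nat) (a::nat \<Rightarrow> real) b.
        (\<forall>k<n. a k \<le> b k \<and> {a k..b k} \<subseteq> S)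
        \<and> (\<forall>k<n. \<forall>l<n. k \<noteq> l \<longrightarrow> b k \<le> a l \<or> b l \<le> a k)
        \<and> (\<Sum>k<n. b k - a k) < d
        \<longrightarrow> (\<Sum>k<n. norm (f (b k) - f (a k))) < e)"

definition locally_abs_continuous_on :: "real set \<Rightarrow> (real \<Rightarrow> 'a::real_normed_vector) \<Rightarrow> bool" where
  "locally_abs_continuous_on S f \<longleftrightarrow>
     (\<forall>a\<in>S. \<forall>b\<in>S. a \<le> b \<longrightarrow> abs_continuous_on {a..b} f)"

definition hybrid_arc :: "(real \<times> nat) set \<Rightarrow> (real \<times> nat \<Rightarrow> 'a::real_normed_vector) \<Rightarrow> bool" where
  "hybrid_arc E x \<longleftrightarrow> hybrid_time_domain E \<and>
     (\<forall>j. interior (jslice E j) \<noteq> {} \<longrightarrow> locally_abs_continuous_on (jslice E j) (\<lambda>t. x (t, j)))"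

definition is_hybrid_solution ::
  "'a::euclidean_space set \<Rightarrow> ('a \<Rightarrow> 'a set) \<Rightarrow> 'a set \<Rightarrow> ('a \<Rightarrow> 'a set)
     \<Rightarrow> (real \<times> nat) set \<Rightarrow> (real \<times> nat \<Rightarrow> 'a) \<Rightarrow> bool" where
  "is_hybrid_solution C F D G E x \<longleftrightarrow>
     E \<noteq> {} \<and> hybrid_arc E x \<and>
     x (0, 0) \<in> closure C \<union> D \<and>
     (\<forall>j. interior (jslice E j) \<noteq> {} \<longrightarrow>
        (\<forall>t\<in>interior (jslice E j). x (t, j) \<in> C) \<and>
        (\<exists>N. negligible N \<and> (\<forall>t\<in>interior (jslice E j) - N.
            \<exists>v. ((\<lambda>s. x (s, j)) has_vector_derivative v) (at t) \<and> v \<in> F (x (t, j))))) \<and>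
     (\<forall>t j. (t, j) \<in> E \<longrightarrow> (t, Suc j) \<in> E \<longrightarrow> x (t, j) \<in> D \<and> x (t, Suc j) \<in> G (x (t, j)))"

definition proper_indicator :: "('a::real_normed_vector \<Rightarrow> real) \<Rightarrow> 'a set \<Rightarrow> 'a set \<Rightarrow> bool" where
  "proper_indicator \<omega> A B \<longleftrightarrow>
     continuous_on B \<omega> \<and> (\<forall>x\<in>B. \<omega> x \<ge> 0) \<and> (\<forall>x\<in>B. \<omega> x = 0 \<longleftrightarrow> x \<in> A) \<and>
     (\<forall>xs. (\<forall>i. xs i \<in> B) \<longrightarrow>
        (filterlim (\<lambda>i. norm (xs i)) at_top sequentially \<or> (\<exists>p\<in>frontier B. xs \<longlonglongrightarrow> p)) \<longrightarrow>
        filterlim (\<lambda>i. \<omega> (xs i)) at_top sequentially)"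

definition sp_flow ::
  "(real \<Rightarrow> 'p \<Rightarrow> 'q \<Rightarrow> 'p) \<Rightarrow> ('p \<Rightarrow> 'q \<Rightarrow> 'q::real_vector) \<Rightarrow> real \<Rightarrow> real
     \<Rightarrow> 'p \<times> 'q \<Rightarrow> ('p \<times> 'q) set" where
  "sp_flow f_phi f_chi \<delta> \<epsilon> z = {(f_phi \<delta> (fst z) (snd z), (1 / \<epsilon>) *\<^sub>R f_chi (fst z) (snd z))}"

definition sp_jump :: "('p \<Rightarrow> 'q \<Rightarrow> 'p set) \<Rightarrow> 'p \<times> 'q \<Rightarrow> ('p \<times> 'q) set" where
  "sp_jump G_phi z = {(p, snd z) | p. p \<in> G_phi (fst z) (snd z)}"

definition avg_jump :: "('p \<Rightarrow> 'q \<Rightarrow> 'p set) \<Rightarrow> 'q set \<Rightarrow> 'p \<Rightarrow> 'p set" where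
  "avg_jump G_phi \<Psi> y = (\<Union>c\<in>\<Psi>. G_phi y c)"

end

theory Submission
  imports Defs "HOL-Complex_Analysis.Great_Picard"
begin

text \<open>
  As \<open>\<epsilon> \<rightarrow> 0\<close>, in the fast time scale the slow variable freezes, so on time windows of length
  \<open>\<epsilon> L\<close> the averaging hypothesis applies up to a small error (by compactness, as boundary layer
  solutions need not be unique). Summing over windows shows that slow components of
  solutions staying in a compact set, with a fixed number of jumps and bounded duration, accumulate
  only at solutions of the average system. Hence a violation of the \<open>KL\<close> estimate on a finite
  horizon for arbitrarily small \<open>\<epsilon>\<close>, truncated at its first occurrence so that compactness is
  available, would produce a solution of the average system violating its own estimate.
  For the unbounded horizon choose \<open>T\<close> so large that after time \<open>T\<close> a solution starting in \<open>K\<^sub>0\<close> or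
  in \<open>{\<omega> \<le> \<nu>}\<close> has returned to \<open>{\<omega> \<le> \<nu>}\<close>, and estimate later points by restarting
  between \<open>T\<close> and \<open>T + 1\<close> time units earlier.
\<close>

section \<open>Absolutely continuous functions\<close>

text \<open>The fields are merely continuous, so no Gronwall estimate compares a solution with its
  average; comparisons go through limits of sequences. A limit keeps only weak inequalities, so the
  finite-horizon tolerance \<open>\<nu> / 2\<close> must exceed the tolerance
  \<open>\<nu> / 4\<close> granted to the average system; the rest of \<open>\<nu>\<close> absorbs
  what \<open>\<beta>\<close> retains after time \<open>T\<close>. Outside \<open>B\<close> the
  values of \<open>\<omega>\<close> are arbitrary, so its estimate alone does not keep a solution in
  \<open>B\<close>. Replacing them by a constant above all levels that can occur leaves a proper
  indicator; (A3) applies to it as well and then also confines average solutions to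
  \<open>B\<close>. Restarts begin in \<open>{\<omega> \<le> \<nu>}\<close> rather than in the given
  compact set, so (A3) is invoked for the union of both, which gives one threshold for delta.
  Solutions satisfy their differential equation only almost everywhere. The fundamental theorem of
  calculus for absolutely continuous functions, proved first by means of gauges, turns flows into
  continuously differentiable curves, since the fields are continuous along them.\<close>

lemma abs_continuous_on_tagged_division:
  fixes h :: "real \<Rightarrow> 'a::real_normed_vector"
  assumes "abs_continuous_on {a..b} h" "e > 0"
  obtains d where "d > 0"
    "\<And>p q. p tagged_division_of {a..b} \<Longrightarrow> q \<subseteq> p \<Longrightarrow> (\<Sum>(x, K)\<in>q. measure lborel K) < d
       \<Longrightarrow> (\<Sum>(x, K)\<in>q. norm (h (Sup K) - h (Inf K))) < e"
proof -
  obtain d where "d > 0" and d0: "\<forall>(n::nat) u v.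
      (\<forall>k<n. u k \<le> v k \<and> {u k..v k} \<subseteq> {a..b})
      \<and> (\<forall>k<n. \<forall>l<n. k \<noteq> l \<longrightarrow> v k \<le> u l \<or> v l \<le> u k)
      \<and> (\<Sum>k<n. v k - u k) < d \<longrightarrow> (\<Sum>k<n. norm (h (v k) - h (u k))) < e"
    using assms(1)[unfolded abs_continuous_on_def, rule_format, OF assms(2)] by (elim exE conjE)
  note d = d0[rule_format, OF conjI, OF _ conjI]
  show ?thesis
  proof (rule that[OF \<open>d > 0\<close>])
    fix p q :: "(real \<times> real set) set"
    assume p: "p tagged_division_of {a..b}" and "q \<subseteq> p" and small: "(\<Sum>(x, K)\<in>q. measure lborel K) < d"
    have "finite q" using p \<open>q \<subseteq> p\<close> by (meson finite_subset tagged_division_of_finite)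
    \<comment> \<open>Degenerate intervals may lie inside other ones, but contribute nothing.\<close>
    define q' where "q' = {z \<in> q. Inf (snd z) < Sup (snd z)}"
    have "finite q'" using \<open>finite q\<close> by (simp add: q'_def)
    then obtain g where g: "bij_betw g {..<card q'} q'"
      using ex_bij_betw_nat_finite[of q'] by (auto simp: lessThan_atLeast0)
    have K: "\<exists>u v. snd z = {u..v} \<and> u \<le> v \<and> {u..v} \<subseteq> {a..b}" if "z \<in> q" for z
    proof -
      have z: "(fst z, snd z) \<in> p" using that \<open>q \<subseteq> p\<close> by auto
      obtain u v where "snd z = {u..v}" using tagged_division_ofD(4)[OF p z] by (auto simp: box_real)
      then show ?thesis
        using tagged_division_ofD(2,3)[OF p z] by auto
    qed
    have KI: "snd z = {Inf (snd z)..Sup (snd z)} \<and> Inf (snd z) \<le> Sup (snd z) \<and>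
        {Inf (snd z)..Sup (snd z)} \<subseteq> {a..b}" if "z \<in> q" for z
      using K[OF that] by (auto simp del: atLeastatMost_subset_iff)
    have gq: "g k \<in> q'" if "k < card q'" for k
      using bij_betwE[OF g] that by auto
    have disj: "Sup (snd y) \<le> Inf (snd z) \<or> Sup (snd z) \<le> Inf (snd y)"
      if "y \<in> q'" "z \<in> q'" "y \<noteq> z" for y z
    proof -
      have yz: "y \<in> q" "z \<in> q" "Inf (snd y) < Sup (snd y)" "Inf (snd z) < Sup (snd z)"
        using that by (auto simp: q'_def)
      have "(fst y, snd y) \<in> p" "(fst z, snd z) \<in> p" "(fst y, snd y) \<noteq> (fst z, snd z)"
        using yz that(3) \<open>q \<subseteq> p\<close> by auto
      then have "interior (snd y) \<inter> interior (snd z) = {}"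
        using tagged_division_ofD(5)[OF p] by blast
      then have "{Inf (snd y)<..<Sup (snd y)} \<inter> {Inf (snd z)<..<Sup (snd z)} = {}"
        using KI[OF yz(1)] KI[OF yz(2)] by (metis interior_atLeastAtMost_real)
      then show ?thesis using yz(3,4) by (auto simp: Int_greaterThanLessThan)
    qed
    have sumq: "(\<Sum>(x, K)\<in>q. F K) = (\<Sum>k<card q'. F (snd (g k)))"
      if "\<And>u. F {u..u} = 0" for F :: "real set \<Rightarrow> real"
    proof -
      have "(\<Sum>(x, K)\<in>q. F K) = (\<Sum>z\<in>q. F (snd z))" by (simp add: case_prod_unfold)
      also have "\<dots> = (\<Sum>z\<in>q'. F (snd z))"
      proof (rule sum.mono_neutral_right[OF \<open>finite q\<close>])
        show "\<forall>z\<in>q - q'. F (snd z) = 0"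
          using K that by (fastforce simp: q'_def)
      qed (auto simp: q'_def)
      also have "\<dots> = (\<Sum>k<card q'. F (snd (g k)))"
        by (rule sum.reindex_bij_betw[OF g, symmetric])
      finally show ?thesis .
    qed
    have "(\<Sum>k<card q'. norm (h (Sup (snd (g k))) - h (Inf (snd (g k))))) < e"
    proof (rule d)
      show "\<forall>k<card q'. Inf (snd (g k)) \<le> Sup (snd (g k)) \<and> {Inf (snd (g k))..Sup (snd (g k))} \<subseteq> {a..b}"
        using KI gq unfolding q'_def by blast
      show "\<forall>k<card q'. \<forall>l<card q'. k \<noteq> l \<longrightarrow>
          Sup (snd (g k)) \<le> Inf (snd (g l)) \<or> Sup (snd (g l)) \<le> Inf (snd (g k))"
        using disj gq g by (metis bij_betw_def inj_on_contraD lessThan_iff)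
      have "(\<Sum>k<card q'. Sup (snd (g k)) - Inf (snd (g k))) = (\<Sum>k<card q'. measure lborel (snd (g k)))"
      proof (rule sum.cong[OF refl])
        fix k assume "k \<in> {..<card q'}"
        then have "g k \<in> q" using gq by (auto simp: q'_def)
        from K[OF this] show "Sup (snd (g k)) - Inf (snd (g k)) = measure lborel (snd (g k))" by auto
      qed
      also have "\<dots> < d" using small sumq[of "measure lborel"] by simp
      finally show "(\<Sum>k<card q'. Sup (snd (g k)) - Inf (snd (g k))) < d" .
    qed
    then show "(\<Sum>(x, K)\<in>q. norm (h (Sup K) - h (Inf K))) < e"
      using sumq[of "\<lambda>K. norm (h (Sup K) - h (Inf K))"] by simp
  qed
qed

text \<open>The tag splits the interval, so the two errors of the linear approximation are
  proportional to lengths that add up to \<open>y - x\<close>; over a division they sum to a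
  multiple of its total length.\<close>

lemma has_vector_derivative_straddle:
  fixes h :: "real \<Rightarrow> 'a::real_normed_vector"
  assumes "(h has_vector_derivative v) (at t)" "e > 0"
  obtains d where "d > 0"
    "\<And>x y. x \<le> t \<Longrightarrow> t \<le> y \<Longrightarrow> {x..y} \<subseteq> ball t d \<Longrightarrow> norm ((y - x) *\<^sub>R v - (h y - h x)) \<le> e * (y - x)"
proof -
  obtain d where "d > 0" and d: "\<And>y. norm (y - t) < d \<Longrightarrow> norm (h y - h t - (y - t) *\<^sub>R v) \<le> e * norm (y - t)"
    using assms unfolding has_vector_derivative_def has_derivative_at_alt by blast
  show ?thesis
  proof (rule that[OF \<open>d > 0\<close>])
    fix x y assume xy: "x \<le> t" "t \<le> y" "{x..y} \<subseteq> ball t d"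
    have "x \<in> {x..y}" "y \<in> {x..y}" using xy by auto
    then have *: "norm (x - t) < d" "norm (y - t) < d" using xy(3) by (auto simp: dist_norm norm_minus_commute)
    have "(y - x) *\<^sub>R v - (h y - h x) = (h x - h t - (x - t) *\<^sub>R v) - (h y - h t - (y - t) *\<^sub>R v)"
      by (simp add: algebra_simps)
    also have "norm \<dots> \<le> e * norm (x - t) + e * norm (y - t)"
      using d[OF *(1)] d[OF *(2)] norm_triangle_ineq4 by (meson add_mono order_trans)
    also have "\<dots> = e * (y - x)" using xy by (simp add: algebra_simps)
    finally show "norm ((y - x) *\<^sub>R v - (h y - h x)) \<le> e * (y - x)" .
  qed
qed

text \<open>A gauge makes intervals with good tags obey the straddle estimate, while those tagged in
  the exceptional null set get small total length, so that absolute continuity makes the increments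
  of \<open>h\<close> over them small. Integrability of the derivative is a result of the
  argument.\<close>

theorem abs_continuous_on_has_integral:
  fixes h :: "real \<Rightarrow> 'a::real_normed_vector"
  assumes "a \<le> b" and ac: "abs_continuous_on {a..b} h" and "negligible N"
    and der: "\<And>t. t \<in> {a<..<b} - N \<Longrightarrow> (h has_vector_derivative g t) (at t)"
  shows "(g has_integral h b - h a) {a..b}"
proof -
  \<comment> \<open>The derivative is given only in the open interval, so the endpoints join the
    exceptional points.\<close>
  define N' where "N' = N \<union> {a, b}"
  have "negligible N'" using \<open>negligible N\<close> by (simp add: N'_def)
  define g' where "g' t = (if t \<in> N' then 0 else g t)" for t
  have "(g' has_integral h b - h a) {a..b}"
    unfolding has_integral_real
  proof (intro allI impI)
    fix e :: real assume "e > 0"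
    obtain d where "d > 0" and d: "\<And>p q. p tagged_division_of {a..b} \<Longrightarrow> q \<subseteq> p \<Longrightarrow>
        (\<Sum>(x, K)\<in>q. measure lborel K) < d \<Longrightarrow> (\<Sum>(x, K)\<in>q. norm (h (Sup K) - h (Inf K))) < e / 2"
      using abs_continuous_on_tagged_division[OF ac, of "e / 2"] \<open>e > 0\<close> by auto
    \<comment> \<open>The vanishing integral of the indicator supplies a gauge for which the
      intervals tagged in \<open>N'\<close> have total length below \<open>d\<close>.\<close>
    have "((indicator N' :: real \<Rightarrow> real) has_integral 0) {a..b}"
      using \<open>negligible N'\<close> unfolding negligible_def by (metis box_real(2))
    then obtain \<gamma>0 where \<gamma>0: "gauge \<gamma>0" and \<gamma>0_fine: "\<And>p. p tagged_division_of {a..b} \<Longrightarrow> \<gamma>0 fine p \<Longrightarrow>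
        norm ((\<Sum>(x, K)\<in>p. measure lborel K *\<^sub>R indicator N' x) - (0::real)) < d"
      unfolding has_integral_real using \<open>d > 0\<close> by meson
    \<comment> \<open>Half of \<open>e\<close> is reserved for the good tags; the summand 1 avoids a
      zero denominator when \<open>a = b\<close>.\<close>
    define e' where "e' = e / (2 * (b - a + 1))"
    have "e' > 0" using \<open>e > 0\<close> \<open>a \<le> b\<close> by (simp add: e'_def)
    have "\<exists>r>0. t \<in> {a..b} \<longrightarrow> t \<notin> N' \<longrightarrow> (\<forall>x y. x \<le> t \<longrightarrow> t \<le> y \<longrightarrow> {x..y} \<subseteq> ball t r \<longrightarrow>
        norm ((y - x) *\<^sub>R g t - (h y - h x)) \<le> e' * (y - x))" for t
    proof (cases "t \<in> {a..b} \<and> t \<notin> N'")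
      case True
      then have "(h has_vector_derivative g t) (at t)"
        using der[of t] by (auto simp: N'_def)
      from has_vector_derivative_straddle[OF this \<open>e' > 0\<close>] show ?thesis by metis
    qed (auto intro: exI[of _ 1])
    then obtain r where rpos: "\<And>t. r t > 0" and r: "\<And>t x y. t \<in> {a..b} \<Longrightarrow> t \<notin> N' \<Longrightarrow> x \<le> t \<Longrightarrow> t \<le> y \<Longrightarrow>
        {x..y} \<subseteq> ball t (r t) \<Longrightarrow> norm ((y - x) *\<^sub>R g t - (h y - h x)) \<le> e' * (y - x)"
      by metis
    define \<gamma> where "\<gamma> t = \<gamma>0 t \<inter> ball t (r t)" for t
    have "gauge \<gamma>" unfolding \<gamma>_def using \<gamma>0 by (intro gauge_Int gauge_ball_dependent) (auto simp: rpos)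
    moreover have "norm ((\<Sum>(x, K)\<in>p. measure lborel K *\<^sub>R g' x) - (h b - h a)) < e"
      if p: "p tagged_division_of {a..b}" and fine: "\<gamma> fine p" for p
    proof -
      have "finite p" using p by (rule tagged_division_of_finite)
      have fine0: "\<gamma>0 fine p" using fine unfolding \<gamma>_def fine_def by blast
      define q where "q = {z \<in> p. fst z \<in> N'}"
      have "(\<Sum>(x, K)\<in>p. measure lborel K *\<^sub>R indicator N' x) = (\<Sum>(x, K)\<in>q. measure lborel K)"
        unfolding q_def case_prod_unfold
        by (subst sum.inter_filter[OF \<open>finite p\<close>]) (auto intro!: sum.cong simp: indicator_def)
      with \<gamma>0_fine[OF p fine0] have "(\<Sum>(x, K)\<in>q. measure lborel K) < d" by auto
      then have q: "(\<Sum>(x, K)\<in>q. norm (h (Sup K) - h (Inf K))) < e / 2"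
        using d[OF p, of q] by (auto simp: q_def)
      have tag_le: "norm (measure lborel K *\<^sub>R g' x - (h (Sup K) - h (Inf K)))
          \<le> (if x \<in> N' then norm (h (Sup K) - h (Inf K)) else 0) + e' * measure lborel K"
        if xK: "(x, K) \<in> p" for x K
      proof (cases "x \<in> N'")
        case True then show ?thesis using \<open>e' > 0\<close> by (simp add: g'_def norm_minus_commute)
      next
        case False
        obtain u v where K: "K = {u..v}" using tagged_division_ofD(4)[OF p xK] by (auto simp: box_real)
        have x: "x \<in> K" "K \<subseteq> {a..b}" using tagged_division_ofD(2,3)[OF p xK] by auto
        have "K \<subseteq> ball x (r x)" using fine xK unfolding fine_def \<gamma>_def by blast
        then have "norm ((v - u) *\<^sub>R g x - (h v - h u)) \<le> e' * (v - u)"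
          using x K False by (intro r) auto
        then show ?thesis
          using x K False by (simp add: g'_def)
      qed
      have "(\<Sum>(x, K)\<in>p. measure lborel K *\<^sub>R g' x) - (h b - h a)
          = (\<Sum>(x, K)\<in>p. measure lborel K *\<^sub>R g' x - (h (Sup K) - h (Inf K)))"
        unfolding additive_tagged_division_1[OF \<open>a \<le> b\<close> p, symmetric]
        by (simp add: sum_subtractf case_prod_unfold)
      also have "norm \<dots> \<le> (\<Sum>(x, K)\<in>p. (if x \<in> N' then norm (h (Sup K) - h (Inf K)) else 0) + e' * measure lborel K)"
        by (rule sum_norm_le) (use tag_le in auto)
      also have "\<dots> = (\<Sum>(x, K)\<in>q. norm (h (Sup K) - h (Inf K))) + e' * (\<Sum>(x, K)\<in>p. measure lborel K)"
        unfolding q_def case_prod_unfold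
        by (subst sum.inter_filter[OF \<open>finite p\<close>]) (simp add: sum.distrib sum_distrib_left)
      also have "(\<Sum>(x, K)\<in>p. measure lborel K) = b - a"
        using additive_content_tagged_division[of p a b] p \<open>a \<le> b\<close> by (simp add: box_real)
      also have "e' * (b - a) \<le> e / 2"
        using \<open>e > 0\<close> \<open>a \<le> b\<close> by (simp add: e'_def field_simps)
      finally show ?thesis using q by linarith
    qed
    ultimately show "\<exists>\<gamma>. gauge \<gamma> \<and> (\<forall>p. p tagged_division_of {a..b} \<and> \<gamma> fine p \<longrightarrow>
        norm ((\<Sum>(x, K)\<in>p. measure lborel K *\<^sub>R g' x) - (h b - h a)) < e)"
      by (intro exI[of _ \<gamma>]) simp
  qed
  then show ?thesis
    by (rule has_integral_spike[OF \<open>negligible N'\<close>, rotated]) (simp add: g'_def)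
qed

section \<open>Averaging along slow-fast curves\<close>

lemma has_vector_derivative_imp_lipschitz:
  fixes x :: "real \<Rightarrow> 'a::real_normed_vector"
  assumes der: "\<And>s. s \<in> {a..b} \<Longrightarrow> (x has_vector_derivative h s) (at s within {a..b})"
    and M: "\<And>s. s \<in> {a..b} \<Longrightarrow> norm (h s) \<le> M" and "s \<in> {a..b}" "t \<in> {a..b}"
  shows "norm (x s - x t) \<le> M * \<bar>s - t\<bar>"
proof -
  have "norm (x s - x t) \<le> M * norm (s - t)"
  proof (rule differentiable_bound[where S = "{a..b}" and f' = "\<lambda>s r. r *\<^sub>R h s"])
    fix u assume u: "u \<in> {a..b}"
    show "(x has_derivative (\<lambda>r. r *\<^sub>R h u)) (at u within {a..b})"
      using der[OF u] by (simp add: has_vector_derivative_def)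
    show "onorm (\<lambda>r. r *\<^sub>R h u) \<le> M"
      by (rule onorm_le) (use M[OF u] in \<open>auto simp: mult.commute[of M] intro!: mult_left_mono\<close>)
  qed (use assms in auto)
  then show ?thesis by simp
qed

text \<open>Pointwise convergence of derivatives does not by itself differentiate a limit. Bounded
  convergence in the integrated equation does, because \<open>k\<close> is continuous. This
  identifies limits of fast components as boundary layer solutions.\<close>

lemma integral_equation_limit:
  fixes x :: "nat \<Rightarrow> real \<Rightarrow> 'a::euclidean_space"
  assumes "a \<le> b"
    and der: "\<And>n s. s \<in> {a..b} \<Longrightarrow> (x n has_vector_derivative h n s) (at s within {a..b})"
    and M: "\<And>n s. s \<in> {a..b} \<Longrightarrow> norm (h n s) \<le> M"
    and x: "\<And>s. s \<in> {a..b} \<Longrightarrow> (\<lambda>n. x n s) \<longlonglongrightarrow> y s"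
    and h: "\<And>s. s \<in> {a..b} \<Longrightarrow> (\<lambda>n. h n s) \<longlonglongrightarrow> k s"
    and k: "continuous_on {a..b} k" and "s \<in> {a..b}"
  shows "(y has_vector_derivative k s) (at s within {a..b})"
proof -
  have y: "y t = y a + integral {a..t} k" if "t \<in> {a..b}" for t
  proof -
    have int: "(h n has_integral x n t - x n a) {a..t}" for n
      using that by (intro fundamental_theorem_of_calculus)
        (auto intro!: has_vector_derivative_within_subset[OF der])
    have "(\<lambda>n. integral {a..t} (h n)) \<longlonglongrightarrow> integral {a..t} k"
      using int M h that by (intro dominated_convergence(2)[where h = "\<lambda>_. M"]) auto
    then have "(\<lambda>n. x n t - x n a) \<longlonglongrightarrow> integral {a..t} k"
      using integral_unique[OF int] by simp
    moreover have "(\<lambda>n. x n t - x n a) \<longlonglongrightarrow> y t - y a"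
      using that \<open>a \<le> b\<close> by (intro tendsto_diff x) auto
    ultimately show ?thesis using LIMSEQ_unique by fastforce
  qed
  have "((\<lambda>t. y a + integral {a..t} k) has_vector_derivative k s) (at s within {a..b})"
    using has_vector_derivative_add[OF has_vector_derivative_const
        integral_has_vector_derivative[OF k \<open>s \<in> {a..b}\<close>]] by simp
  then show ?thesis
    by (rule has_vector_derivative_transform[OF \<open>s \<in> {a..b}\<close>, rotated]) (rule y)
qed

text \<open>Delta is fixed here: \<open>f\<close> and \<open>fA\<close> are the slow field and its
  average for one value of it, so that thresholds for \<open>\<epsilon>\<close> may depend on that
  value.\<close>

locale averaging =
  fixes C :: "'a::euclidean_space set" and \<Psi> :: "'b::euclidean_space set"
    and f :: "'a \<Rightarrow> 'b \<Rightarrow> 'a" and g :: "'a \<Rightarrow> 'b \<Rightarrow> 'b" and fA :: "'a \<Rightarrow> 'a"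
  assumes closed_C: "closed C" and compact_Psi: "compact \<Psi>"
    and cont_f: "continuous_on (C \<times> \<Psi>) (\<lambda>(p, q). f p q)"
    and cont_g: "continuous_on (C \<times> \<Psi>) (\<lambda>(p, q). g p q)"
    and cont_fA: "continuous_on UNIV fA"
    and averaged: "\<And>K. compact K \<Longrightarrow> \<exists>\<sigma>. class_L \<sigma> \<and>
          (\<forall>L>0. \<forall>p\<in>C \<inter> K. \<forall>c :: real \<Rightarrow> 'b.
             (\<forall>s\<in>{0..L}. c s \<in> \<Psi> \<and> (c has_vector_derivative g p (c s)) (at s within {0..L})) \<longrightarrow>
             norm ((1 / L) *\<^sub>R integral {0..L} (\<lambda>s. f p (c s) - fA p)) \<le> \<sigma> L)"
begin

text \<open>The equations hold at every point, one-sidedly at the ends, and not just almost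
  everywhere; \<open>hybrid_solution_flow\<close> shows that flows of hybrid solutions are of this
  kind.\<close>

definition sp_curve :: "real \<Rightarrow> 'a set \<Rightarrow> real \<Rightarrow> real \<Rightarrow> (real \<Rightarrow> 'a) \<Rightarrow> (real \<Rightarrow> 'b) \<Rightarrow> bool" where
  "sp_curve \<epsilon> K a b \<phi> \<xi> \<longleftrightarrow> (\<forall>s\<in>{a..b}. \<phi> s \<in> C \<inter> K \<and> \<xi> s \<in> \<Psi> \<and>
     (\<phi> has_vector_derivative f (\<phi> s) (\<xi> s)) (at s within {a..b}) \<and>
     (\<xi> has_vector_derivative (1 / \<epsilon>) *\<^sub>R g (\<phi> s) (\<xi> s)) (at s within {a..b}))"

lemma sp_curve_subset:
  assumes "sp_curve \<epsilon> K a b \<phi> \<xi>" "a \<le> c" "d \<le> b"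
  shows "sp_curve \<epsilon> K c d \<phi> \<xi>"
proof -
  have "{c..d} \<subseteq> {a..b}" using assms by auto
  then show ?thesis
    using assms(1) unfolding sp_curve_def by (meson has_vector_derivative_within_subset subsetD)
qed

lemma vector_fields_bounded:
  assumes "compact K"
  obtains M where "M > 0" "\<And>p q. p \<in> C \<inter> K \<Longrightarrow> q \<in> \<Psi> \<Longrightarrow> norm (f p q) \<le> M"
    "\<And>p q. p \<in> C \<inter> K \<Longrightarrow> q \<in> \<Psi> \<Longrightarrow> norm (g p q) \<le> M" "\<And>p. p \<in> K \<Longrightarrow> norm (fA p) \<le> M"
proof -
  have comp: "compact ((C \<inter> K) \<times> \<Psi>)"
    using closed_C compact_Psi assms by (intro compact_Times) (auto simp: closed_Int_compact)
  have "bounded ((\<lambda>(p, q). f p q) ` ((C \<inter> K) \<times> \<Psi>))" "bounded ((\<lambda>(p, q). g p q) ` ((C \<inter> K) \<times> \<Psi>))"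
    using comp by (intro compact_imp_bounded compact_continuous_image;
        auto intro: continuous_on_subset[OF cont_f] continuous_on_subset[OF cont_g])+
  have "bounded (fA ` K)"
    using assms by (intro compact_imp_bounded compact_continuous_image)
      (auto intro: continuous_on_subset[OF cont_fA])
  obtain M1 where M1: "\<forall>z\<in>(\<lambda>(p, q). f p q) ` ((C \<inter> K) \<times> \<Psi>). norm z \<le> M1"
    using \<open>bounded ((\<lambda>(p, q). f p q) ` ((C \<inter> K) \<times> \<Psi>))\<close> unfolding bounded_iff by blast
  obtain M2 where M2: "\<forall>z\<in>(\<lambda>(p, q). g p q) ` ((C \<inter> K) \<times> \<Psi>). norm z \<le> M2"
    using \<open>bounded ((\<lambda>(p, q). g p q) ` ((C \<inter> K) \<times> \<Psi>))\<close> unfolding bounded_iff by blast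
  obtain M3 where M3: "\<forall>z\<in>fA ` K. norm z \<le> M3"
    using \<open>bounded (fA ` K)\<close> unfolding bounded_iff by blast
  define M where "M = max 1 (max M1 (max M2 M3))"
  show ?thesis
  proof (rule that[of M])
    fix p q assume "p \<in> C \<inter> K" "q \<in> \<Psi>"
    then have pq: "(p, q) \<in> (C \<inter> K) \<times> \<Psi>" by auto
    show "norm (f p q) \<le> M" using M1 pq by (force simp: M_def le_max_iff_disj)
    show "norm (g p q) \<le> M" using M2 pq by (force simp: M_def le_max_iff_disj)
  next
    fix p assume "p \<in> K" then show "norm (fA p) \<le> M" using M3 by (force simp: M_def le_max_iff_disj)
  qed (simp add: M_def)
qed

lemma continuous_on_fields:
  assumes "continuous_on S \<phi>" "continuous_on S \<xi>" "\<And>s. s \<in> S \<Longrightarrow> \<phi> s \<in> C" "\<And>s. s \<in> S \<Longrightarrow> \<xi> s \<in> \<Psi>"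
  shows "continuous_on S (\<lambda>s. f (\<phi> s) (\<xi> s))" "continuous_on S (\<lambda>s. g (\<phi> s) (\<xi> s))"
  using continuous_on_compose2[OF cont_f, of S "\<lambda>s. (\<phi> s, \<xi> s)"]
    continuous_on_compose2[OF cont_g, of S "\<lambda>s. (\<phi> s, \<xi> s)"]
    assms
  by (auto intro!: continuous_intros)

lemma continuous_on_fA: "continuous_on S \<phi> \<Longrightarrow> continuous_on S (\<lambda>s. fA (\<phi> s))"
  using continuous_on_compose2[OF cont_fA] by auto

lemma tendsto_fA: "p \<longlonglongrightarrow> p0 \<Longrightarrow> (\<lambda>n. fA (p n)) \<longlonglongrightarrow> fA p0"
  using continuous_on_tendsto_compose[OF cont_fA] by auto

lemma tendsto_fields:
  assumes "\<And>n. p n \<in> C" "\<And>n. q n \<in> \<Psi>" "p \<longlonglongrightarrow> p0" "q \<longlonglongrightarrow> q0"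
  shows "(\<lambda>n. f (p n) (q n)) \<longlonglongrightarrow> f p0 q0" "(\<lambda>n. g (p n) (q n)) \<longlonglongrightarrow> g p0 q0"
proof -
  have *: "p0 \<in> C" "q0 \<in> \<Psi>"
    using assms closed_C compact_imp_closed[OF compact_Psi] closed_sequentially by blast+
  have lim: "(\<lambda>n. (p n, q n)) \<longlonglongrightarrow> (p0, q0)" using assms by (intro tendsto_Pair)
  show "(\<lambda>n. f (p n) (q n)) \<longlonglongrightarrow> f p0 q0"
    using continuous_on_tendsto_compose[OF cont_f lim] * assms by auto
  show "(\<lambda>n. g (p n) (q n)) \<longlonglongrightarrow> g p0 q0"
    using continuous_on_tendsto_compose[OF cont_g lim] * assms by auto
qed

lemma sp_curve_integrable:
  assumes "sp_curve \<epsilon> K a b \<phi> \<xi>"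
  shows "continuous_on {a..b} \<phi>" "continuous_on {a..b} \<xi>"
    "(\<lambda>s. f (\<phi> s) (\<xi> s)) integrable_on {a..b}" "(\<lambda>s. fA (\<phi> s)) integrable_on {a..b}"
proof -
  show c: "continuous_on {a..b} \<phi>" "continuous_on {a..b} \<xi>"
    using assms unfolding sp_curve_def
    by (auto simp: continuous_on_eq_continuous_within intro: has_vector_derivative_continuous)
  show "(\<lambda>s. f (\<phi> s) (\<xi> s)) integrable_on {a..b}" "(\<lambda>s. fA (\<phi> s)) integrable_on {a..b}"
    using assms unfolding sp_curve_def
    by (intro integrable_continuous_real continuous_on_fields continuous_on_fA c; auto)+
qed

text \<open>Time is fast here, so the slow field carries the factor \<open>\<epsilon>\<close>. Along
  violations with \<open>\<epsilon>\<close> tending to 0, Arzela-Ascoli gives a limit whose slow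
  part is a constant \<open>p\<close> and whose fast part is a boundary layer solution for this
  \<open>p\<close>. The limit obeys the bound \<open>S\<close>, yet it inherits at least
  \<open>S + \<eta>\<close>.\<close>

lemma boundary_layer_average:
  assumes K: "compact K" and "L > 0" "\<eta> > 0"
    and S: "\<forall>p\<in>C \<inter> K. \<forall>c. (\<forall>s\<in>{0..L}. c s \<in> \<Psi> \<and>
        (c has_vector_derivative g p (c s)) (at s within {0..L})) \<longrightarrow>
        norm (integral {0..L} (\<lambda>s. f p (c s) - fA p)) \<le> S"
  shows "\<exists>\<epsilon>0>0. \<forall>\<epsilon> \<phi> \<xi>. 0 < \<epsilon> \<longrightarrow> \<epsilon> < \<epsilon>0 \<longrightarrow>
    (\<forall>s\<in>{0..L}. \<phi> s \<in> C \<inter> K \<and> \<xi> s \<in> \<Psi> \<and>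
      (\<phi> has_vector_derivative \<epsilon> *\<^sub>R f (\<phi> s) (\<xi> s)) (at s within {0..L}) \<and>
      (\<xi> has_vector_derivative g (\<phi> s) (\<xi> s)) (at s within {0..L})) \<longrightarrow>
    norm (integral {0..L} (\<lambda>s. f (\<phi> s) (\<xi> s) - fA (\<phi> s))) \<le> S + \<eta>"
proof (rule ccontr)
  let ?P = "\<lambda>\<epsilon> \<phi> \<xi>. \<forall>s\<in>{0..L}. \<phi> s \<in> C \<inter> K \<and> \<xi> s \<in> \<Psi> \<and>
      (\<phi> has_vector_derivative \<epsilon> *\<^sub>R f (\<phi> s) (\<xi> s)) (at s within {0..L}) \<and>
      (\<xi> has_vector_derivative g (\<phi> s) (\<xi> s)) (at s within {0..L})"
  let ?I = "\<lambda>\<phi> \<xi>. integral {0..L} (\<lambda>s. f (\<phi> s) (\<xi> s) - fA (\<phi> s))"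
  assume neg: "\<not> ?thesis"
  have "\<exists>\<epsilon> \<phi> \<xi>. 0 < \<epsilon> \<and> \<epsilon> < inverse (Suc n) \<and> ?P \<epsilon> \<phi> \<xi> \<and> norm (?I \<phi> \<xi>) > S + \<eta>" for n
  proof (rule ccontr)
    assume no: "\<not> ?thesis"
    have "\<exists>\<epsilon>0>0. \<forall>\<epsilon> \<phi> \<xi>. 0 < \<epsilon> \<longrightarrow> \<epsilon> < \<epsilon>0 \<longrightarrow> ?P \<epsilon> \<phi> \<xi> \<longrightarrow> norm (?I \<phi> \<xi>) \<le> S + \<eta>"
    proof (intro exI[of _ "inverse (real (Suc n))"] conjI allI impI)
      fix \<epsilon> \<phi> \<xi> assume "0 < \<epsilon>" "\<epsilon> < inverse (real (Suc n))" "?P \<epsilon> \<phi> \<xi>"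
      then show "norm (?I \<phi> \<xi>) \<le> S + \<eta>" using no not_le by blast
    qed simp
    with neg show False by blast
  qed
  then have "\<forall>n. \<exists>z. 0 < fst z \<and> fst z < inverse (real (Suc n)) \<and> ?P (fst z) (fst (snd z)) (snd (snd z)) \<and>
      norm (?I (fst (snd z)) (snd (snd z))) > S + \<eta>"
    by simp
  then obtain z where z: "\<forall>n. 0 < fst (z n) \<and> fst (z n) < inverse (real (Suc n)) \<and>
      ?P (fst (z n)) (fst (snd (z n))) (snd (snd (z n))) \<and>
      norm (?I (fst (snd (z n))) (snd (snd (z n)))) > S + \<eta>"
    unfolding choice_iff by (elim exE)
  define \<epsilon> \<phi> \<xi> where "\<epsilon> n = fst (z n)" and "\<phi> n = fst (snd (z n))" and "\<xi> n = snd (snd (z n))" for n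
  have e: "0 < \<epsilon> n \<and> \<epsilon> n < inverse (real (Suc n))" and P: "?P (\<epsilon> n) (\<phi> n) (\<xi> n)"
    and I: "norm (?I (\<phi> n) (\<xi> n)) > S + \<eta>" for n
    using z unfolding \<epsilon>_def \<phi>_def \<xi>_def by blast+
  have e0: "\<epsilon> \<longlonglongrightarrow> 0"
    by (rule tendsto_sandwich[OF _ _ tendsto_const LIMSEQ_inverse_real_of_nat])
      (use e less_imp_le in \<open>auto intro!: always_eventually\<close>)
  \<comment> \<open>Makes the Lipschitz bound of the slow parts uniform in \<open>n\<close>, as
    equicontinuity requires.\<close>
  have e1: "\<epsilon> n \<le> 1" for n
    using e[of n] inverse_le_1_iff[of "real (Suc n)"] by simp
  obtain M where M: "M > 0" "\<And>p q. p \<in> C \<inter> K \<Longrightarrow> q \<in> \<Psi> \<Longrightarrow> norm (f p q) \<le> M"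
    "\<And>p q. p \<in> C \<inter> K \<Longrightarrow> q \<in> \<Psi> \<Longrightarrow> norm (g p q) \<le> M" "\<And>p. p \<in> K \<Longrightarrow> norm (fA p) \<le> M"
    using vector_fields_bounded[OF K] by blast
  have lip\<phi>: "norm (\<phi> n s - \<phi> n t) \<le> \<epsilon> n * M * \<bar>s - t\<bar>" if "s \<in> {0..L}" "t \<in> {0..L}" for n s t
    by (rule has_vector_derivative_imp_lipschitz[where h = "\<lambda>s. \<epsilon> n *\<^sub>R f (\<phi> n s) (\<xi> n s)", OF _ _ that])
      (use P[of n] M e[of n] in auto)
  have lip\<xi>: "norm (\<xi> n s - \<xi> n t) \<le> M * \<bar>s - t\<bar>" if "s \<in> {0..L}" "t \<in> {0..L}" for n s t
    by (rule has_vector_derivative_imp_lipschitz[where h = "\<lambda>s. g (\<phi> n s) (\<xi> n s)", OF _ _ that])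
      (use P[of n] M in auto)
  have lip: "norm ((\<phi> n s, \<xi> n s) - (\<phi> n t, \<xi> n t)) \<le> 2 * M * \<bar>s - t\<bar>"
    if "s \<in> {0..L}" "t \<in> {0..L}" for n s t
  proof -
    have "norm (\<phi> n s - \<phi> n t) \<le> M * \<bar>s - t\<bar>"
      using lip\<phi>[OF that, of n] e1[of n] e[of n] M(1)
      by (elim order_trans) (intro mult_right_mono mult_left_le_one_le; simp)
    then show ?thesis
      using lip\<xi>[OF that, of n] norm_Pair_le[of "\<phi> n s - \<phi> n t" "\<xi> n s - \<xi> n t"] by simp
  qed
  obtain B where B: "\<And>z. z \<in> K \<times> \<Psi> \<Longrightarrow> norm z \<le> B"
    using compact_imp_bounded[OF compact_Times[OF K compact_Psi]] unfolding bounded_iff by blast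
  obtain G k where "continuous_on {0..L} G" and k: "strict_mono (k :: nat \<Rightarrow> nat)"
    and unif: "\<And>e. 0 < e \<Longrightarrow> \<exists>N. \<forall>n x. n \<ge> N \<and> x \<in> {0..L} \<longrightarrow> norm ((\<phi> (k n) x, \<xi> (k n) x) - G x) < e"
  proof (rule Arzela_Ascoli[of "{0..L}" "\<lambda>n s. (\<phi> n s, \<xi> n s)" B])
    show "norm (\<phi> n x, \<xi> n x) \<le> B" if "x \<in> {0..L}" for n x
      using P[of n] that by (intro B) auto
    show "\<exists>d>0. \<forall>n y. y \<in> {0..L} \<and> norm (x - y) < d \<longrightarrow> norm ((\<phi> n x, \<xi> n x) - (\<phi> n y, \<xi> n y)) < e"
      if "x \<in> {0..L}" "0 < e" for x e
    proof (intro exI[of _ "e / (2 * M)"] conjI allI impI)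
      fix n y assume y: "y \<in> {0..L} \<and> norm (x - y) < e / (2 * M)"
      have "norm ((\<phi> n x, \<xi> n x) - (\<phi> n y, \<xi> n y)) \<le> 2 * M * \<bar>x - y\<bar>"
        using lip that y by blast
      also have "\<dots> < e" using y M(1) by (simp add: field_simps)
      finally show "norm ((\<phi> n x, \<xi> n x) - (\<phi> n y, \<xi> n y)) < e" .
    qed (use that M in auto)
  qed (use that in auto)
  have limG: "(\<lambda>n. (\<phi> (k n) s, \<xi> (k n) s)) \<longlonglongrightarrow> G s" if "s \<in> {0..L}" for s
    using unif that unfolding LIMSEQ_iff by blast
  have lim\<xi>: "(\<lambda>n. \<xi> (k n) s) \<longlonglongrightarrow> snd (G s)" if "s \<in> {0..L}" for s
    using tendsto_snd[OF limG[OF that]] by simp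
  define p where "p = fst (G 0)"
  have 0: "(0::real) \<in> {0..L}" using \<open>L > 0\<close> by auto
  \<comment> \<open>The Lipschitz constant \<open>\<epsilon> n * M\<close> tends to 0, so the limit
    does not depend on \<open>s\<close>: the slow variable freezes.\<close>
  have lim\<phi>: "(\<lambda>n. \<phi> (k n) s) \<longlonglongrightarrow> p" if "s \<in> {0..L}" for s
  proof -
    have lim0: "(\<lambda>n. \<phi> (k n) 0) \<longlonglongrightarrow> p" unfolding p_def
      using tendsto_fst[OF limG[of 0]] \<open>L > 0\<close> by simp
    have "(\<lambda>n. \<phi> (k n) s - \<phi> (k n) 0) \<longlonglongrightarrow> 0"
    proof (rule Lim_null_comparison)
      show "\<forall>\<^sub>F n in sequentially. norm (\<phi> (k n) s - \<phi> (k n) 0) \<le> \<epsilon> (k n) * M * \<bar>s - 0\<bar>"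
        using lip\<phi>[OF that 0] by (intro always_eventually allI)
      show "(\<lambda>n. \<epsilon> (k n) * M * \<bar>s - 0\<bar>) \<longlonglongrightarrow> 0"
        using LIMSEQ_subseq_LIMSEQ[OF e0 k] by (auto intro!: tendsto_mult_left_zero simp: o_def)
    qed
    from tendsto_add[OF this lim0] show ?thesis by simp
  qed
  have "closed (C \<inter> K)" using closed_C compact_imp_closed[OF K] by blast
  then have p: "p \<in> C \<inter> K"
    by (rule closed_sequentially[OF _ _ lim\<phi>[OF 0]]) (use P 0 in blast)
  have G\<Psi>: "snd (G s) \<in> \<Psi>" if "s \<in> {0..L}" for s
    by (rule closed_sequentially[OF compact_imp_closed[OF compact_Psi] _ lim\<xi>[OF that]]) (use P that in blast)
  have contG: "continuous_on {0..L} (\<lambda>s. snd (G s))"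
    using \<open>continuous_on {0..L} G\<close> by (intro continuous_intros)
  have "((\<lambda>s. snd (G s)) has_vector_derivative g p (snd (G s))) (at s within {0..L})"
    if s: "s \<in> {0..L}" for s
  proof (rule integral_equation_limit[OF _ _ _ _ _ _ s, where x = "\<lambda>n. \<xi> (k n)" and M = M
        and h = "\<lambda>n s. g (\<phi> (k n) s) (\<xi> (k n) s)"])
    show "(\<lambda>n. g (\<phi> (k n) t) (\<xi> (k n) t)) \<longlonglongrightarrow> g p (snd (G t))" if "t \<in> {0..L}" for t
      using P that lim\<phi>[OF that] lim\<xi>[OF that] by (intro tendsto_fields) auto
    show "continuous_on {0..L} (\<lambda>s. g p (snd (G s)))"
      using p G\<Psi> by (intro continuous_on_fields contG continuous_on_const) auto
  qed (use P M lim\<xi> \<open>L > 0\<close> in auto)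
  then have bound: "norm (integral {0..L} (\<lambda>s. f p (snd (G s)) - fA p)) \<le> S"
    using G\<Psi> by (intro S[rule_format, OF p]) auto
  have "(\<lambda>n. ?I (\<phi> (k n)) (\<xi> (k n))) \<longlonglongrightarrow> integral {0..L} (\<lambda>s. f p (snd (G s)) - fA p)"
  proof (rule dominated_convergence(2)[where h = "\<lambda>_. 2 * M"])
    fix n
    have c: "continuous_on {0..L} (\<phi> (k n))" "continuous_on {0..L} (\<xi> (k n))"
      using P[of "k n"] by (auto simp: continuous_on_eq_continuous_within intro: has_vector_derivative_continuous)
    show "(\<lambda>s. f (\<phi> (k n) s) (\<xi> (k n) s) - fA (\<phi> (k n) s)) integrable_on {0..L}"
      using P[of "k n"] by (intro integrable_continuous_real continuous_on_diff continuous_on_fields c continuous_on_fA) auto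
    fix s assume s: "s \<in> {0..L}"
    show "norm (f (\<phi> (k n) s) (\<xi> (k n) s) - fA (\<phi> (k n) s)) \<le> 2 * M"
      using norm_triangle_ineq4[of "f (\<phi> (k n) s) (\<xi> (k n) s)" "fA (\<phi> (k n) s)"] P[of "k n"] s
        M(2)[of "\<phi> (k n) s" "\<xi> (k n) s"] M(4)[of "\<phi> (k n) s"] by auto
  next
    fix s assume s: "s \<in> {0..L}"
    show "(\<lambda>n. f (\<phi> (k n) s) (\<xi> (k n) s) - fA (\<phi> (k n) s)) \<longlonglongrightarrow> f p (snd (G s)) - fA p"
      using P s lim\<phi>[OF s] lim\<xi>[OF s] by (intro tendsto_diff tendsto_fields tendsto_fA) auto
  qed auto
  then have "S + \<eta> \<le> norm (integral {0..L} (\<lambda>s. f p (snd (G s)) - fA p))"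
    by (rule LIMSEQ_le_const[OF tendsto_norm]) (use I less_imp_le in blast)
  with bound \<open>\<eta> > 0\<close> show False by linarith
qed

end

section \<open>Return to slow time and summation over windows\<close>

lemma integral_rescale:
  fixes F :: "real \<Rightarrow> 'a::euclidean_space"
  assumes "\<epsilon> > 0" "F integrable_on {a..a + \<epsilon> * L}"
  shows "integral {0..L} (\<lambda>s. F (a + \<epsilon> * s)) = (1 / \<epsilon>) *\<^sub>R integral {a..a + \<epsilon> * L} F"
proof -
  have "(F has_integral integral {a..a + \<epsilon> * L} F) (cbox a (a + \<epsilon> * L))"
    using assms(2) by (simp add: integrable_integral)
  from has_integral_affinity[OF this, of \<epsilon> a] have
    "((\<lambda>x. F (\<epsilon> *\<^sub>R x + a)) has_integral (1 / \<bar>\<epsilon>\<bar> ^ DIM(real)) *\<^sub>R integral {a..a + \<epsilon> * L} F)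
      ((\<lambda>x. (1 / \<epsilon>) *\<^sub>R x + - ((1 / \<epsilon>) *\<^sub>R a)) ` cbox a (a + \<epsilon> * L))"
    using assms(1) by auto
  moreover have "(\<lambda>x. (1 / \<epsilon>) *\<^sub>R x + - ((1 / \<epsilon>) *\<^sub>R a)) ` cbox a (a + \<epsilon> * L) = {0..L}"
  proof
    show "{0..L} \<subseteq> (\<lambda>x. (1 / \<epsilon>) *\<^sub>R x + - ((1 / \<epsilon>) *\<^sub>R a)) ` cbox a (a + \<epsilon> * L)"
    proof
      fix s assume "s \<in> {0..L}"
      then show "s \<in> (\<lambda>x. (1 / \<epsilon>) *\<^sub>R x + - ((1 / \<epsilon>) *\<^sub>R a)) ` cbox a (a + \<epsilon> * L)"
        using assms(1) by (intro image_eqI[of _ _ "a + \<epsilon> * s"]) (auto simp: field_simps)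
    qed
  qed (use assms(1) in \<open>auto simp: field_simps\<close>)
  ultimately show ?thesis
    using assms(1) by (intro integral_unique) (simp add: add.commute)
qed

context averaging
begin

text \<open>In slow time a window has length \<open>\<epsilon> * L\<close> and the bound acquires
  the same factor \<open>\<epsilon>\<close>. Hence the sum over the roughly
  \<open>T / (\<epsilon> * L)\<close> windows of an interval is bounded independently of
  \<open>\<epsilon>\<close>.\<close>

lemma window_average:
  assumes K: "compact K" and "L > 0" "\<eta> > 0"
    and S: "\<forall>p\<in>C \<inter> K. \<forall>c. (\<forall>s\<in>{0..L}. c s \<in> \<Psi> \<and>
        (c has_vector_derivative g p (c s)) (at s within {0..L})) \<longrightarrow>
        norm (integral {0..L} (\<lambda>s. f p (c s) - fA p)) \<le> S"
  obtains \<epsilon>0 where "\<epsilon>0 > 0" "\<And>\<epsilon> a \<phi> \<xi>. 0 < \<epsilon> \<Longrightarrow> \<epsilon> < \<epsilon>0 \<Longrightarrow> sp_curve \<epsilon> K a (a + \<epsilon> * L) \<phi> \<xi> \<Longrightarrow>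
    norm (integral {a..a + \<epsilon> * L} (\<lambda>s. f (\<phi> s) (\<xi> s) - fA (\<phi> s))) \<le> \<epsilon> * (S + \<eta>)"
proof -
  obtain \<epsilon>0 where "\<epsilon>0 > 0" and \<epsilon>0: "\<forall>\<epsilon> \<phi> \<xi>. 0 < \<epsilon> \<longrightarrow> \<epsilon> < \<epsilon>0 \<longrightarrow>
    (\<forall>s\<in>{0..L}. \<phi> s \<in> C \<inter> K \<and> \<xi> s \<in> \<Psi> \<and>
      (\<phi> has_vector_derivative \<epsilon> *\<^sub>R f (\<phi> s) (\<xi> s)) (at s within {0..L}) \<and>
      (\<xi> has_vector_derivative g (\<phi> s) (\<xi> s)) (at s within {0..L})) \<longrightarrow>
    norm (integral {0..L} (\<lambda>s. f (\<phi> s) (\<xi> s) - fA (\<phi> s))) \<le> S + \<eta>"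
    using boundary_layer_average[OF assms] by (elim exE conjE)
  show ?thesis
  proof (rule that[OF \<open>\<epsilon>0 > 0\<close>])
    fix \<epsilon> a \<phi> \<xi> assume e: "0 < \<epsilon>" "\<epsilon> < \<epsilon>0" and curve: "sp_curve \<epsilon> K a (a + \<epsilon> * L) \<phi> \<xi>"
    let ?l = "\<lambda>s. a + \<epsilon> * s"
    have l: "?l s \<in> {a..a + \<epsilon> * L}" if "s \<in> {0..L}" for s
      using that e by (auto intro!: mult_nonneg_nonneg)
    have chain: "((\<lambda>s. x (?l s)) has_vector_derivative \<epsilon> *\<^sub>R v) (at s within {0..L})"
      if "(x has_vector_derivative v) (at (?l s) within {a..a + \<epsilon> * L})" for x :: "real \<Rightarrow> 'c::real_normed_vector" and v s
    proof -
      have "(?l has_vector_derivative \<epsilon>) (at s within {0..L})"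
        by (auto intro!: derivative_eq_intros simp: has_real_derivative_iff_has_vector_derivative[symmetric])
      moreover have "(x has_vector_derivative v) (at (?l s) within ?l ` {0..L})"
        using that l by (rule_tac has_vector_derivative_within_subset) auto
      ultimately show ?thesis
        using vector_diff_chain_within by (fastforce simp: o_def)
    qed
    have "norm (integral {0..L} (\<lambda>s. f (\<phi> (?l s)) (\<xi> (?l s)) - fA (\<phi> (?l s)))) \<le> S + \<eta>"
    proof (rule \<epsilon>0[rule_format, OF e])
      fix s assume s: "s \<in> {0..L}"
      have c: "\<phi> (?l s) \<in> C \<inter> K" "\<xi> (?l s) \<in> \<Psi>"
        "(\<phi> has_vector_derivative f (\<phi> (?l s)) (\<xi> (?l s))) (at (?l s) within {a..a + \<epsilon> * L})"
        "(\<xi> has_vector_derivative (1 / \<epsilon>) *\<^sub>R g (\<phi> (?l s)) (\<xi> (?l s))) (at (?l s) within {a..a + \<epsilon> * L})"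
        using curve l[OF s] unfolding sp_curve_def by blast+
      show "\<phi> (?l s) \<in> C \<inter> K \<and> \<xi> (?l s) \<in> \<Psi> \<and>
        ((\<lambda>s. \<phi> (?l s)) has_vector_derivative \<epsilon> *\<^sub>R f (\<phi> (?l s)) (\<xi> (?l s))) (at s within {0..L}) \<and>
        ((\<lambda>s. \<xi> (?l s)) has_vector_derivative g (\<phi> (?l s)) (\<xi> (?l s))) (at s within {0..L})"
        using c(1,2) chain[OF c(3)] chain[OF c(4)] e by simp
    qed
    also have "integral {0..L} (\<lambda>s. f (\<phi> (?l s)) (\<xi> (?l s)) - fA (\<phi> (?l s)))
        = (1 / \<epsilon>) *\<^sub>R integral {a..a + \<epsilon> * L} (\<lambda>s. f (\<phi> s) (\<xi> s) - fA (\<phi> s))"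
      using sp_curve_integrable[OF curve] by (intro integral_rescale[OF e(1)] integrable_diff)
    finally show "norm (integral {a..a + \<epsilon> * L} (\<lambda>s. f (\<phi> s) (\<xi> s) - fA (\<phi> s))) \<le> \<epsilon> * (S + \<eta>)"
      using e by (simp add: field_simps)
  qed
qed

text \<open>Every full window contributes at most \<open>2 * \<kappa>\<close> times its length, one
  \<open>\<kappa>\<close> from the decay of \<open>\<sigma>\<close> and one from letting the slow
  variable move. The incomplete last window is short and gets the crude bound \<open>2 * M\<close>
  times its length.\<close>

lemma sp_curve_average:
  assumes K: "compact K" and "T > 0" "\<eta> > 0"
  obtains \<epsilon>0 where "\<epsilon>0 > 0" "\<And>\<epsilon> a b \<phi> \<xi>. 0 < \<epsilon> \<Longrightarrow> \<epsilon> < \<epsilon>0 \<Longrightarrow> a \<le> b \<Longrightarrow> b - a \<le> T \<Longrightarrow> sp_curve \<epsilon> K a b \<phi> \<xi> \<Longrightarrow>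
    norm (integral {a..b} (\<lambda>s. f (\<phi> s) (\<xi> s) - fA (\<phi> s))) \<le> \<eta>"
proof -
  obtain M where M: "M > 0" "\<And>p q. p \<in> C \<inter> K \<Longrightarrow> q \<in> \<Psi> \<Longrightarrow> norm (f p q) \<le> M"
    "\<And>p q. p \<in> C \<inter> K \<Longrightarrow> q \<in> \<Psi> \<Longrightarrow> norm (g p q) \<le> M" "\<And>p. p \<in> K \<Longrightarrow> norm (fA p) \<le> M"
    using vector_fields_bounded[OF K] by blast
  obtain \<sigma> where "class_L \<sigma>" and \<sigma>: "\<forall>L>0. \<forall>p\<in>C \<inter> K. \<forall>c :: real \<Rightarrow> 'b.
             (\<forall>s\<in>{0..L}. c s \<in> \<Psi> \<and> (c has_vector_derivative g p (c s)) (at s within {0..L})) \<longrightarrow>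
             norm ((1 / L) *\<^sub>R integral {0..L} (\<lambda>s. f p (c s) - fA p)) \<le> \<sigma> L"
    using averaged[OF K] by (elim exE conjE)
  \<comment> \<open>With this choice all full windows together contribute at most
    \<open>2 * \<kappa> * T\<close>, which is half of \<open>\<eta>\<close>.\<close>
  define \<kappa> where "\<kappa> = \<eta> / (4 * T)"
  have "\<kappa> > 0" using assms by (simp add: \<kappa>_def)
  have "\<forall>\<^sub>F L in at_top. \<sigma> L < \<kappa> \<and> L > 0"
    using \<open>class_L \<sigma>\<close> \<open>\<kappa> > 0\<close> unfolding class_L_def
    by (intro eventually_conj order_tendstoD(2)[of \<sigma> 0] eventually_gt_at_top) auto
  then obtain L where L: "\<sigma> L < \<kappa>" "L > 0"
    using eventually_happens[of _ "at_top :: real filter"] by auto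
  have "L * \<kappa> > 0" using L \<open>\<kappa> > 0\<close> by simp
  have S: "\<forall>p\<in>C \<inter> K. \<forall>c. (\<forall>s\<in>{0..L}. c s \<in> \<Psi> \<and>
        (c has_vector_derivative g p (c s)) (at s within {0..L})) \<longrightarrow>
        norm (integral {0..L} (\<lambda>s. f p (c s) - fA p)) \<le> L * \<kappa>"
  proof (intro ballI allI impI)
    fix p c assume that: "p \<in> C \<inter> K"
      "\<forall>s\<in>{0..L}. c s \<in> \<Psi> \<and> (c has_vector_derivative g p (c s)) (at s within {0..L})"
    have "norm ((1 / L) *\<^sub>R integral {0..L} (\<lambda>s. f p (c s) - fA p)) \<le> \<sigma> L"
      using \<sigma> L(2) that by blast
    then have "norm (integral {0..L} (\<lambda>s. f p (c s) - fA p)) \<le> L * \<sigma> L"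
      using L by (simp add: field_simps)
    also have "\<dots> \<le> L * \<kappa>" using L by (intro mult_left_mono) auto
    finally show "norm (integral {0..L} (\<lambda>s. f p (c s) - fA p)) \<le> L * \<kappa>" .
  qed
  obtain \<epsilon>1 where "\<epsilon>1 > 0" and \<epsilon>1: "\<And>\<epsilon> a \<phi> \<xi>. 0 < \<epsilon> \<Longrightarrow> \<epsilon> < \<epsilon>1 \<Longrightarrow> sp_curve \<epsilon> K a (a + \<epsilon> * L) \<phi> \<xi> \<Longrightarrow>
    norm (integral {a..a + \<epsilon> * L} (\<lambda>s. f (\<phi> s) (\<xi> s) - fA (\<phi> s))) \<le> \<epsilon> * (L * \<kappa> + L * \<kappa>)"
    using window_average[OF K L(2) \<open>L * \<kappa> > 0\<close> S] by blast
  show ?thesis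
  \<comment> \<open>The second bound makes a window so short that an integrand of size at most
    \<open>2 * M\<close> contributes no more than \<open>\<eta> / 2\<close> over it.\<close>
  proof (rule that[of "min \<epsilon>1 (\<eta> / (4 * M * L))"])
    show "min \<epsilon>1 (\<eta> / (4 * M * L)) > 0" using \<open>\<epsilon>1 > 0\<close> M L assms by simp
    fix \<epsilon> a b \<phi> \<xi> assume e: "0 < \<epsilon>" "\<epsilon> < min \<epsilon>1 (\<eta> / (4 * M * L))" and ab: "a \<le> b" "b - a \<le> T"
      and curve: "sp_curve \<epsilon> K a b \<phi> \<xi>"
    define w where "w = \<epsilon> * L"
    have "w > 0" using e L by (simp add: w_def)
    define F where "F s = f (\<phi> s) (\<xi> s) - fA (\<phi> s)" for s
    have contF: "continuous_on {a..b} F" unfolding F_def using curve sp_curve_integrable(1,2)[OF curve]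
      by (intro continuous_on_diff continuous_on_fields continuous_on_fA) (auto simp: sp_curve_def)
    have intF: "F integrable_on {c..d}" if "a \<le> c" "d \<le> b" for c d
      unfolding F_def using sp_curve_integrable[OF sp_curve_subset[OF curve that]]
      by (intro integrable_diff)
    have win: "norm (integral {a..a + real m * w} F) \<le> real m * (2 * \<kappa> * w)" if "a + real m * w \<le> b" for m
      using that
    proof (induction m)
      case (Suc m)
      have eq: "a + real (Suc m) * w = (a + real m * w) + \<epsilon> * L" by (simp add: w_def algebra_simps)
      have le: "0 \<le> real m * w" "a + real m * w \<le> b" "a + real m * w \<le> a + real (Suc m) * w"
        using Suc.prems \<open>w > 0\<close> by (auto simp: algebra_simps)
      have "norm (integral {a + real m * w..a + real (Suc m) * w} F) \<le> 2 * \<kappa> * w"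
        unfolding F_def eq using e
          \<epsilon>1[of \<epsilon> "a + real m * w" \<phi> \<xi>] sp_curve_subset[OF curve, of "a + real m * w" "(a + real m * w) + \<epsilon> * L"]
          Suc.prems le by (simp add: w_def algebra_simps)
      moreover have "integral {a..a + real (Suc m) * w} F
          = integral {a..a + real m * w} F + integral {a + real m * w..a + real (Suc m) * w} F"
        using le Suc.prems by (intro Henstock_Kurzweil_Integration.integral_combine[symmetric] intF) auto
      ultimately show ?case
        using Suc.IH le norm_triangle_ineq[of "integral {a..a + real m * w} F"
            "integral {a + real m * w..a + real (Suc m) * w} F"]
        by (simp add: algebra_simps)
    qed simp
    define m where "m = nat \<lfloor>(b - a) / w\<rfloor>"
    have m: "real m \<le> (b - a) / w" "(b - a) / w < real m + 1"
      using ab \<open>w > 0\<close> by (auto simp: m_def)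
    define c where "c = a + real m * w"
    have mw: "real m * w \<le> b - a" "b - a < real m * w + w"
      using m \<open>w > 0\<close> by (simp_all add: field_simps)
    have c: "a \<le> c" "c \<le> b" "b - c \<le> w" using mw \<open>w > 0\<close> by (auto simp: c_def)
    have "norm (integral {a..c} F) \<le> 2 * \<kappa> * (real m * w)"
      using win[of m] c by (simp add: c_def algebra_simps)
    also have "\<dots> \<le> 2 * \<kappa> * T" using mw ab \<open>\<kappa> > 0\<close> by (intro mult_left_mono) auto
    also have "\<dots> = \<eta> / 2" using \<open>T > 0\<close> by (simp add: \<kappa>_def)
    finally have 1: "norm (integral {a..c} F) \<le> \<eta> / 2" .
    have "norm (F s) \<le> 2 * M" if "s \<in> {c..b}" for s
      using curve that c M(2)[of "\<phi> s" "\<xi> s"] M(4)[of "\<phi> s"] norm_triangle_ineq4[of "f (\<phi> s) (\<xi> s)" "fA (\<phi> s)"]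
      unfolding F_def sp_curve_def by auto
    then have "norm (integral {c..b} F) \<le> 2 * M * (b - c)"
      using c by (intro integral_bound continuous_on_subset[OF contF]) auto
    also have "\<dots> \<le> 2 * M * w" using M c by (intro mult_left_mono) auto
    also have "\<dots> \<le> \<eta> / 2" using e M L by (simp add: w_def field_simps)
    finally have 2: "norm (integral {c..b} F) \<le> \<eta> / 2" .
    have "integral {a..b} F = integral {a..c} F + integral {c..b} F"
      using c by (intro Henstock_Kurzweil_Integration.integral_combine[symmetric] intF) auto
    then show "norm (integral {a..b} (\<lambda>s. f (\<phi> s) (\<xi> s) - fA (\<phi> s))) \<le> \<eta>"
      using 1 2 norm_triangle_ineq[of "integral {a..c} F" "integral {c..b} F"] unfolding F_def by simp
  qed
qed

text \<open>The fast components need not converge, so the limit is not taken in \<open>f\<close>.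
  Replacing \<open>f\<close> by \<open>fA\<close> costs an integral that tends to 0 by
  \<open>sp_curve_average\<close>, and \<open>fA\<close> depends only on the slow components, which
  do converge.\<close>

lemma sp_curve_limit:
  assumes K: "compact K" and "a < b" and \<epsilon>: "\<epsilon> \<longlonglongrightarrow> 0" "\<And>n. \<epsilon> n > 0"
    and curve: "\<And>n. sp_curve (\<epsilon> n) K a b (\<phi> n) (\<xi> n)"
    and y: "\<And>s. s \<in> {a..b} \<Longrightarrow> (\<lambda>n. \<phi> n s) \<longlonglongrightarrow> y s" and s: "s \<in> {a..b}"
  shows "y s \<in> C \<inter> K" "(y has_vector_derivative fA (y s)) (at s within {a..b})"
proof -
  obtain M where M: "M > 0" "\<And>p q. p \<in> C \<inter> K \<Longrightarrow> q \<in> \<Psi> \<Longrightarrow> norm (f p q) \<le> M"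
    "\<And>p q. p \<in> C \<inter> K \<Longrightarrow> q \<in> \<Psi> \<Longrightarrow> norm (g p q) \<le> M" "\<And>p. p \<in> K \<Longrightarrow> norm (fA p) \<le> M"
    using vector_fields_bounded[OF K] by blast
  have in_CK: "\<phi> n t \<in> C \<inter> K" "\<xi> n t \<in> \<Psi>"
    and der: "(\<phi> n has_vector_derivative f (\<phi> n t) (\<xi> n t)) (at t within {a..b})" if "t \<in> {a..b}" for n t
    using curve that unfolding sp_curve_def by blast+
  have "closed (C \<inter> K)" using closed_C compact_imp_closed[OF K] by blast
  then show "y s \<in> C \<inter> K"
    by (rule closed_sequentially[OF _ _ y[OF s]]) (use in_CK s in blast)
  \<comment> \<open>Convergence is only assumed pointwise, but the common Lipschitz bound survives
    and makes \<open>y\<close> continuous.\<close>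
  have "norm (y t - y u) \<le> M * \<bar>t - u\<bar>" if "t \<in> {a..b}" "u \<in> {a..b}" for t u
  proof (rule LIMSEQ_le_const2[OF tendsto_norm[OF tendsto_diff[OF y y]]])
    show "\<exists>N. \<forall>n\<ge>N. norm (\<phi> n t - \<phi> n u) \<le> M * \<bar>t - u\<bar>"
      using has_vector_derivative_imp_lipschitz[OF der _ that] in_CK M(2) by blast
  qed (use that in auto)
  then have "M-lipschitz_on {a..b} y"
    using M(1) by (intro lipschitz_onI) (auto simp: dist_norm)
  then have conty: "continuous_on {a..b} y" by (rule lipschitz_on_continuous_on)
  have eq: "y t = y a + integral {a..t} (\<lambda>s. fA (y s))" if t: "t \<in> {a..b}" for t
  proof -
    have sub: "sp_curve (\<epsilon> n) K a t (\<phi> n) (\<xi> n)" for n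
      using sp_curve_subset[OF curve] t by auto
    have int: "((\<lambda>s. f (\<phi> n s) (\<xi> n s)) has_integral \<phi> n t - \<phi> n a) {a..t}" for n
      using t sub[of n] unfolding sp_curve_def by (intro fundamental_theorem_of_calculus) auto
    have err: "(\<lambda>n. integral {a..t} (\<lambda>s. f (\<phi> n s) (\<xi> n s) - fA (\<phi> n s))) \<longlonglongrightarrow> 0"
    proof (rule tendstoI)
      fix \<eta> :: real assume "\<eta> > 0"
      then obtain \<epsilon>0 where "\<epsilon>0 > 0" and \<epsilon>0: "\<And>\<epsilon> c d \<phi> \<xi>. 0 < \<epsilon> \<Longrightarrow> \<epsilon> < \<epsilon>0 \<Longrightarrow> c \<le> d \<Longrightarrow> d - c \<le> b - a \<Longrightarrow>
          sp_curve \<epsilon> K c d \<phi> \<xi> \<Longrightarrow> norm (integral {c..d} (\<lambda>s. f (\<phi> s) (\<xi> s) - fA (\<phi> s))) \<le> \<eta> / 2"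
        using sp_curve_average[OF K, of "b - a" "\<eta> / 2"] \<open>a < b\<close> by auto
      have "\<forall>\<^sub>F n in sequentially. \<epsilon> n < \<epsilon>0" using \<epsilon>(1) \<open>\<epsilon>0 > 0\<close> by (rule order_tendstoD)
      then show "\<forall>\<^sub>F n in sequentially. dist (integral {a..t} (\<lambda>s. f (\<phi> n s) (\<xi> n s) - fA (\<phi> n s))) 0 < \<eta>"
      proof eventually_elim
        case (elim n)
        have "norm (integral {a..t} (\<lambda>s. f (\<phi> n s) (\<xi> n s) - fA (\<phi> n s))) \<le> \<eta> / 2"
          using t by (intro \<epsilon>0[OF \<epsilon>(2) elim _ _ sub]) auto
        then show ?case using \<open>\<eta> > 0\<close> by simp
      qed
    qed
    have "(\<lambda>n. integral {a..t} (\<lambda>s. fA (\<phi> n s))) \<longlonglongrightarrow> integral {a..t} (\<lambda>s. fA (y s))"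
    proof (rule dominated_convergence(2)[where h = "\<lambda>_. M"])
      show "(\<lambda>s. fA (\<phi> n s)) integrable_on {a..t}" for n using sp_curve_integrable[OF sub] by blast
      show "norm (fA (\<phi> n s)) \<le> M" if "s \<in> {a..t}" for n s using that t in_CK[of s n] M by auto
      show "(\<lambda>n. fA (\<phi> n s)) \<longlonglongrightarrow> fA (y s)" if "s \<in> {a..t}" for s
        using that t by (intro tendsto_fA y) auto
    qed auto
    from tendsto_add[OF err this]
    have "(\<lambda>n. \<phi> n t - \<phi> n a) \<longlonglongrightarrow> integral {a..t} (\<lambda>s. fA (y s))"
      using integral_unique[OF int] sp_curve_integrable(3,4)[OF sub] by (simp add: integral_diff)
    moreover have "(\<lambda>n. \<phi> n t - \<phi> n a) \<longlonglongrightarrow> y t - y a"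
      using t \<open>a < b\<close> by (intro tendsto_diff y) auto
    ultimately show ?thesis using LIMSEQ_unique by fastforce
  qed
  have "((\<lambda>t. y a + integral {a..t} (\<lambda>s. fA (y s))) has_vector_derivative fA (y s)) (at s within {a..b})"
    using has_vector_derivative_add[OF has_vector_derivative_const
        integral_has_vector_derivative[OF continuous_on_fA[OF conty] s]] by simp
  then show "(y has_vector_derivative fA (y s)) (at s within {a..b})"
    by (rule has_vector_derivative_transform[OF s, rotated]) (rule eq)
qed

end

section \<open>Limits of solutions with finitely many jumps\<close>

text \<open>One further subsequence is taken for each index; \<open>sub\<close> lets the properties
  already achieved survive.\<close>

lemma finite_subsequence:
  fixes P :: "nat \<Rightarrow> (nat \<Rightarrow> nat) \<Rightarrow> bool"
  assumes ex: "\<And>k r. k < n \<Longrightarrow> strict_mono (r :: nat \<Rightarrow> nat) \<Longrightarrow> \<exists>s. strict_mono (s :: nat \<Rightarrow> nat) \<and> P k (r \<circ> s)"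
    and sub: "\<And>k r (s :: nat \<Rightarrow> nat). P k r \<Longrightarrow> strict_mono s \<Longrightarrow> P k (r \<circ> s)"
  shows "\<exists>r. strict_mono (r :: nat \<Rightarrow> nat) \<and> (\<forall>k<n. P k r)"
  using ex
proof (induction n)
  case 0
  show ?case using strict_mono_id by blast
next
  case (Suc n)
  then obtain r where r: "strict_mono r" "\<forall>k<n. P k r" by (meson less_Suc_eq)
  obtain s where s: "strict_mono s" "P n (r \<circ> s)" using Suc.prems[OF lessI r(1)] by blast
  have "\<forall>k<Suc n. P k (r \<circ> s)" using r s sub by (auto simp: less_Suc_eq)
  then show ?case using strict_mono_o[OF r(1) s(1)] by blast
qed

lemma mono_upto:
  fixes ts :: "nat \<Rightarrow> real"
  assumes "\<forall>k\<le>J. ts k \<le> ts (Suc k)" "i \<le> j" "j \<le> Suc J"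
  shows "ts i \<le> ts j"
  using assms(2,3)
proof (induction j rule: dec_induct)
  case (step m)
  then have "ts i \<le> ts m" by simp
  also have "\<dots> \<le> ts (Suc m)" using assms(1) step by simp
  finally show ?case .
qed simp

lemma lipschitz_imp_locally_abs_continuous_on:
  fixes x :: "real \<Rightarrow> 'a::real_normed_vector"
  assumes "M-lipschitz_on {a..b} x"
  shows "locally_abs_continuous_on {a..b} x"
  unfolding locally_abs_continuous_on_def abs_continuous_on_def
proof (intro ballI impI allI)
  fix c d e :: real assume cd: "c \<in> {a..b}" "d \<in> {a..b}" and "e > 0"
  have "M \<ge> 0" using assms by (rule lipschitz_on_nonneg)
  show "\<exists>\<delta>>0. \<forall>(n::nat) u v.
      (\<forall>k<n. u k \<le> v k \<and> {u k..v k} \<subseteq> {c..d}) \<and>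
      (\<forall>k<n. \<forall>l<n. k \<noteq> l \<longrightarrow> v k \<le> u l \<or> v l \<le> u k) \<and> (\<Sum>k<n. v k - u k) < \<delta> \<longrightarrow>
      (\<Sum>k<n. norm (x (v k) - x (u k))) < e"
  proof (intro exI[of _ "e / (M + 1)"] conjI allI impI; (elim conjE)?)
    fix n :: nat and u v
    assume uv: "\<forall>k<n. u k \<le> v k \<and> {u k..v k} \<subseteq> {c..d}" and small: "(\<Sum>k<n. v k - u k) < e / (M + 1)"
    have "norm (x (v k) - x (u k)) \<le> M * (v k - u k)" if "k < n" for k
    proof -
      have "u k \<in> {c..d}" "v k \<in> {c..d}" "u k \<le> v k" using uv that by auto
      then show ?thesis
        using lipschitz_onD[OF assms, of "v k" "u k"] cd by (auto simp: dist_norm)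
    qed
    then have "(\<Sum>k<n. norm (x (v k) - x (u k))) \<le> (\<Sum>k<n. M * (v k - u k))"
      by (intro sum_mono) auto
    also have "\<dots> = M * (\<Sum>k<n. v k - u k)" by (simp add: sum_distrib_left)
    also have "\<dots> \<le> M * (e / (M + 1))" using small \<open>M \<ge> 0\<close> by (intro mult_left_mono) auto
    also have "\<dots> < e" using \<open>e > 0\<close> \<open>M \<ge> 0\<close> by (simp add: field_simps)
    finally show "(\<Sum>k<n. norm (x (v k) - x (u k))) < e" .
  qed (use \<open>e > 0\<close> \<open>M \<ge> 0\<close> in auto)
qed

locale hybrid_averaging = averaging C \<Psi> f g fA
  for C :: "'a::euclidean_space set" and \<Psi> :: "'b::euclidean_space set" and f g fA +
  fixes D :: "'a set" and G :: "'a \<Rightarrow> 'b \<Rightarrow> 'a set"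
  assumes closed_D: "closed D"
    and osc_G: "outer_semicontinuous (\<lambda>(p, q). G p q)"
    and bounded_G: "locally_bounded (\<lambda>(p, q). G p q)"
begin

text \<open>A solution cut off after \<open>J\<close> jumps, stored as \<open>J + 1\<close> pieces
  so that solutions with equal \<open>J\<close> can be compared piece by piece. A piece may be a
  single point, and then no flow equation is imposed: between two jumps, or after the last one, such
  a point need not lie in \<open>C\<close>.\<close>

definition sp_path :: "real \<Rightarrow> 'a set \<Rightarrow> nat \<Rightarrow> (nat \<Rightarrow> real) \<Rightarrow> (nat \<Rightarrow> real \<Rightarrow> 'a) \<Rightarrow> (nat \<Rightarrow> real \<Rightarrow> 'b) \<Rightarrow> bool" where
  "sp_path \<epsilon> K J ts \<phi> \<xi> \<longleftrightarrow> ts 0 = 0 \<and> (\<forall>k\<le>J. ts k \<le> ts (Suc k)) \<and> \<phi> 0 0 \<in> C \<union> D \<and>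
     (\<forall>k\<le>J. \<forall>s\<in>{ts k..ts (Suc k)}. \<phi> k s \<in> K \<and> \<xi> k s \<in> \<Psi>) \<and>
     (\<forall>k\<le>J. ts k < ts (Suc k) \<longrightarrow> sp_curve \<epsilon> K (ts k) (ts (Suc k)) (\<phi> k) (\<xi> k)) \<and>
     (\<forall>k<J. \<phi> k (ts (Suc k)) \<in> D \<and> \<phi> (Suc k) (ts (Suc k)) \<in> G (\<phi> k (ts (Suc k))) (\<xi> k (ts (Suc k))))"

text \<open>The form in which limits arise: uniform bounds yield Lipschitz pieces, and the equation
  is obtained only inside each limit interval, which may have shrunk to a point.\<close>

definition avg_path :: "nat \<Rightarrow> (nat \<Rightarrow> real) \<Rightarrow> (nat \<Rightarrow> real \<Rightarrow> 'a) \<Rightarrow> bool" where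
  "avg_path J ts y \<longleftrightarrow> ts 0 = 0 \<and> (\<forall>k\<le>J. ts k \<le> ts (Suc k)) \<and> y 0 0 \<in> C \<union> D \<and>
     (\<forall>k\<le>J. \<exists>M. M-lipschitz_on {ts k..ts (Suc k)} (y k)) \<and>
     (\<forall>k\<le>J. \<forall>s\<in>{ts k<..<ts (Suc k)}. y k s \<in> C \<and> (y k has_vector_derivative fA (y k s)) (at s)) \<and>
     (\<forall>k<J. y k (ts (Suc k)) \<in> D \<and> y (Suc k) (ts (Suc k)) \<in> avg_jump G \<Psi> (y k (ts (Suc k))))"

lemma avg_path_is_hybrid_solution:
  assumes "avg_path J ts y"
  defines "E \<equiv> \<Union>j<Suc J. {ts j..ts (Suc j)} \<times> {j}"
  shows "is_hybrid_solution C (\<lambda>z. {fA z}) D (avg_jump G \<Psi>) E (\<lambda>(t, j). y j t)"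
proof -
  have ts0: "ts 0 = 0" and mono: "\<forall>k\<le>J. ts k \<le> ts (Suc k)"
    and y0: "y 0 0 \<in> C \<union> D"
    and lip: "\<forall>k\<le>J. \<exists>M. M-lipschitz_on {ts k..ts (Suc k)} (y k)"
    and flow: "\<forall>k\<le>J. \<forall>s\<in>{ts k<..<ts (Suc k)}. y k s \<in> C \<and> (y k has_vector_derivative fA (y k s)) (at s)"
    and jump: "\<forall>k<J. y k (ts (Suc k)) \<in> D \<and> y (Suc k) (ts (Suc k)) \<in> avg_jump G \<Psi> (y k (ts (Suc k)))"
    using assms(1) unfolding avg_path_def by blast+
  note ts_mono = mono_upto[OF mono]
  have E: "(t, j) \<in> E \<longleftrightarrow> j \<le> J \<and> ts j \<le> t \<and> t \<le> ts (Suc j)" for t j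
    unfolding E_def by auto
  have slice: "jslice E j = (if j \<le> J then {ts j..ts (Suc j)} else {})" for j
    unfolding jslice_def E by auto
  have "compact_hybrid_time_domain (E \<inter> ({0..T} \<times> {..j}))" if Tj: "(T, j) \<in> E" for T j
    unfolding compact_hybrid_time_domain_def
  \<comment> \<open>Cutting at \<open>(T, j)\<close> keeps the slices below \<open>j\<close> whole
    and ends slice \<open>j\<close> at \<open>T\<close>.\<close>
  proof (intro exI[of _ "Suc j"] exI[of _ "\<lambda>i. if i \<le> j then ts i else T"] conjI)
    have j: "j \<le> J" "ts j \<le> T" "T \<le> ts (Suc j)" using Tj unfolding E by auto
    show "\<forall>k<Suc j. (if k \<le> j then ts k else T) \<le> (if Suc k \<le> j then ts (Suc k) else T)"
      using j mono by (auto simp: less_Suc_eq_le not_le Suc_le_eq dest: le_antisym)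
    have mem: "(t, i) \<in> E \<inter> ({0..T} \<times> {..j}) \<longleftrightarrow>
      (t, i) \<in> (\<Union>i<Suc j. {if i \<le> j then ts i else T..if Suc i \<le> j then ts (Suc i) else T} \<times> {i})" for t i
    proof (cases "i < j")
      case True
      then have "ts (Suc i) \<le> T" "0 \<le> ts i" using ts_mono[of "Suc i" j] ts_mono[of 0 i] j ts0 by auto
      then show ?thesis using True j by (auto simp: E)
    next
      case False
      have "0 \<le> ts j" using ts_mono[of 0 j] j ts0 by auto
      moreover have "i = j \<or> i > j" using False by linarith
      ultimately show ?thesis using j by (auto simp: E)
    qed
    show "E \<inter> ({0..T} \<times> {..j}) =
      (\<Union>i<Suc j. {if i \<le> j then ts i else T..if Suc i \<le> j then ts (Suc i) else T} \<times> {i})"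
      by (intro equalityI subrelI) (simp_all only: mem)
  qed (use ts0 in auto)
  moreover have "E \<subseteq> {0..} \<times> UNIV"
  proof
    fix z assume "z \<in> E"
    then obtain t j where z: "z = (t, j)" "j \<le> J" "ts j \<le> t" using E by (metis surj_pair)
    then have "0 \<le> t" using ts_mono[of 0 j] ts0 by auto
    then show "z \<in> {0..} \<times> UNIV" using z by auto
  qed
  ultimately have dom: "hybrid_time_domain E" unfolding hybrid_time_domain_def by auto
  have "(0, 0) \<in> E" unfolding E using ts0 mono by auto
  moreover have "hybrid_arc E (\<lambda>(t, j). y j t)"
    unfolding hybrid_arc_def
  proof (intro conjI dom allI impI)
    fix j assume "interior (jslice E j) \<noteq> {}"
    then have "j \<le> J" unfolding slice by (auto split: if_splits)
    then obtain M where "M-lipschitz_on {ts j..ts (Suc j)} (y j)" using lip by blast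
    from lipschitz_imp_locally_abs_continuous_on[OF this]
    show "locally_abs_continuous_on (jslice E j) (\<lambda>t. case (t, j) of (t, j) \<Rightarrow> y j t)"
      using \<open>j \<le> J\<close> unfolding slice by simp
  qed
  moreover have "y 0 0 \<in> closure C \<union> D" using y0 closure_subset by auto
  moreover have "(\<forall>t\<in>interior (jslice E j). y j t \<in> C) \<and>
        (\<exists>N. negligible N \<and> (\<forall>t\<in>interior (jslice E j) - N.
            \<exists>v. (y j has_vector_derivative v) (at t) \<and> v \<in> {fA (y j t)}))" for j
  proof (cases "j \<le> J")
    case True
    then show ?thesis
      using flow unfolding slice by (auto intro!: exI[of _ "{}"])
  qed (simp add: slice, blast intro: negligible_empty)
  moreover have "y j t \<in> D \<and> y (Suc j) t \<in> avg_jump G \<Psi> (y j t)" if "(t, j) \<in> E" "(t, Suc j) \<in> E" for t j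
  proof -
    have "j < J" "t = ts (Suc j)" using that unfolding E by auto
    then show ?thesis using jump by blast
  qed
  ultimately show ?thesis unfolding is_hybrid_solution_def by auto
qed

text \<open>Jump times vary along a sequence, while Arzela-Ascoli needs a common domain. Freezing a
  piece at its end values extends it to all times without increasing its Lipschitz constant.\<close>

definition clamp_time :: "(nat \<Rightarrow> real) \<Rightarrow> nat \<Rightarrow> real \<Rightarrow> real" where
  "clamp_time ts k s = max (ts k) (min s (ts (Suc k)))"

lemma sp_path_lipschitz:
  assumes path: "sp_path \<epsilon> K J ts \<phi> \<xi>" and "k \<le> J"
    and M: "M > 0" "\<And>p q. p \<in> C \<inter> K \<Longrightarrow> q \<in> \<Psi> \<Longrightarrow> norm (f p q) \<le> M"
  shows "norm (\<phi> k (clamp_time ts k s) - \<phi> k (clamp_time ts k t)) \<le> M * \<bar>s - t\<bar>"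
proof (cases "ts k < ts (Suc k)")
  case True
  then have curve: "sp_curve \<epsilon> K (ts k) (ts (Suc k)) (\<phi> k) (\<xi> k)"
    using path \<open>k \<le> J\<close> unfolding sp_path_def by blast
  have "clamp_time ts k r \<in> {ts k..ts (Suc k)}" for r using True by (auto simp: clamp_time_def)
  then have "norm (\<phi> k (clamp_time ts k s) - \<phi> k (clamp_time ts k t)) \<le> M * \<bar>clamp_time ts k s - clamp_time ts k t\<bar>"
    using curve M(2) unfolding sp_curve_def
    by (intro has_vector_derivative_imp_lipschitz[where h = "\<lambda>s. f (\<phi> k s) (\<xi> k s)" and a = "ts k" and b = "ts (Suc k)"]) auto
  also have "\<dots> \<le> M * \<bar>s - t\<bar>" using M(1) by (intro mult_left_mono) (auto simp: clamp_time_def)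
  finally show ?thesis .
next
  case False
  then have "clamp_time ts k s = clamp_time ts k t" by (auto simp: clamp_time_def)
  then show ?thesis using M by simp
qed

lemma sp_path_subsequence:
  fixes ts :: "nat \<Rightarrow> nat \<Rightarrow> real"
  assumes K: "compact K" and path: "\<And>n. sp_path (\<epsilon> n) K J (ts n) (\<phi> n) (\<xi> n)"
    and T: "\<And>n. ts n (Suc J) \<le> T"
  obtains r where "strict_mono r"
    "\<forall>k\<le>J. \<forall>s\<in>{0..T}. convergent (\<lambda>n. \<phi> (r n) k (clamp_time (ts (r n)) k s))"
    "\<forall>k\<le>Suc J. convergent (\<lambda>n. ts (r n) k)"
    "\<forall>k\<le>J. convergent (\<lambda>n. \<xi> (r n) k (ts (r n) (Suc k)))"
proof -
  obtain M where "M > 0" "\<And>p q. p \<in> C \<inter> K \<Longrightarrow> q \<in> \<Psi> \<Longrightarrow> norm (f p q) \<le> M"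
    "\<And>p q. p \<in> C \<inter> K \<Longrightarrow> q \<in> \<Psi> \<Longrightarrow> norm (g p q) \<le> M" "\<And>p. p \<in> K \<Longrightarrow> norm (fA p) \<le> M"
    using vector_fields_bounded[OF K] by blast
  note M = this(1,2)
  \<comment> \<open>The jump times and the fast values at the ends of the pieces ride along as
    components constant in \<open>s\<close>, so that one application of Arzela-Ascoli per piece
    makes them converge too. The fast values are wanted because they enter the jump map.\<close>
  define F where "F k n s = (\<phi> n k (clamp_time (ts n) k s), ts n k, ts n (Suc k), \<xi> n k (ts n (Suc k)))" for k n s
  define P where "P k r \<longleftrightarrow> (\<forall>s\<in>{0..T}. convergent (\<lambda>n. F k (r n) s))" for k r
  have ts: "0 \<le> ts n k" "ts n k \<le> T" if "k \<le> Suc J" for n k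
  proof -
    have m: "ts n 0 = 0" "\<forall>k\<le>J. ts n k \<le> ts n (Suc k)" using path[of n] unfolding sp_path_def by blast+
    show "0 \<le> ts n k" "ts n k \<le> T"
      using mono_upto[OF m(2), of 0 k] mono_upto[OF m(2), of k "Suc J"] T[of n] that m(1) by auto
  qed
  have inK: "\<phi> n k (clamp_time (ts n) k s) \<in> K" "\<xi> n k (ts n (Suc k)) \<in> \<Psi>" if "k \<le> J" for n k s
  proof -
    have "ts n k \<le> ts n (Suc k)" using path[of n] that unfolding sp_path_def by blast
    then have "clamp_time (ts n) k s \<in> {ts n k..ts n (Suc k)}" "ts n (Suc k) \<in> {ts n k..ts n (Suc k)}"
      by (auto simp: clamp_time_def)
    then show "\<phi> n k (clamp_time (ts n) k s) \<in> K" "\<xi> n k (ts n (Suc k)) \<in> \<Psi>"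
      using path[of n] that unfolding sp_path_def by blast+
  qed
  have comp: "compact (K \<times> {0..T} \<times> {0..T} \<times> \<Psi>)"
    using K compact_Psi by (intro compact_Times) auto
  obtain B where B: "\<And>z. z \<in> K \<times> {0..T} \<times> {0..T} \<times> \<Psi> \<Longrightarrow> norm z \<le> B"
    using compact_imp_bounded[OF comp] unfolding bounded_iff by blast
  have "\<exists>r. strict_mono r \<and> (\<forall>k<Suc J. P k r)"
  proof (rule finite_subsequence[where P = P and n = "Suc J"])
    fix k and r :: "nat \<Rightarrow> nat" assume "k < Suc J" "strict_mono r"
    then have "k \<le> J" by simp
    have norm_F: "norm (F k n x - F k n y) \<le> M * \<bar>x - y\<bar>" for n x y
      using sp_path_lipschitz[OF path \<open>k \<le> J\<close> M, of n x y] by (simp add: F_def norm_Pair)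
    obtain h and s :: "nat \<Rightarrow> nat" where "continuous_on {0..T} h" "strict_mono s"
      and h: "\<And>e. 0 < e \<Longrightarrow> \<exists>N. \<forall>n x. n \<ge> N \<and> x \<in> {0..T} \<longrightarrow> norm (F k (r (s n)) x - h x) < e"
    proof (rule Arzela_Ascoli[of "{0..T}" "\<lambda>n. F k (r n)" B])
      show "norm (F k (r n) x) \<le> B" if "x \<in> {0..T}" for n x
        using inK[OF \<open>k \<le> J\<close>] ts \<open>k \<le> J\<close> by (intro B) (auto simp: F_def)
      show "\<exists>d>0. \<forall>n y. y \<in> {0..T} \<and> norm (x - y) < d \<longrightarrow> norm (F k (r n) x - F k (r n) y) < e"
        if "x \<in> {0..T}" "0 < e" for x e
      proof (intro exI[of _ "e / M"] conjI allI impI)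
        fix n y assume y: "y \<in> {0..T} \<and> norm (x - y) < e / M"
        have "norm (F k (r n) x - F k (r n) y) \<le> M * \<bar>x - y\<bar>" by (rule norm_F)
        also have "\<dots> < e" using y M(1) by (simp add: field_simps)
        finally show "norm (F k (r n) x - F k (r n) y) < e" .
      qed (use that M in auto)
    qed (simp, rule that, assumption, assumption, blast)
    have "(\<lambda>n. F k (r (s n)) x) \<longlonglongrightarrow> h x" if "x \<in> {0..T}" for x
      using h that unfolding LIMSEQ_iff by blast
    then have "P k (r \<circ> s)" unfolding P_def o_apply by (blast intro: convergentI)
    then show "\<exists>s. strict_mono s \<and> P k (r \<circ> s)" using \<open>strict_mono s\<close> by blast
  next
    fix k and r s :: "nat \<Rightarrow> nat" assume "P k r" "strict_mono s"
    then show "P k (r \<circ> s)"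
      unfolding P_def using convergent_subseq_convergent[of "\<lambda>n. F k (r n) x" s for x] by (auto simp: o_def)
  qed
  then obtain r where r: "strict_mono r" "\<And>k. k \<le> J \<Longrightarrow> P k r" by (auto simp: less_Suc_eq_le)
  have conv: "convergent (\<lambda>n. \<phi> (r n) k (clamp_time (ts (r n)) k s))" "convergent (\<lambda>n. ts (r n) k)"
    "convergent (\<lambda>n. ts (r n) (Suc k))" "convergent (\<lambda>n. \<xi> (r n) k (ts (r n) (Suc k)))"
    if k: "k \<le> J" and s: "s \<in> {0..T}" for k s
  proof -
    obtain l where l: "(\<lambda>n. F k (r n) s) \<longlonglongrightarrow> l" using r(2)[OF k] s unfolding P_def convergent_def by blast
    from tendsto_fst[OF l] show "convergent (\<lambda>n. \<phi> (r n) k (clamp_time (ts (r n)) k s))"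
      unfolding F_def convergent_def by auto
    from tendsto_fst[OF tendsto_snd[OF l]] show "convergent (\<lambda>n. ts (r n) k)"
      unfolding F_def convergent_def by auto
    from tendsto_fst[OF tendsto_snd[OF tendsto_snd[OF l]]] show "convergent (\<lambda>n. ts (r n) (Suc k))"
      unfolding F_def convergent_def by auto
    from tendsto_snd[OF tendsto_snd[OF tendsto_snd[OF l]]] show "convergent (\<lambda>n. \<xi> (r n) k (ts (r n) (Suc k)))"
      unfolding F_def convergent_def by auto
  qed
  have 0: "(0::real) \<in> {0..T}" using ts[of 0 0] by auto
  show ?thesis
  proof (rule that[OF r(1)])
    show "\<forall>k\<le>Suc J. convergent (\<lambda>n. ts (r n) k)"
    proof (intro allI impI)
      fix k assume "k \<le> Suc J"
      then show "convergent (\<lambda>n. ts (r n) k)"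
        using conv(2)[of k 0] conv(3)[OF _ 0, of J] 0 by (cases "k = Suc J") auto
    qed
  qed (use conv(1) conv(4)[OF _ 0] in blast)+
qed

text \<open>Inside the limit intervals \<open>sp_curve_limit\<close> applies. At a jump, outer
  semicontinuity yields a value of \<open>G\<close> at the limit of the fast variable, about which
  only membership in \<open>\<Psi>\<close> is known; this is where the union over
  \<open>\<Psi>\<close> in the average jump map comes from.\<close>

lemma sp_path_limit:
  assumes K: "compact K" and \<epsilon>: "\<epsilon> \<longlonglongrightarrow> 0" "\<And>n. \<epsilon> n > 0"
    and path: "\<And>n. sp_path (\<epsilon> n) K J (ts n) (\<phi> n) (\<xi> n)"
    and T: "\<And>n. ts n (Suc J) \<le> T"
  obtains r tt y where "strict_mono r" "avg_path J tt y" "(\<lambda>n. ts (r n) (Suc J)) \<longlonglongrightarrow> tt (Suc J)"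
    "(\<lambda>n. \<phi> (r n) 0 0) \<longlonglongrightarrow> y 0 0" "(\<lambda>n. \<phi> (r n) J (ts (r n) (Suc J))) \<longlonglongrightarrow> y J (tt (Suc J))"
proof -
  obtain M where "M > 0" "\<And>p q. p \<in> C \<inter> K \<Longrightarrow> q \<in> \<Psi> \<Longrightarrow> norm (f p q) \<le> M"
    "\<And>p q. p \<in> C \<inter> K \<Longrightarrow> q \<in> \<Psi> \<Longrightarrow> norm (g p q) \<le> M" "\<And>p. p \<in> K \<Longrightarrow> norm (fA p) \<le> M"
    using vector_fields_bounded[OF K] by blast
  note M = this(1,2)
  obtain r where r: "strict_mono r"
    and convs: "\<forall>k\<le>J. \<forall>s\<in>{0..T}. convergent (\<lambda>n. \<phi> (r n) k (clamp_time (ts (r n)) k s))"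
      "\<forall>k\<le>Suc J. convergent (\<lambda>n. ts (r n) k)"
      "\<forall>k\<le>J. convergent (\<lambda>n. \<xi> (r n) k (ts (r n) (Suc k)))"
    by (rule sp_path_subsequence[where \<epsilon> = \<epsilon> and ts = ts and \<phi> = \<phi> and \<xi> = \<xi>, OF K path T])
  note conv = convs[rule_format]
  define \<tau> where "\<tau> n = ts (r n)" for n
  define p where "p n = \<phi> (r n)" for n
  define q where "q n = \<xi> (r n)" for n
  define e where "e n = \<epsilon> (r n)" for n
  have e: "e \<longlonglongrightarrow> 0" "\<And>n. e n > 0"
    using LIMSEQ_subseq_LIMSEQ[OF \<epsilon>(1) r] \<epsilon>(2) by (auto simp: e_def[abs_def] o_def)
  have pth: "sp_path (e n) K J (\<tau> n) (p n) (q n)" for n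
    using path unfolding \<tau>_def p_def q_def e_def by blast
  have \<tau>0: "\<tau> n 0 = 0" and mono: "\<forall>k\<le>J. \<tau> n k \<le> \<tau> n (Suc k)"
    and p0: "p n 0 0 \<in> C \<union> D"
    and inK: "\<forall>k\<le>J. \<forall>s\<in>{\<tau> n k..\<tau> n (Suc k)}. p n k s \<in> K \<and> q n k s \<in> \<Psi>"
    and curve: "\<forall>k\<le>J. \<tau> n k < \<tau> n (Suc k) \<longrightarrow> sp_curve (e n) K (\<tau> n k) (\<tau> n (Suc k)) (p n k) (q n k)"
    and jump: "\<forall>k<J. p n k (\<tau> n (Suc k)) \<in> D \<and> p n (Suc k) (\<tau> n (Suc k)) \<in> G (p n k (\<tau> n (Suc k))) (q n k (\<tau> n (Suc k)))"
    for n
    using pth[of n] unfolding sp_path_def by blast+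
  have \<tau>T: "\<tau> n k \<in> {0..T}" if "k \<le> Suc J" for n k
    using mono_upto[OF mono, of 0 k n] mono_upto[OF mono, of k "Suc J" n] T[of "r n"] that \<tau>0
    by (auto simp: \<tau>_def)
  define tt where "tt k = lim (\<lambda>n. \<tau> n k)" for k
  have tt: "(\<lambda>n. \<tau> n k) \<longlonglongrightarrow> tt k" if "k \<le> Suc J" for k
    using conv(2)[OF that] by (simp add: convergent_LIMSEQ_iff \<tau>_def tt_def)
  have ttT: "tt k \<in> {0..T}" if "k \<le> Suc J" for k
    by (rule closed_sequentially[OF _ _ tt[OF that]]) (use \<tau>T[OF that] in auto)
  define \<Phi> where "\<Phi> n k s = p n k (clamp_time (\<tau> n) k s)" for n k s
  define y where "y k s = lim (\<lambda>n. \<Phi> n k s)" for k s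
  have y: "(\<lambda>n. \<Phi> n k s) \<longlonglongrightarrow> y k s" if "k \<le> J" "s \<in> {0..T}" for k s
    using conv(1)[OF that] by (simp add: convergent_LIMSEQ_iff \<tau>_def p_def \<Phi>_def y_def)
  have lip: "norm (\<Phi> n k s - \<Phi> n k t) \<le> M * \<bar>s - t\<bar>" if "k \<le> J" for n k s t
    unfolding \<Phi>_def by (rule sp_path_lipschitz[OF pth that M])
  \<comment> \<open>Pieces are evaluated at jump times that themselves depend on \<open>n\<close>;
    the common Lipschitz constant makes this harmless.\<close>
  have y_moving: "(\<lambda>n. \<Phi> n k (s n)) \<longlonglongrightarrow> y k s0" if k: "k \<le> J" and "s0 \<in> {0..T}" "s \<longlonglongrightarrow> s0" for k s s0
  proof -
    have "(\<lambda>n. \<Phi> n k (s n) - \<Phi> n k s0) \<longlonglongrightarrow> 0"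
    proof (rule Lim_null_comparison)
      show "\<forall>\<^sub>F n in sequentially. norm (\<Phi> n k (s n) - \<Phi> n k s0) \<le> M * \<bar>s n - s0\<bar>"
        using lip[OF k] by simp
      have "(\<lambda>n. M * \<bar>s n - s0\<bar>) \<longlonglongrightarrow> M * \<bar>s0 - s0\<bar>"
        by (intro tendsto_intros \<open>s \<longlonglongrightarrow> s0\<close>)
      then show "(\<lambda>n. M * \<bar>s n - s0\<bar>) \<longlonglongrightarrow> 0" by simp
    qed
    from tendsto_add[OF this y[OF k \<open>s0 \<in> {0..T}\<close>]] show ?thesis by simp
  qed
  have \<Phi>_end: "\<Phi> n k (\<tau> n (Suc k)) = p n k (\<tau> n (Suc k))" "\<Phi> n k (\<tau> n k) = p n k (\<tau> n k)" if "k \<le> J" for n k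
  proof -
    have "\<tau> n k \<le> \<tau> n (Suc k)" using mono that by blast
    then show "\<Phi> n k (\<tau> n (Suc k)) = p n k (\<tau> n (Suc k))" "\<Phi> n k (\<tau> n k) = p n k (\<tau> n k)"
      unfolding \<Phi>_def clamp_time_def by auto
  qed
  have y_end: "(\<lambda>n. p n k (\<tau> n (Suc k))) \<longlonglongrightarrow> y k (tt (Suc k))" if "k \<le> J" for k
    using y_moving[OF that ttT tt, of "Suc k"] \<Phi>_end that by auto
  have y_start: "(\<lambda>n. p n k (\<tau> n k)) \<longlonglongrightarrow> y k (tt k)" if "k \<le> J" for k
    using y_moving[OF that ttT tt, of k] \<Phi>_end that by auto
  have tt0: "tt 0 = 0" using LIMSEQ_unique[OF tt[of 0]] \<tau>0 by simp
  have start: "(\<lambda>n. p n 0 0) \<longlonglongrightarrow> y 0 0" using y_start[of 0] tt0 \<tau>0 by simp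
  have "avg_path J tt y"
    unfolding avg_path_def
  proof (intro conjI allI impI ballI)
    show "tt 0 = 0" by (rule tt0)
    show "tt k \<le> tt (Suc k)" if "k \<le> J" for k
      by (rule LIMSEQ_le[OF tt tt]) (use that mono in auto)
    have "closed (C \<union> D)" using closed_C closed_D by auto
    then show "y 0 0 \<in> C \<union> D" by (rule closed_sequentially[OF _ _ start]) (use p0 in blast)
  next
    fix k assume k: "k \<le> J"
    have "norm (y k s - y k t) \<le> M * \<bar>s - t\<bar>" if "s \<in> {0..T}" "t \<in> {0..T}" for s t
      by (rule LIMSEQ_le_const2[OF tendsto_norm[OF tendsto_diff[OF y[OF k that(1)] y[OF k that(2)]]]])
        (use lip[OF k] in auto)
    then have "M-lipschitz_on {0..T} (y k)"
      using M(1) by (intro lipschitz_onI) (auto simp: dist_norm)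
    moreover have "{tt k..tt (Suc k)} \<subseteq> {0..T}" using ttT[of k] ttT[of "Suc k"] k by auto
    ultimately show "\<exists>M. M-lipschitz_on {tt k..tt (Suc k)} (y k)" using lipschitz_on_subset by blast
  next
    fix k s assume k: "k \<le> J" and s: "s \<in> {tt k<..<tt (Suc k)}"
    \<comment> \<open>The \<open>n\<close>-th interval need not contain the limit interval, but for
      large \<open>n\<close> it contains \<open>{a..b}\<close>, which has \<open>s\<close> in its
      interior.\<close>
    define a where "a = (tt k + s) / 2"
    define b where "b = (tt (Suc k) + s) / 2"
    have ab: "tt k < a" "a < s" "s < b" "b < tt (Suc k)" using s by (auto simp: a_def b_def)
    have "\<forall>\<^sub>F n in sequentially. \<tau> n k < a" "\<forall>\<^sub>F n in sequentially. \<tau> n (Suc k) > b"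
      using order_tendstoD[OF tt[of k]] order_tendstoD[OF tt[of "Suc k"]] ab k by auto
    then obtain N where N: "\<And>n. n \<ge> N \<Longrightarrow> \<tau> n k < a \<and> \<tau> n (Suc k) > b"
      using eventually_conj unfolding eventually_sequentially by (metis (full_types) linorder_le_cases order_trans)
    have sub: "sp_curve (e (n + N)) K a b (p (n + N) k) (q (n + N) k)" for n
      using N[of "n + N"] ab k by (intro sp_curve_subset[OF curve[rule_format, OF k]]) auto
    have lim: "(\<lambda>n. p (n + N) k u) \<longlonglongrightarrow> y k u" if u: "u \<in> {a..b}" for u
    proof -
      have "u \<in> {0..T}" using u ab ttT[of k] ttT[of "Suc k"] k by auto
      from LIMSEQ_ignore_initial_segment[OF y[OF k this], of N]
      have "(\<lambda>n. \<Phi> (n + N) k u) \<longlonglongrightarrow> y k u" .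
      moreover have "\<Phi> (n + N) k u = p (n + N) k u" for n
        using N[of "n + N"] u by (simp add: \<Phi>_def clamp_time_def)
      ultimately show ?thesis by simp
    qed
    have "s \<in> {a..b}" "a < b" using ab by auto
    note lims = sp_curve_limit[OF K \<open>a < b\<close> LIMSEQ_ignore_initial_segment[OF e(1)] e(2) sub lim \<open>s \<in> {a..b}\<close>]
    show "y k s \<in> C" using lims(1) by blast
    show "(y k has_vector_derivative fA (y k s)) (at s)"
      using lims(2) at_within_Icc_at[of a s b] ab by simp
  next
    fix k assume k: "k < J"
    then have k': "k \<le> J" "Suc k \<le> J" by auto
    show "y k (tt (Suc k)) \<in> D"
      by (rule closed_sequentially[OF closed_D _ y_end[OF k'(1)]]) (use jump k in blast)
    obtain c where c: "(\<lambda>n. q n k (\<tau> n (Suc k))) \<longlonglongrightarrow> c"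
      using conv(3)[OF k'(1)] unfolding convergent_def q_def \<tau>_def by blast
    have "\<tau> n (Suc k) \<in> {\<tau> n k..\<tau> n (Suc k)}" for n using mono[of n] k' by auto
    then have "q n k (\<tau> n (Suc k)) \<in> \<Psi>" for n using inK k' by blast
    then have "c \<in> \<Psi>"
      using closed_sequentially[OF compact_imp_closed[OF compact_Psi] _ c] by blast
    moreover have "y (Suc k) (tt (Suc k)) \<in> G (y k (tt (Suc k))) c"
    proof -
      have "(\<lambda>n. (p n k (\<tau> n (Suc k)), q n k (\<tau> n (Suc k)))) \<longlonglongrightarrow> (y k (tt (Suc k)), c)"
        using y_end[OF k'(1)] c by (rule tendsto_Pair)
      moreover have "\<forall>n. p n (Suc k) (\<tau> n (Suc k)) \<in> (\<lambda>(p, q). G p q) (p n k (\<tau> n (Suc k)), q n k (\<tau> n (Suc k)))"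
        using jump k by auto
      ultimately have "y (Suc k) (tt (Suc k)) \<in> (\<lambda>(p, q). G p q) (y k (tt (Suc k)), c)"
        using osc_G y_start[OF k'(2)] unfolding outer_semicontinuous_def by blast
      then show ?thesis by simp
    qed
    ultimately show "y (Suc k) (tt (Suc k)) \<in> avg_jump G \<Psi> (y k (tt (Suc k)))"
      unfolding avg_jump_def by blast
  qed
  moreover have "(\<lambda>n. ts (r n) (Suc J)) \<longlonglongrightarrow> tt (Suc J)" using tt[of "Suc J"] by (simp add: \<tau>_def)
  moreover have "(\<lambda>n. \<phi> (r n) 0 0) \<longlonglongrightarrow> y 0 0" using start by (simp add: p_def)
  moreover have "(\<lambda>n. \<phi> (r n) J (ts (r n) (Suc J))) \<longlonglongrightarrow> y J (tt (Suc J))"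
    using y_end[of J] by (simp add: p_def \<tau>_def)
  ultimately show ?thesis using that[OF r] by blast
qed

end

section \<open>Truncation and restart of hybrid solutions\<close>

text \<open>A compact time domain consists of an unspecified number of slices; the point
  \<open>(t, j)\<close> forces this number to be \<open>j + 1\<close> and the last cut to be
  \<open>t\<close>.\<close>

lemma hybrid_time_domain_truncation:
  assumes dom: "hybrid_time_domain E" and tj: "(t, j) \<in> E"
  obtains ts where "ts 0 = 0" "\<forall>k\<le>j. ts k \<le> ts (Suc k)" "ts (Suc j) = t"
    "\<forall>s k. (s, k) \<in> E \<and> s \<le> t \<and> k \<le> j \<longleftrightarrow> k \<le> j \<and> ts k \<le> s \<and> s \<le> ts (Suc k)"
proof -
  have "compact_hybrid_time_domain (E \<inter> ({0..t} \<times> {..j}))" and nonneg: "E \<subseteq> {0..} \<times> UNIV"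
    using dom tj unfolding hybrid_time_domain_def by auto
  then obtain J and ts :: "nat \<Rightarrow> real" where ts0: "ts 0 = 0" and mono: "\<forall>k<J. ts k \<le> ts (Suc k)"
    and E: "E \<inter> ({0..t} \<times> {..j}) = (\<Union>i<J. {ts i..ts (Suc i)} \<times> {i})"
    unfolding compact_hybrid_time_domain_def by blast
  have mem: "(s, k) \<in> E \<and> 0 \<le> s \<and> s \<le> t \<and> k \<le> j \<longleftrightarrow> k < J \<and> ts k \<le> s \<and> s \<le> ts (Suc k)" for s k
    using E by (auto simp: set_eq_iff)
  have "0 \<le> t" using nonneg tj by auto
  then have j: "j < J" using mem[of t j] tj by auto
  have "J \<le> Suc j"
  proof (rule ccontr)
    assume "\<not> J \<le> Suc j"
    then show False using mem[of "ts (Suc j)" "Suc j"] mono by auto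
  qed
  with j have J: "J = Suc j" by simp
  have "ts (Suc j) = t"
    using mem[of t j] mem[of "ts (Suc j)" j] mono tj j \<open>0 \<le> t\<close> by force
  then show ?thesis
    using that[of ts] ts0 mono mem nonneg J by (auto simp: less_Suc_eq_le)
qed

text \<open>A jump raises hybrid time by 1, so a prescribed value \<open>c\<close> may be skipped,
  but the next point overshoots it by at most 1.\<close>

lemma hybrid_time_domain_intermediate:
  assumes dom: "hybrid_time_domain E" and tj: "(t, j) \<in> E" and c: "0 \<le> c" "c \<le> t + real j"
  obtains s k where "(s, k) \<in> E" "s \<le> t" "k \<le> j" "c \<le> s + real k" "s + real k \<le> c + 1"
proof -
  obtain ts where ts: "ts 0 = 0" "\<forall>k\<le>j. ts k \<le> ts (Suc k)" "ts (Suc j) = t"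
    and mem': "\<forall>s k. (s, k) \<in> E \<and> s \<le> t \<and> k \<le> j \<longleftrightarrow> k \<le> j \<and> ts k \<le> s \<and> s \<le> ts (Suc k)"
    by (rule hybrid_time_domain_truncation[OF dom tj])
  note mem = mem'[rule_format]
  define k where "k = (LEAST k. c \<le> ts (Suc k) + real k)"
  have ex: "c \<le> ts (Suc j) + real j" using c ts by simp
  have k: "c \<le> ts (Suc k) + real k" "k \<le> j"
    unfolding k_def using ex
    by (rule LeastI[of "\<lambda>k. c \<le> ts (Suc k) + real k" j], rule Least_le[of "\<lambda>k. c \<le> ts (Suc k) + real k" j])
  define s where "s = max (ts k) (c - real k)"
  have "ts k \<le> ts (Suc k)" using ts(2) k by blast
  then have "ts k \<le> s" "s \<le> ts (Suc k)" using k by (auto simp: s_def)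
  then have E: "(s, k) \<in> E" "s \<le> t" using mem[of s k] k by blast+
  \<comment> \<open>By minimality of \<open>k\<close> the preceding slice ends before hybrid time
    \<open>c\<close>, and the jump into slice \<open>k\<close> adds 1.\<close>
  have "ts k + real k \<le> c + 1"
  proof (cases k)
    case 0 then show ?thesis using ts c by simp
  next
    case (Suc i)
    then have "\<not> c \<le> ts (Suc i) + real i"
      using not_less_Least[of i "\<lambda>k. c \<le> ts (Suc k) + real k"] unfolding k_def by simp
    then show ?thesis using Suc by simp
  qed
  then show ?thesis using that[OF E(1,2) k(2)] by (auto simp: s_def)
qed

section \<open>Regularity of solutions during flow\<close>

lemma abs_continuous_on_imp_continuous_on:
  fixes h :: "real \<Rightarrow> 'a::real_normed_vector"
  assumes "abs_continuous_on {a..b} h"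
  shows "continuous_on {a..b} h"
proof (rule continuous_onI)
  fix t and e :: real assume t: "t \<in> {a..b}" and "e > 0"
  obtain d where "d > 0" and d: "\<forall>(n::nat) u v.
      (\<forall>k<n. u k \<le> v k \<and> {u k..v k} \<subseteq> {a..b})
      \<and> (\<forall>k<n. \<forall>l<n. k \<noteq> l \<longrightarrow> v k \<le> u l \<or> v l \<le> u k)
      \<and> (\<Sum>k<n. v k - u k) < d \<longrightarrow> (\<Sum>k<n. norm (h (v k) - h (u k))) < e"
    using assms[unfolded abs_continuous_on_def, rule_format, OF \<open>e > 0\<close>] by (elim exE conjE)
  have small: "norm (h v - h u) < e" if "u \<in> {a..b}" "v \<in> {a..b}" "u \<le> v" "v - u < d" for u v
    using d[rule_format, of 1 "\<lambda>_. u" "\<lambda>_. v"] that by simp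
  show "\<exists>d>0. \<forall>s\<in>{a..b}. dist s t < d \<longrightarrow> dist (h s) (h t) \<le> e"
  proof (intro exI[of _ d] conjI ballI impI)
    fix s assume "s \<in> {a..b}" "dist s t < d"
    then show "dist (h s) (h t) \<le> e"
      using small[of s t] small[of t s] t by (cases "s \<le> t") (auto simp: dist_norm norm_minus_commute)
  qed fact
qed

lemma abs_continuous_on_shift:
  fixes h :: "real \<Rightarrow> 'a::real_normed_vector"
  assumes "abs_continuous_on {s + a..s + b} h"
  shows "abs_continuous_on {a..b} (\<lambda>t. h (s + t))"
  unfolding abs_continuous_on_def
proof (intro allI impI)
  fix e :: real assume "e > 0"
  obtain d where "d > 0" and d: "\<forall>(n::nat) u v.
      (\<forall>k<n. u k \<le> v k \<and> {u k..v k} \<subseteq> {s + a..s + b})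
      \<and> (\<forall>k<n. \<forall>l<n. k \<noteq> l \<longrightarrow> v k \<le> u l \<or> v l \<le> u k)
      \<and> (\<Sum>k<n. v k - u k) < d \<longrightarrow> (\<Sum>k<n. norm (h (v k) - h (u k))) < e"
    using assms[unfolded abs_continuous_on_def, rule_format, OF \<open>e > 0\<close>] by (elim exE conjE)
  show "\<exists>d>0. \<forall>(n::nat) u v.
      (\<forall>k<n. u k \<le> v k \<and> {u k..v k} \<subseteq> {a..b})
      \<and> (\<forall>k<n. \<forall>l<n. k \<noteq> l \<longrightarrow> v k \<le> u l \<or> v l \<le> u k)
      \<and> (\<Sum>k<n. v k - u k) < d \<longrightarrow> (\<Sum>k<n. norm (h (s + v k) - h (s + u k))) < e"
  proof (intro exI[of _ d] conjI allI impI \<open>d > 0\<close>)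
    fix n :: nat and u v
    assume "(\<forall>k<n. u k \<le> v k \<and> {u k..v k} \<subseteq> {a..b})
      \<and> (\<forall>k<n. \<forall>l<n. k \<noteq> l \<longrightarrow> v k \<le> u l \<or> v l \<le> u k) \<and> (\<Sum>k<n. v k - u k) < d"
    then show "(\<Sum>k<n. norm (h (s + v k) - h (s + u k))) < e"
      using d[rule_format, of n "\<lambda>k. s + u k" "\<lambda>k. s + v k"] by simp
  qed
qed

text \<open>The definition of a solution gives the equation almost everywhere in the interior.
  Integrating it and then differentiating the integral of a continuous function gives it everywhere;
  closedness of \<open>C\<close> takes care of the ends of the interval.\<close>

lemma hybrid_solution_flow:
  fixes x :: "real \<times> nat \<Rightarrow> 'a::euclidean_space"
  assumes sol: "is_hybrid_solution C (\<lambda>z. {h z}) D G E x"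
    and "closed C" and cont_h: "continuous_on C h"
    and "a < b" and sub: "{a..b} \<subseteq> jslice E j" and t: "t \<in> {a..b}"
  shows "x (t, j) \<in> C" "((\<lambda>s. x (s, j)) has_vector_derivative h (x (t, j))) (at t within {a..b})"
proof -
  have inner: "{a<..<b} \<subseteq> interior (jslice E j)"
    using sub by (intro interior_maximal) auto
  then have ne: "interior (jslice E j) \<noteq> {}" using \<open>a < b\<close> by (metis greaterThanLessThan_empty_iff not_le subset_empty)
  have "locally_abs_continuous_on (jslice E j) (\<lambda>t. x (t, j))"
    using sol ne unfolding is_hybrid_solution_def hybrid_arc_def by blast
  then have ac: "abs_continuous_on {c..d} (\<lambda>t. x (t, j))" if "c \<in> {a..b}" "d \<in> {a..b}" "c \<le> d" for c d
    using sub that unfolding locally_abs_continuous_on_def by blast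
  have in_C: "x (s, j) \<in> C" if "s \<in> {a<..<b}" for s
    using sol ne inner that unfolding is_hybrid_solution_def by blast
  obtain N where "negligible N" and "\<forall>s\<in>interior (jslice E j) - N.
      \<exists>v. ((\<lambda>s. x (s, j)) has_vector_derivative v) (at s) \<and> v \<in> {h (x (s, j))}"
    using sol ne unfolding is_hybrid_solution_def by blast
  then have der: "((\<lambda>s. x (s, j)) has_vector_derivative h (x (s, j))) (at s)" if "s \<in> {a<..<b} - N" for s
    using inner that by blast
  have cont: "continuous_on {a..b} (\<lambda>s. x (s, j))"
    using ac[of a b] \<open>a < b\<close> by (intro abs_continuous_on_imp_continuous_on) auto
  have in_C': "x (s, j) \<in> C" if "s \<in> {a..b}" for s
  proof -
    have cl: "closure {a<..<b} = {a..b}" using \<open>a < b\<close> by (rule closure_greaterThanLessThan)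
    have "(\<lambda>s. x (s, j)) ` closure {a<..<b} \<subseteq> C"
      by (rule image_closure_subset) (use cont \<open>closed C\<close> in_C in \<open>auto simp: cl\<close>)
    then show ?thesis using that cl by auto
  qed
  then show "x (t, j) \<in> C" using t by blast
  have eq: "x (s, j) = x (a, j) + integral {a..s} (\<lambda>s. h (x (s, j)))" if s: "s \<in> {a..b}" for s
  proof -
    have "((\<lambda>s. h (x (s, j))) has_integral x (s, j) - x (a, j)) {a..s}"
      using s by (intro abs_continuous_on_has_integral[OF _ ac \<open>negligible N\<close> der]) auto
    then show ?thesis by (simp add: integral_unique)
  qed
  have "continuous_on {a..b} (\<lambda>s. h (x (s, j)))"
    using in_C' by (intro continuous_on_compose2[OF cont_h cont]) auto
  then have "((\<lambda>s. x (a, j) + integral {a..s} (\<lambda>s. h (x (s, j)))) has_vector_derivative h (x (t, j))) (at t within {a..b})"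
    using has_vector_derivative_add[OF has_vector_derivative_const integral_has_vector_derivative[OF _ t]] by fastforce
  then show "((\<lambda>s. x (s, j)) has_vector_derivative h (x (t, j))) (at t within {a..b})"
    by (rule has_vector_derivative_transform[OF t, rotated]) (rule eq)
qed

text \<open>The definition constrains the initial point, whereas a last value reached by a jump may
  lie anywhere. A point that is followed by another one either flows on, so it lies in
  \<open>C\<close>, or jumps, so it lies in \<open>D\<close>; thus a solution can be restarted
  there.\<close>

lemma hybrid_solution_nonterminal:
  fixes x :: "real \<times> nat \<Rightarrow> 'a::euclidean_space"
  assumes sol: "is_hybrid_solution C (\<lambda>z. {h z}) D G E x"
    and "closed C" and cont_h: "continuous_on C h"
    and sk: "(s, k) \<in> E" and tj: "(t, j) \<in> E" "s \<le> t" "k \<le> j" "(s, k) \<noteq> (t, j)"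
  shows "x (s, k) \<in> C \<union> D"
proof -
  have dom: "hybrid_time_domain E" using sol unfolding is_hybrid_solution_def hybrid_arc_def by blast
  obtain ts where ts: "ts 0 = 0" "\<forall>k\<le>j. ts k \<le> ts (Suc k)" "ts (Suc j) = t"
    and mem': "\<forall>s k. (s, k) \<in> E \<and> s \<le> t \<and> k \<le> j \<longleftrightarrow> k \<le> j \<and> ts k \<le> s \<and> s \<le> ts (Suc k)"
    by (rule hybrid_time_domain_truncation[OF dom tj(1)])
  note mem = mem'[rule_format]
  have s: "ts k \<le> s" "s \<le> ts (Suc k)" using mem[of s k] sk tj by blast+
  show ?thesis
  proof (cases "s < ts (Suc k)")
    case True
    have "{s..ts (Suc k)} \<subseteq> jslice E k"
      using mem[of _ k] s tj unfolding jslice_def by force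
    from hybrid_solution_flow(1)[OF sol \<open>closed C\<close> cont_h True this, of s] show ?thesis using True by auto
  next
    case False
    then have eq: "s = ts (Suc k)" using s by simp
    have "k \<noteq> j" using eq tj ts(3) by auto
    then have "Suc k \<le> j" using tj by simp
    then have "(s, Suc k) \<in> E" using mem[of s "Suc k"] ts(2) eq by auto
    then show ?thesis using sol sk unfolding is_hybrid_solution_def by blast
  qed
qed

section \<open>Restarting a solution at a later point of its domain\<close>

lemma hybrid_time_domain_shift:
  assumes dom: "hybrid_time_domain E" and sk: "(s, k) \<in> E"
  shows "hybrid_time_domain {(\<tau>, i). 0 \<le> \<tau> \<and> (s + \<tau>, k + i) \<in> E}" (is "hybrid_time_domain ?E'")
  unfolding hybrid_time_domain_def
proof (intro conjI ballI)
  show "?E' \<subseteq> {0..} \<times> UNIV" by auto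
  fix z assume "z \<in> ?E'"
  then obtain T J where z: "z = (T, J)" and T: "0 \<le> T" "(s + T, k + J) \<in> E" by auto
  obtain ts where ts: "ts 0 = 0" "\<forall>i\<le>k + J. ts i \<le> ts (Suc i)" "ts (Suc (k + J)) = s + T"
    and mem': "\<forall>r i. (r, i) \<in> E \<and> r \<le> s + T \<and> i \<le> k + J \<longleftrightarrow> i \<le> k + J \<and> ts i \<le> r \<and> r \<le> ts (Suc i)"
    by (rule hybrid_time_domain_truncation[OF dom T(2)])
  note mem = mem'[rule_format]
  have s: "ts k \<le> s" "s \<le> ts (Suc k)" using mem[of s k] sk T(1) by auto
  \<comment> \<open>Slice \<open>k\<close> is cut at \<open>s\<close>, which becomes time 0; the
    later cuts are merely translated.\<close>
  define ts' where "ts' i = (if i = 0 then 0 else ts (k + i) - s)" for i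
  have "compact_hybrid_time_domain (?E' \<inter> ({0..T} \<times> {..J}))"
    unfolding compact_hybrid_time_domain_def
  proof (intro exI[of _ "Suc J"] exI[of _ ts'] conjI)
    show "ts' 0 = 0" by (simp add: ts'_def)
    show "\<forall>i<Suc J. ts' i \<le> ts' (Suc i)" using ts(2) s by (auto simp: ts'_def)
    have in_E': "(r, i) \<in> ?E' \<inter> ({0..T} \<times> {..J}) \<longleftrightarrow> (r, i) \<in> (\<Union>i<Suc J. {ts' i..ts' (Suc i)} \<times> {i})" for r i
    proof -
      have "(r, i) \<in> ?E' \<inter> ({0..T} \<times> {..J}) \<longleftrightarrow> 0 \<le> r \<and> i \<le> J \<and> ts (k + i) \<le> s + r \<and> s + r \<le> ts (Suc (k + i))"
        using mem[of "s + r" "k + i"] by auto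
      also have "\<dots> \<longleftrightarrow> i \<le> J \<and> ts' i \<le> r \<and> r \<le> ts' (Suc i)"
      proof (cases "i = 0")
        case True
        then show ?thesis using s by (auto simp: ts'_def)
      next
        case False
        have "s \<le> ts (k + i)" if "i \<le> J"
          using mono_upto[OF ts(2), of "Suc k" "k + i"] s False that by auto
        then show ?thesis using False by (auto simp: ts'_def)
      qed
      finally show ?thesis by auto
    qed
    show "?E' \<inter> ({0..T} \<times> {..J}) = (\<Union>i<Suc J. {ts' i..ts' (Suc i)} \<times> {i})"
      by (intro equalityI subrelI) (simp_all only: in_E')
  qed
  then show "case z of (T, J) \<Rightarrow> compact_hybrid_time_domain (?E' \<inter> ({0..T} \<times> {..J}))" using z by simp
qed

lemma hybrid_solution_shift:
  assumes sol: "is_hybrid_solution C F D G E x" and sk: "(s, k) \<in> E"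
    and init: "x (s, k) \<in> closure C \<union> D"
  shows "is_hybrid_solution C F D G {(\<tau>, i). 0 \<le> \<tau> \<and> (s + \<tau>, k + i) \<in> E} (\<lambda>(\<tau>, i). x (s + \<tau>, k + i))"
    (is "is_hybrid_solution C F D G ?E' ?x'")
proof -
  have dom: "hybrid_time_domain E" and arc: "\<And>j. interior (jslice E j) \<noteq> {} \<Longrightarrow>
      locally_abs_continuous_on (jslice E j) (\<lambda>t. x (t, j))"
    and flow: "\<And>j. interior (jslice E j) \<noteq> {} \<Longrightarrow> (\<forall>t\<in>interior (jslice E j). x (t, j) \<in> C) \<and>
        (\<exists>N. negligible N \<and> (\<forall>t\<in>interior (jslice E j) - N.
            \<exists>v. ((\<lambda>s. x (s, j)) has_vector_derivative v) (at t) \<and> v \<in> F (x (t, j))))"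
    and jump: "\<And>t j. (t, j) \<in> E \<Longrightarrow> (t, Suc j) \<in> E \<Longrightarrow> x (t, j) \<in> D \<and> x (t, Suc j) \<in> G (x (t, j))"
    using sol unfolding is_hybrid_solution_def hybrid_arc_def by auto
  have int: "s + t \<in> interior (jslice E (k + j))" if "t \<in> interior (jslice ?E' j)" for t j
  proof -
    have "(+) s ` interior (jslice ?E' j) \<subseteq> interior (jslice E (k + j))"
    proof (rule interior_maximal)
      show "(+) s ` interior (jslice ?E' j) \<subseteq> jslice E (k + j)"
        using interior_subset[of "jslice ?E' j"] unfolding jslice_def by auto
    qed (simp add: open_translation)
    then show ?thesis using that by blast
  qed
  have shift_der: "((\<lambda>r. x (s + r, j)) has_vector_derivative v) (at t)"
    if "((\<lambda>r. x (r, j)) has_vector_derivative v) (at (s + t))" for v t j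
  proof -
    have "((+) s has_vector_derivative 1) (at t)"
      using has_vector_derivative_add[OF has_vector_derivative_const[of s] has_vector_derivative_id] by simp
    from vector_diff_chain_at[OF this that] show ?thesis by (simp add: o_def)
  qed
  have "(0, 0) \<in> ?E'" using sk by simp
  moreover have "hybrid_arc ?E' ?x'"
    unfolding hybrid_arc_def
  proof (intro conjI allI impI hybrid_time_domain_shift[OF dom sk])
    fix j assume "interior (jslice ?E' j) \<noteq> {}"
    then have "interior (jslice E (k + j)) \<noteq> {}" using int by blast
    note ac = arc[OF this]
    show "locally_abs_continuous_on (jslice ?E' j) (\<lambda>t. ?x' (t, j))"
      unfolding locally_abs_continuous_on_def
    proof (intro ballI impI)
      fix a b assume "a \<in> jslice ?E' j" "b \<in> jslice ?E' j" "a \<le> b"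
      then have "abs_continuous_on {s + a..s + b} (\<lambda>t. x (t, k + j))"
        using ac unfolding locally_abs_continuous_on_def jslice_def by auto
      from abs_continuous_on_shift[OF this]
      show "abs_continuous_on {a..b} (\<lambda>t. ?x' (t, j))" by simp
    qed
  qed
  moreover have "?x' (0, 0) \<in> closure C \<union> D" using init by simp
  moreover have "(\<forall>t\<in>interior (jslice ?E' j). ?x' (t, j) \<in> C) \<and>
        (\<exists>N. negligible N \<and> (\<forall>t\<in>interior (jslice ?E' j) - N.
            \<exists>v. ((\<lambda>s. ?x' (s, j)) has_vector_derivative v) (at t) \<and> v \<in> F (?x' (t, j))))"
    if ne: "interior (jslice ?E' j) \<noteq> {}" for j
  proof -
    have ne': "interior (jslice E (k + j)) \<noteq> {}" using int ne by blast
    have C: "\<forall>t\<in>interior (jslice E (k + j)). x (t, k + j) \<in> C" using flow[OF ne'] by (rule conjunct1)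
    obtain N where "negligible N"
      and N: "\<forall>t\<in>interior (jslice E (k + j)) - N.
            \<exists>v. ((\<lambda>s. x (s, k + j)) has_vector_derivative v) (at t) \<and> v \<in> F (x (t, k + j))"
      using flow[OF ne', THEN conjunct2] by (elim exE conjE)
    have "negligible ((+) (- s) ` N)" using \<open>negligible N\<close> by (rule negligible_translation)
    moreover have "\<exists>v. ((\<lambda>s. ?x' (s, j)) has_vector_derivative v) (at t) \<and> v \<in> F (?x' (t, j))"
      if t: "t \<in> interior (jslice ?E' j) - (+) (- s) ` N" for t
    proof -
      have "s + t \<notin> N"
      proof
        assume "s + t \<in> N"
        then have "- s + (s + t) \<in> (+) (- s) ` N" by (rule imageI)
        then show False using t by simp
      qed
      then obtain v where "((\<lambda>s. x (s, k + j)) has_vector_derivative v) (at (s + t))" "v \<in> F (x (s + t, k + j))"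
        using N int t by blast
      then show ?thesis using shift_der by auto
    qed
    ultimately show ?thesis using C int by auto
  qed
  moreover have "?x' (t, j) \<in> D \<and> ?x' (t, Suc j) \<in> G (?x' (t, j))" if "(t, j) \<in> ?E'" "(t, Suc j) \<in> ?E'" for t j
    using jump[of "s + t" "k + j"] that by simp
  ultimately show ?thesis unfolding is_hybrid_solution_def by blast
qed

section \<open>Closeness on finite horizons\<close>

lemma class_KL_antimono:
  assumes "class_KL \<beta>" "0 \<le> r" "0 \<le> s" "s \<le> s'"
  shows "\<beta> r s' \<le> \<beta> r s"
  using assms unfolding class_KL_def class_L_def by blast

lemma class_KL_mono:
  assumes "class_KL \<beta>" "0 \<le> r" "r \<le> r'" "0 \<le> s"
  shows "\<beta> r s \<le> \<beta> r' s"
proof -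
  have "strict_mono_on {0..} (\<lambda>r. \<beta> r s)"
    using assms unfolding class_KL_def class_K_def by blast
  then show ?thesis using assms by (intro strict_mono_on_leD[of "{0..}" "\<lambda>r. \<beta> r s"]) auto
qed

lemma locally_bounded_imp_bounded:
  assumes "locally_bounded H" "compact S"
  shows "bounded (\<Union>(H ` S))"
proof -
  obtain U where U: "\<And>x. open (U x)" "\<And>x. x \<in> U x" "\<And>x. bounded (\<Union>(H ` U x))"
    using assms(1) unfolding locally_bounded_def by metis
  obtain T where T: "finite T" "S \<subseteq> (\<Union>x\<in>T. U x)"
    using compactE_image[OF assms(2), of S U] U by (metis UN_I subsetI)
  have "bounded (\<Union>x\<in>T. \<Union>(H ` U x))" by (rule bounded_UN[OF T(1) ballI[OF U(3)]])
  then show ?thesis by (rule bounded_subset) (use T(2) in blast)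
qed

section \<open>Solutions of the singularly perturbed system as paths\<close>

context hybrid_averaging
begin

definition sp_field :: "real \<Rightarrow> 'a \<times> 'b \<Rightarrow> 'a \<times> 'b" where
  "sp_field \<epsilon> z = (f (fst z) (snd z), (1 / \<epsilon>) *\<^sub>R g (fst z) (snd z))"

definition sp_solution :: "real \<Rightarrow> (real \<times> nat) set \<Rightarrow> (real \<times> nat \<Rightarrow> 'a \<times> 'b) \<Rightarrow> bool" where
  "sp_solution \<epsilon> E z \<longleftrightarrow> is_hybrid_solution (C \<times> \<Psi>) (\<lambda>z. {sp_field \<epsilon> z}) (D \<times> \<Psi>) (sp_jump G) E z"

lemma closed_C_Psi: "closed (C \<times> \<Psi>)"
  by (intro closed_Times closed_C compact_imp_closed[OF compact_Psi])

lemma continuous_on_sp_field: "continuous_on (C \<times> \<Psi>) (sp_field \<epsilon>)"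
  using cont_f cont_g unfolding sp_field_def[abs_def] case_prod_unfold
  by (intro continuous_on_Pair continuous_on_scaleR continuous_on_const)

lemma sp_solution_domain: "sp_solution \<epsilon> E z \<Longrightarrow> hybrid_time_domain E"
  unfolding sp_solution_def is_hybrid_solution_def hybrid_arc_def by blast

lemma sp_solution_jump:
  assumes "sp_solution \<epsilon> E z" "(t, j) \<in> E" "(t, Suc j) \<in> E"
  shows "fst (z (t, j)) \<in> D" "snd (z (t, j)) \<in> \<Psi>" "snd (z (t, Suc j)) = snd (z (t, j))"
    "fst (z (t, Suc j)) \<in> G (fst (z (t, j))) (snd (z (t, j)))"
proof -
  have "z (t, j) \<in> D \<times> \<Psi>" "z (t, Suc j) \<in> sp_jump G (z (t, j))"
    using assms unfolding sp_solution_def is_hybrid_solution_def by blast+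
  then show "fst (z (t, j)) \<in> D" "snd (z (t, j)) \<in> \<Psi>" "snd (z (t, Suc j)) = snd (z (t, j))"
    "fst (z (t, Suc j)) \<in> G (fst (z (t, j))) (snd (z (t, j)))"
    unfolding sp_jump_def by auto
qed

lemma sp_solution_init:
  assumes "sp_solution \<epsilon> E z"
  shows "fst (z (0, 0)) \<in> C \<union> D" "snd (z (0, 0)) \<in> \<Psi>"
proof -
  have "z (0, 0) \<in> closure (C \<times> \<Psi>) \<union> D \<times> \<Psi>"
    using assms unfolding sp_solution_def is_hybrid_solution_def by blast
  then have "z (0, 0) \<in> C \<times> \<Psi> \<union> D \<times> \<Psi>"
    using closed_C_Psi by (simp only: closure_closed)
  then show "fst (z (0, 0)) \<in> C \<union> D" "snd (z (0, 0)) \<in> \<Psi>" by auto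
qed

lemma sp_solution_curve:
  assumes sol: "sp_solution \<epsilon> E z" and "a < b" "{a..b} \<subseteq> jslice E k"
    and K: "\<And>s. s \<in> {a..b} \<Longrightarrow> fst (z (s, k)) \<in> K"
  shows "sp_curve \<epsilon> K a b (\<lambda>s. fst (z (s, k))) (\<lambda>s. snd (z (s, k)))"
  unfolding sp_curve_def
proof
  fix s assume s: "s \<in> {a..b}"
  note flow = hybrid_solution_flow[OF sol[unfolded sp_solution_def] closed_C_Psi continuous_on_sp_field
      \<open>a < b\<close> \<open>{a..b} \<subseteq> jslice E k\<close> s]
  have "((\<lambda>s. fst (z (s, k))) has_vector_derivative fst (sp_field \<epsilon> (z (s, k)))) (at s within {a..b})"
    "((\<lambda>s. snd (z (s, k))) has_vector_derivative snd (sp_field \<epsilon> (z (s, k)))) (at s within {a..b})"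
    using bounded_linear.has_vector_derivative[OF bounded_linear_fst flow(2)]
      bounded_linear.has_vector_derivative[OF bounded_linear_snd flow(2)] by auto
  then show "fst (z (s, k)) \<in> C \<inter> K \<and> snd (z (s, k)) \<in> \<Psi> \<and>
      ((\<lambda>s. fst (z (s, k))) has_vector_derivative f (fst (z (s, k))) (snd (z (s, k)))) (at s within {a..b}) \<and>
      ((\<lambda>s. snd (z (s, k))) has_vector_derivative (1 / \<epsilon>) *\<^sub>R g (fst (z (s, k))) (snd (z (s, k)))) (at s within {a..b})"
    using flow(1) K[OF s] by (auto simp: sp_field_def mem_Times_iff)
qed

text \<open>A last point reached by a jump need not lie in the flow or jump set, but jumps leave the
  fast variable unchanged, so it inherits membership in \<open>\<Psi>\<close> from the point before
  the jump.\<close>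

lemma sp_solution_snd:
  assumes sol: "sp_solution \<epsilon> E z" and tj: "(t, j) \<in> E"
  shows "snd (z (t, j)) \<in> \<Psi>"
proof -
  obtain ts where ts: "ts 0 = 0" "\<forall>k\<le>j. ts k \<le> ts (Suc k)" "ts (Suc j) = t"
    and mem': "\<forall>s k. (s, k) \<in> E \<and> s \<le> t \<and> k \<le> j \<longleftrightarrow> k \<le> j \<and> ts k \<le> s \<and> s \<le> ts (Suc k)"
    by (rule hybrid_time_domain_truncation[OF sp_solution_domain[OF sol] tj])
  note mem = mem'[rule_format]
  show ?thesis
  proof (cases "ts j < t")
    case True
    have "s \<in> jslice E j" if "s \<in> {ts j..t}" for s using mem[of s j] ts(3) that by (auto simp: jslice_def)
    then have "{ts j..t} \<subseteq> jslice E j" by blast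
    from sp_solution_curve[OF sol True this, of UNIV] True show ?thesis unfolding sp_curve_def by auto
  next
    case False
    then have t: "t = ts j" using ts(2,3) by (metis le_refl linorder_not_le order_antisym)
    show ?thesis
    proof (cases j)
      case 0
      then show ?thesis using sp_solution_init(2)[OF sol] t ts(1) by simp
    next
      case (Suc i)
      have "(t, i) \<in> E" using mem[of t i] ts(2) t Suc by auto
      then show ?thesis using sp_solution_jump(2,3)[OF sol, of t i] tj Suc by simp
    qed
  qed
qed

lemma sp_solution_path:
  assumes sol: "sp_solution \<epsilon> E z" and tj: "(t, j) \<in> E"
    and K: "\<And>s k. (s, k) \<in> E \<Longrightarrow> s \<le> t \<Longrightarrow> k \<le> j \<Longrightarrow> fst (z (s, k)) \<in> K"
  shows "\<exists>ts. ts (Suc j) = t \<and> sp_path \<epsilon> K j ts (\<lambda>k s. fst (z (s, k))) (\<lambda>k s. snd (z (s, k)))"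
proof -
  obtain ts where ts: "ts 0 = 0" "\<forall>k\<le>j. ts k \<le> ts (Suc k)" "ts (Suc j) = t"
    and mem': "\<forall>s k. (s, k) \<in> E \<and> s \<le> t \<and> k \<le> j \<longleftrightarrow> k \<le> j \<and> ts k \<le> s \<and> s \<le> ts (Suc k)"
    by (rule hybrid_time_domain_truncation[OF sp_solution_domain[OF sol] tj])
  note mem = mem'[rule_format]
  have "sp_path \<epsilon> K j ts (\<lambda>k s. fst (z (s, k))) (\<lambda>k s. snd (z (s, k)))"
    unfolding sp_path_def
  proof (intro conjI ballI allI impI)
    fix k s assume "k \<le> j" "s \<in> {ts k..ts (Suc k)}"
    then have "(s, k) \<in> E \<and> s \<le> t \<and> k \<le> j" using mem[of s k] by auto
    then show "fst (z (s, k)) \<in> K" "snd (z (s, k)) \<in> \<Psi>" using K sp_solution_snd[OF sol] by blast+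
  next
    fix k assume k: "k \<le> j" "ts k < ts (Suc k)"
    have "(s, k) \<in> E \<and> s \<le> t" if "s \<in> {ts k..ts (Suc k)}" for s using mem[of s k] k that by auto
    then show "sp_curve \<epsilon> K (ts k) (ts (Suc k)) (\<lambda>s. fst (z (s, k))) (\<lambda>s. snd (z (s, k)))"
      using K k by (intro sp_solution_curve[OF sol]) (auto simp: jslice_def)
  next
    fix k assume k: "k < j"
    have "(ts (Suc k), k) \<in> E" "(ts (Suc k), Suc k) \<in> E"
      using mem[of "ts (Suc k)" k] mem[of "ts (Suc k)" "Suc k"] ts(2) k by auto
    from sp_solution_jump[OF sol this]
    show "fst (z (ts (Suc k), k)) \<in> D"
      "fst (z (ts (Suc k), Suc k)) \<in> G (fst (z (ts (Suc k), k))) (snd (z (ts (Suc k), k)))"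
      by blast+
  qed (use ts sp_solution_init[OF sol] in auto)
  then show ?thesis using ts(3) by blast
qed

lemma sp_solution_shift:
  assumes sol: "sp_solution \<epsilon> E z" and sk: "(s, k) \<in> E"
    and tj: "(t, j) \<in> E" "s \<le> t" "k \<le> j" "(s, k) \<noteq> (t, j)"
  shows "sp_solution \<epsilon> {(\<tau>, i). 0 \<le> \<tau> \<and> (s + \<tau>, k + i) \<in> E} (\<lambda>(\<tau>, i). z (s + \<tau>, k + i))"
proof -
  have "z (s, k) \<in> C \<times> \<Psi> \<union> D \<times> \<Psi>"
    by (rule hybrid_solution_nonterminal[OF sol[unfolded sp_solution_def] closed_C_Psi continuous_on_sp_field sk tj])
  then have "z (s, k) \<in> closure (C \<times> \<Psi>) \<union> D \<times> \<Psi>"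
    by (simp only: closure_closed[OF closed_C_Psi])
  from hybrid_solution_shift[OF sol[unfolded sp_solution_def] sk this] show ?thesis
    unfolding sp_solution_def .
qed

end

text \<open>The function \<open>W\<close> is a proper indicator inside \<open>B\<close> and exceeds \<open>M\<close> outside, so that the estimate
  for the average system also expresses that its solutions stay in \<open>B\<close>.\<close>

locale average_stable = hybrid_averaging C \<Psi> f g fA D G
  for C :: "'a::euclidean_space set" and \<Psi> :: "'b::euclidean_space set" and f g fA D G +
  fixes B K0 :: "'a set" and W :: "'a \<Rightarrow> real" and \<beta> :: "real \<Rightarrow> real \<Rightarrow> real" and M \<nu>' \<nu> :: real
  assumes open_B: "open B" and cont_W: "continuous_on B W" and W_nonneg: "\<And>x. x \<in> B \<Longrightarrow> 0 \<le> W x"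
    and sublevel: "\<And>c. compact {x \<in> B. W x \<le> c}" and W_outside: "\<And>x. x \<notin> B \<Longrightarrow> M < W x"
    and KL: "class_KL \<beta>" and K0: "compact K0" "K0 \<subseteq> B" "\<And>x. x \<in> K0 \<Longrightarrow> W x \<le> M"
    and M_bound: "\<And>x. x \<in> K0 \<Longrightarrow> \<beta> (W x) 0 + \<nu> \<le> M" and \<nu>: "\<nu>' < \<nu>"
    and average_bound: "\<And>J ts y. avg_path J ts y \<Longrightarrow> y 0 0 \<in> K0 \<Longrightarrow>
      W (y J (ts (Suc J))) \<le> \<beta> (W (y 0 0)) (ts (Suc J) + real J) + \<nu>'"
begin

text \<open>\<open>M\<close> dominates every level that the estimate permits from \<open>K0\<close>,
  and \<open>W\<close> exceeds \<open>M\<close> off \<open>B\<close>; so the estimate carries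
  membership in \<open>B\<close> with it.\<close>

lemma below_M:
  assumes "x0 \<in> K0" "0 \<le> s" "W x \<le> \<beta> (W x0) s + \<nu>"
  shows "x \<in> B" "W x \<le> M"
proof -
  have "\<beta> (W x0) s \<le> \<beta> (W x0) 0"
    using assms W_nonneg K0(2) by (intro class_KL_antimono[OF KL]) auto
  then show "W x \<le> M" using assms(3) M_bound[OF assms(1)] by simp
  then show "x \<in> B" using W_outside[of x] by force
qed

text \<open>For fixed \<open>J\<close>, violations with \<open>\<epsilon>\<close> tending to 0
  accumulate at a path of the average system starting in the compact set \<open>K0\<close>. Its
  endpoint obeys the estimate with \<open>\<nu>'\<close>, while the violations still leave an excess
  of at least \<open>\<nu>\<close> in the limit.\<close>

lemma sp_path_bound:
  assumes K: "compact K"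
  shows "\<exists>\<epsilon>0>0. \<forall>\<epsilon> ts \<phi> \<xi>. 0 < \<epsilon> \<longrightarrow> \<epsilon> < \<epsilon>0 \<longrightarrow> sp_path \<epsilon> K J ts \<phi> \<xi> \<longrightarrow> \<phi> 0 0 \<in> K0 \<longrightarrow>
    ts (Suc J) \<le> T \<longrightarrow> W (\<phi> J (ts (Suc J))) \<le> \<beta> (W (\<phi> 0 0)) (ts (Suc J) + real J) + \<nu>"
    (is ?goal)
proof (rule ccontr)
  assume neg: "\<not> ?goal"
  define Q where "Q = (\<lambda>(\<epsilon>, ts, \<phi>, \<xi>). sp_path \<epsilon> K J ts \<phi> \<xi> \<and> \<phi> 0 0 \<in> K0 \<and> ts (Suc J) \<le> T \<and>
    \<not> W (\<phi> J (ts (Suc J))) \<le> \<beta> (W (\<phi> 0 0)) (ts (Suc J) + real J) + \<nu>)"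
  have "\<exists>z. 0 < fst z \<and> fst z < inverse (real (Suc n)) \<and> Q z" for n
  proof (rule ccontr)
    assume no: "\<not> ?thesis"
    have ?goal
    proof (intro exI[of _ "inverse (real (Suc n))"] conjI allI impI)
      fix \<epsilon> ts \<phi> \<xi>
      assume "0 < \<epsilon>" "\<epsilon> < inverse (real (Suc n))" "sp_path \<epsilon> K J ts \<phi> \<xi>" "\<phi> 0 0 \<in> K0" "ts (Suc J) \<le> T"
      moreover from this have "\<not> Q (\<epsilon>, ts, \<phi>, \<xi>)" using no by auto
      ultimately show "W (\<phi> J (ts (Suc J))) \<le> \<beta> (W (\<phi> 0 0)) (ts (Suc J) + real J) + \<nu>"
        unfolding Q_def by simp
    qed simp
    with neg show False by (rule notE)
  qed
  then obtain z where z: "\<And>n. 0 < fst (z n) \<and> fst (z n) < inverse (real (Suc n)) \<and> Q (z n)" by metis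
  define \<epsilon> ts \<phi> \<xi> where "\<epsilon> n = fst (z n)" and "ts n = fst (snd (z n))" and "\<phi> n = fst (snd (snd (z n)))"
    and "\<xi> n = snd (snd (snd (z n)))" for n
  have e: "0 < \<epsilon> n" "\<epsilon> n < inverse (real (Suc n))" and path: "sp_path (\<epsilon> n) K J (ts n) (\<phi> n) (\<xi> n)"
    and inK0: "\<phi> n 0 0 \<in> K0" and T: "ts n (Suc J) \<le> T"
    and bad: "\<beta> (W (\<phi> n 0 0)) (ts n (Suc J) + real J) + \<nu> < W (\<phi> n J (ts n (Suc J)))" for n
    using z[of n] unfolding Q_def \<epsilon>_def ts_def \<phi>_def \<xi>_def by (auto simp: case_prod_unfold)
  have e0: "\<epsilon> \<longlonglongrightarrow> 0"
    by (rule tendsto_sandwich[OF _ _ tendsto_const LIMSEQ_inverse_real_of_nat])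
      (use e less_imp_le in \<open>auto intro!: always_eventually\<close>)
  obtain r tt y where r: "strict_mono r" and avg: "avg_path J tt y"
    and lim_t: "(\<lambda>n. ts (r n) (Suc J)) \<longlonglongrightarrow> tt (Suc J)" and lim_0: "(\<lambda>n. \<phi> (r n) 0 0) \<longlonglongrightarrow> y 0 0"
    and lim_end: "(\<lambda>n. \<phi> (r n) J (ts (r n) (Suc J))) \<longlonglongrightarrow> y J (tt (Suc J))"
    by (rule sp_path_limit[where \<epsilon> = \<epsilon> and ts = ts and \<phi> = \<phi> and \<xi> = \<xi>, OF K e0 e(1) path T])
  define x where "x = y J (tt (Suc J))"
  define S where "S = tt (Suc J) + real J"
  have y0: "y 0 0 \<in> K0"
    by (rule closed_sequentially[OF compact_imp_closed[OF K0(1)] _ lim_0]) (use inK0 in blast)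
  have "tt 0 \<le> tt (Suc J)" "tt 0 = 0"
    using avg mono_upto[of J tt 0 "Suc J"] unfolding avg_path_def by auto
  then have "0 \<le> S" by (simp add: S_def)
  have ts_nonneg: "0 \<le> ts n (Suc J)" for n
    using path[of n] mono_upto[of J "ts n" 0 "Suc J"] unfolding sp_path_def by auto
  have x: "W x \<le> \<beta> (W (y 0 0)) S + \<nu>'" using average_bound[OF avg y0] by (simp add: x_def S_def)
  \<comment> \<open>\<open>W\<close> is known to be continuous only on \<open>B\<close>, so its
    values may be passed to the limit only now that the limit endpoint is located there.\<close>
  then have "x \<in> B" using below_M(1)[OF y0 \<open>0 \<le> S\<close>] \<nu> by simp
  have W_lim: "(\<lambda>n. W (p n)) \<longlonglongrightarrow> W l" if "p \<longlonglongrightarrow> l" "l \<in> B" for p l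
    using that cont_W open_B by (intro isCont_tendsto_compose[of l W]) (auto simp: continuous_on_eq_continuous_at)
  have W0: "(\<lambda>n. W (\<phi> (r n) 0 0)) \<longlonglongrightarrow> W (y 0 0)" using W_lim[OF lim_0] y0 K0(2) by blast
  have We: "(\<lambda>n. W (\<phi> (r n) J (ts (r n) (Suc J)))) \<longlonglongrightarrow> W x"
    using W_lim[OF lim_end] \<open>x \<in> B\<close> unfolding x_def by blast
  have S_lim: "(\<lambda>n. ts (r n) (Suc J) + real J) \<longlonglongrightarrow> S"
    unfolding S_def by (intro tendsto_add lim_t tendsto_const)
  have cont: "continuous_on ({0..} \<times> {0..}) (\<lambda>(r, s). \<beta> r s)" using KL unfolding class_KL_def by blast
  have "(\<lambda>n. (\<lambda>(r, s). \<beta> r s) (W (\<phi> (r n) 0 0), ts (r n) (Suc J) + real J)) \<longlonglongrightarrow> (\<lambda>(r, s). \<beta> r s) (W (y 0 0), S)"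
  proof (rule continuous_on_tendsto_compose[OF cont tendsto_Pair[OF W0 S_lim]])
    show "(W (y 0 0), S) \<in> {0..} \<times> {0..}" using W_nonneg y0 K0(2) \<open>0 \<le> S\<close> by auto
    show "\<forall>\<^sub>F n in sequentially. (W (\<phi> (r n) 0 0), ts (r n) (Suc J) + real J) \<in> {0..} \<times> {0..}"
      using W_nonneg inK0 K0(2) ts_nonneg by (intro always_eventually) auto
  qed
  then have "(\<lambda>n. \<beta> (W (\<phi> (r n) 0 0)) (ts (r n) (Suc J) + real J) + \<nu>) \<longlonglongrightarrow> \<beta> (W (y 0 0)) S + \<nu>"
    by (intro tendsto_add tendsto_const) simp
  from LIMSEQ_le[OF this We] have "\<beta> (W (y 0 0)) S + \<nu> \<le> W x" using bad less_imp_le by blast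
  with x \<nu> show False by simp
qed

text \<open>A solution violating the bound has a truncation, ending at the first violation or shortly
  afterwards, that stays in a fixed compact set and ends in a violation.\<close>

lemma sp_solution_first_violation:
  obtains K where "compact K" and "\<And>\<epsilon> E z t j T. sp_solution \<epsilon> E z \<Longrightarrow> fst (z (0, 0)) \<in> K0 \<Longrightarrow> (t, j) \<in> E \<Longrightarrow>
    t + real j \<le> T \<Longrightarrow> \<beta> (W (fst (z (0, 0)))) (t + real j) + \<nu> < W (fst (z (t, j))) \<Longrightarrow>
    \<exists>t' j'. (t', j') \<in> E \<and> t' + real j' \<le> T \<and>
      \<beta> (W (fst (z (0, 0)))) (t' + real j') + \<nu> < W (fst (z (t', j'))) \<and>
      (\<forall>s k. (s, k) \<in> E \<longrightarrow> s \<le> t' \<longrightarrow> k \<le> j' \<longrightarrow> fst (z (s, k)) \<in> K)"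
proof -
  \<comment> \<open>Points without a violation have level at most \<open>M\<close>; the extra 1
    leaves room to follow a flow slightly past the last of them.\<close>
  define K1 where "K1 = {x \<in> B. W x \<le> M + 1}"
  \<comment> \<open>A violation may appear immediately after a jump. Such a point lies in the image
    of \<open>K1\<close> and \<open>\<Psi>\<close> under \<open>G\<close>, which is bounded by local
    boundedness.\<close>
  define K where "K = K1 \<union> closure (\<Union>((\<lambda>(p, q). G p q) ` (K1 \<times> \<Psi>)))"
  have K1: "compact K1" unfolding K1_def by (rule sublevel)
  have "bounded (\<Union>((\<lambda>(p, q). G p q) ` (K1 \<times> \<Psi>)))"
    by (intro locally_bounded_imp_bounded bounded_G compact_Times K1 compact_Psi)
  then have "compact K" unfolding K_def using K1 by (intro compact_Un) (auto simp: compact_closure)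
  have G_K: "p' \<in> K" if "p \<in> K1" "q \<in> \<Psi>" "p' \<in> G p q" for p q p'
  proof -
    have "p' \<in> \<Union>((\<lambda>(p, q). G p q) ` (K1 \<times> \<Psi>))" using that by (intro UnionI[of "G p q"]) auto
    then show ?thesis unfolding K_def by (intro UnI2 subsetD[OF closure_subset])
  qed
  show ?thesis
  proof (rule that[OF \<open>compact K\<close>])
    fix \<epsilon> E z t0 j0 T
    assume sol: "sp_solution \<epsilon> E z" and z0: "fst (z (0, 0)) \<in> K0" and tj0: "(t0, j0) \<in> E" "t0 + real j0 \<le> T"
      and bad0: "\<beta> (W (fst (z (0, 0)))) (t0 + real j0) + \<nu> < W (fst (z (t0, j0)))"
    define bad where "bad t j \<longleftrightarrow> \<beta> (W (fst (z (0, 0)))) (t + real j) + \<nu> < W (fst (z (t, j)))" for t j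
    have dom: "hybrid_time_domain E" by (rule sp_solution_domain[OF sol])
    have E_nonneg: "0 \<le> t" if "(t, j) \<in> E" for t j using dom that unfolding hybrid_time_domain_def by auto
    have good: "fst (z (t, j)) \<in> B \<and> W (fst (z (t, j))) \<le> M" if "(t, j) \<in> E" "\<not> bad t j" for t j
      using below_M[OF z0, of "t + real j" "fst (z (t, j))"] E_nonneg[OF that(1)] that(2) unfolding bad_def by auto
    have good_K1: "fst (z (t, j)) \<in> K1" if "(t, j) \<in> E" "\<not> bad t j" for t j
      using good[OF that] unfolding K1_def by auto
    define R where "R j \<longleftrightarrow> (\<exists>t. (t, j) \<in> E \<and> t + real j \<le> T \<and> bad t j)" for j
    \<comment> \<open>Minimality is sought first in the number of jumps: up to \<open>T\<close> the
      slices below \<open>j\<close> contain no violation, so only slice \<open>j\<close> remains to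
      be cut.\<close>
    define j where "j = (LEAST j. R j)"
    have "R j0" using tj0 bad0 unfolding R_def bad_def by blast
    then have "R j" and least: "\<And>i. i < j \<Longrightarrow> \<not> R i"
      unfolding j_def by (auto intro: LeastI dest: not_less_Least)
    then obtain t where tj: "(t, j) \<in> E" "t + real j \<le> T" "bad t j" unfolding R_def by blast
    obtain ts where ts: "ts 0 = 0" "\<forall>k\<le>j. ts k \<le> ts (Suc k)" "ts (Suc j) = t"
      and mem': "\<forall>s k. (s, k) \<in> E \<and> s \<le> t \<and> k \<le> j \<longleftrightarrow> k \<le> j \<and> ts k \<le> s \<and> s \<le> ts (Suc k)"
      by (rule hybrid_time_domain_truncation[OF dom tj(1)])
    note mem = mem'[rule_format]
    have earlier: "fst (z (s, k)) \<in> K1" if "(s, k) \<in> E" "s \<le> t" "k < j" for s k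
    proof -
      have "s + real k \<le> T" using that tj(2) by simp
      then show ?thesis using good_K1 least[of k] that unfolding R_def by blast
    qed
    define S where "S = {s \<in> {ts j..t}. bad s j}"
    define \<sigma> where "\<sigma> = Inf S"
    have "ts j \<le> t" using ts(2,3) by auto
    then have tS: "t \<in> S" using tj unfolding S_def by auto
    have bddS: "bdd_below S" unfolding S_def by (auto intro: bdd_belowI[of _ "ts j"])
    have \<sigma>: "ts j \<le> \<sigma>" "\<sigma> \<le> t"
      unfolding \<sigma>_def using tS bddS by (auto intro!: cInf_greatest cInf_lower simp: S_def)
    have slice: "(s, j) \<in> E" if "s \<in> {ts j..t}" for s using mem[of s j] ts(3) that by auto
    have not_bad: "\<not> bad s j" if "s \<in> {ts j..<\<sigma>}" for s
      using cInf_lower[OF _ bddS, of s] that \<sigma> unfolding \<sigma>_def S_def by force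
    have before: "fst (z (s, j)) \<in> K1" if "s \<in> {ts j..<\<sigma>}" for s
      using good_K1[OF slice not_bad[OF that]] that \<sigma> by auto
    have cont: "continuous_on {ts j..t} (\<lambda>s. fst (z (s, j)))" if "ts j < t"
    proof -
      have "{ts j..t} \<subseteq> jslice E j" using slice unfolding jslice_def by auto
      from sp_curve_integrable(1)[OF sp_solution_curve[OF sol that this, of UNIV]] show ?thesis by simp
    qed
    \<comment> \<open>The infimum of the violating times need not be a violation. In that case
      continuity allows a slightly later violation before \<open>W\<close> reaches
      \<open>M + 1\<close>.\<close>
    have "\<exists>s. s \<in> {\<sigma>..t} \<and> bad s j \<and> (\<forall>u\<in>{\<sigma>..s}. fst (z (u, j)) \<in> K)"
    proof (cases "bad \<sigma> j")
      case True
      have "fst (z (\<sigma>, j)) \<in> K"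
      proof (cases "ts j < \<sigma>")
        case True
        have cl: "closure {ts j..<\<sigma>} = {ts j..\<sigma>}" using True by simp
        have "(\<lambda>s. fst (z (s, j))) ` closure {ts j..<\<sigma>} \<subseteq> K1"
        proof (rule image_closure_subset)
          show "continuous_on (closure {ts j..<\<sigma>}) (\<lambda>s. fst (z (s, j)))"
            unfolding cl using True \<sigma> by (intro continuous_on_subset[OF cont]) auto
        qed (use before compact_imp_closed[OF K1] in auto)
        then show ?thesis using True unfolding cl K_def by auto
      next
        case False
        then have \<sigma>_eq: "\<sigma> = ts j" using \<sigma> by simp
        show ?thesis
        proof (cases j)
          case 0
          then show ?thesis using \<sigma>_eq ts(1) z0 K0 unfolding K_def K1_def by force
        next
          case (Suc i)
          have i: "(\<sigma>, i) \<in> E" using mem[of \<sigma> i] ts(2) \<sigma>_eq Suc by auto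
          have "(\<sigma>, Suc i) \<in> E" using slice[of \<sigma>] \<sigma> Suc by auto
          note jump = sp_solution_jump[OF sol i this]
          show ?thesis using G_K[OF earlier[OF i \<sigma>(2)] jump(2,4)] Suc by simp
        qed
      qed
      then show ?thesis using True \<sigma> by (intro exI[of _ \<sigma>]) auto
    next
      case False
      define U where "U = {x \<in> B. W x < M + 1}"
      have "open U"
        using continuous_open_preimage[OF cont_W open_B, of "{..<M + 1}"] by (simp add: U_def vimage_def Int_def)
      have "\<sigma> \<noteq> t" using False tj(3) by auto
      then have "\<sigma> < t" "ts j < t" using \<sigma> by auto
      have "fst (z (\<sigma>, j)) \<in> U" using good[OF slice False] \<sigma> unfolding U_def by auto
      then obtain e where "e > 0" and e: "ball (fst (z (\<sigma>, j))) e \<subseteq> U"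
        using \<open>open U\<close> open_contains_ball by blast
      have "\<sigma> \<in> {ts j..t}" using \<sigma> by auto
      then obtain d where "d > 0" and d: "\<forall>s\<in>{ts j..t}. dist s \<sigma> < d \<longrightarrow> dist (fst (z (s, j))) (fst (z (\<sigma>, j))) < e"
        using cont[OF \<open>ts j < t\<close>] \<open>e > 0\<close> unfolding continuous_on_iff by blast
      obtain s where s: "s \<in> S" "s < \<sigma> + d"
        using cInf_lessD[of S "\<sigma> + d"] tS \<open>d > 0\<close> unfolding \<sigma>_def by auto
      have "\<sigma> \<le> s" unfolding \<sigma>_def using s(1) bddS by (rule cInf_lower)
      have "fst (z (u, j)) \<in> K" if u: "u \<in> {\<sigma>..s}" for u
      proof -
        have "u \<in> {ts j..t}" "dist u \<sigma> < d" using u s \<sigma> unfolding S_def by (auto simp: dist_real_def)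
        then have "fst (z (u, j)) \<in> U" using d e by (auto simp: dist_commute subset_eq)
        then show ?thesis unfolding U_def K_def K1_def by auto
      qed
      then show ?thesis using s \<open>\<sigma> \<le> s\<close> unfolding S_def by auto
    qed
    then obtain s where s: "s \<in> {\<sigma>..t}" "bad s j" and after: "\<forall>u\<in>{\<sigma>..s}. fst (z (u, j)) \<in> K" by blast
    have "fst (z (u, k)) \<in> K" if u: "(u, k) \<in> E" "u \<le> s" "k \<le> j" for u k
    proof (cases "k < j")
      case True
      then show ?thesis using earlier[OF u(1)] u s unfolding K_def by auto
    next
      case False
      then have "k = j" using u by simp
      moreover have "ts j \<le> u" using mem[of u j] u s \<open>k = j\<close> by auto
      ultimately show ?thesis using before[of u] after u unfolding K_def by (cases "u < \<sigma>") auto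
    qed
    then show "\<exists>t' j'. (t', j') \<in> E \<and> t' + real j' \<le> T \<and>
      \<beta> (W (fst (z (0, 0)))) (t' + real j') + \<nu> < W (fst (z (t', j'))) \<and>
      (\<forall>s k. (s, k) \<in> E \<longrightarrow> s \<le> t' \<longrightarrow> k \<le> j' \<longrightarrow> fst (z (s, k)) \<in> K)"
      using s slice[of s] \<sigma> tj(2) unfolding bad_def by (intro exI[of _ s] exI[of _ j]) auto
  qed
qed

text \<open>\<open>sp_path_bound\<close> fixes the number of jumps, but hybrid time at most
  \<open>T\<close> leaves only finitely many numbers and \<open>K\<close> is the same for all of
  them, so the least of the thresholds works.\<close>

lemma finite_horizon:
  "\<exists>\<epsilon>0>0. \<forall>\<epsilon> E z t j. 0 < \<epsilon> \<longrightarrow> \<epsilon> < \<epsilon>0 \<longrightarrow> sp_solution \<epsilon> E z \<longrightarrow> fst (z (0, 0)) \<in> K0 \<longrightarrow>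
    (t, j) \<in> E \<longrightarrow> t + real j \<le> T \<longrightarrow> W (fst (z (t, j))) \<le> \<beta> (W (fst (z (0, 0)))) (t + real j) + \<nu>"
proof -
  obtain K where K: "compact K" and violation: "\<And>\<epsilon> E z t j T. sp_solution \<epsilon> E z \<Longrightarrow> fst (z (0, 0)) \<in> K0 \<Longrightarrow> (t, j) \<in> E \<Longrightarrow>
    t + real j \<le> T \<Longrightarrow> \<beta> (W (fst (z (0, 0)))) (t + real j) + \<nu> < W (fst (z (t, j))) \<Longrightarrow>
    \<exists>t' j'. (t', j') \<in> E \<and> t' + real j' \<le> T \<and>
      \<beta> (W (fst (z (0, 0)))) (t' + real j') + \<nu> < W (fst (z (t', j'))) \<and>
      (\<forall>s k. (s, k) \<in> E \<longrightarrow> s \<le> t' \<longrightarrow> k \<le> j' \<longrightarrow> fst (z (s, k)) \<in> K)"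
    using sp_solution_first_violation by metis
  have "\<forall>J. \<exists>e>0. \<forall>\<epsilon> ts \<phi> \<xi>. 0 < \<epsilon> \<longrightarrow> \<epsilon> < e \<longrightarrow> sp_path \<epsilon> K J ts \<phi> \<xi> \<longrightarrow> \<phi> 0 0 \<in> K0 \<longrightarrow>
    ts (Suc J) \<le> T \<longrightarrow> W (\<phi> J (ts (Suc J))) \<le> \<beta> (W (\<phi> 0 0)) (ts (Suc J) + real J) + \<nu>"
    using sp_path_bound[OF K] by blast
  then obtain e where e: "\<forall>J. e J > 0 \<and> (\<forall>\<epsilon> ts \<phi> \<xi>. 0 < \<epsilon> \<longrightarrow> \<epsilon> < e J \<longrightarrow> sp_path \<epsilon> K J ts \<phi> \<xi> \<longrightarrow> \<phi> 0 0 \<in> K0 \<longrightarrow>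
    ts (Suc J) \<le> T \<longrightarrow> W (\<phi> J (ts (Suc J))) \<le> \<beta> (W (\<phi> 0 0)) (ts (Suc J) + real J) + \<nu>)"
    unfolding choice_iff by (elim exE)
  define \<epsilon>0 where "\<epsilon>0 = Min (e ` {..nat \<lfloor>T\<rfloor>})"
  have "\<epsilon>0 > 0" unfolding \<epsilon>0_def using e by (subst Min_gr_iff) auto
  moreover have "W (fst (z (t, j))) \<le> \<beta> (W (fst (z (0, 0)))) (t + real j) + \<nu>"
    if \<epsilon>: "0 < \<epsilon>" "\<epsilon> < \<epsilon>0" and sol: "sp_solution \<epsilon> E z" and z0: "fst (z (0, 0)) \<in> K0" and tj: "(t, j) \<in> E" "t + real j \<le> T"
    for \<epsilon> E z t j
  proof (rule ccontr)
    assume "\<not> ?thesis"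
    then have "\<beta> (W (fst (z (0, 0)))) (t + real j) + \<nu> < W (fst (z (t, j)))" by simp
    from violation[OF sol z0 tj this] obtain s k where sk: "(s, k) \<in> E" "s + real k \<le> T"
      and bad: "\<beta> (W (fst (z (0, 0)))) (s + real k) + \<nu> < W (fst (z (s, k)))"
      and inK: "\<forall>u i. (u, i) \<in> E \<longrightarrow> u \<le> s \<longrightarrow> i \<le> k \<longrightarrow> fst (z (u, i)) \<in> K"
      by (elim exE conjE)
    have "0 \<le> s" using sp_solution_domain[OF sol] sk unfolding hybrid_time_domain_def by auto
    then have "real k \<le> T" "s \<le> T" using sk by auto
    then have "k \<le> nat \<lfloor>T\<rfloor>" by (simp add: le_nat_floor)
    then have "\<epsilon>0 \<le> e k" unfolding \<epsilon>0_def by (intro Min_le) auto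
    then have small: "\<epsilon> < e k" using \<epsilon>(2) by simp
    obtain ts where ts: "ts (Suc k) = s" and path: "sp_path \<epsilon> K k ts (\<lambda>k s. fst (z (s, k))) (\<lambda>k s. snd (z (s, k)))"
      using sp_solution_path[OF sol sk(1)] inK by blast
    have "W (fst (z (ts (Suc k), k))) \<le> \<beta> (W (fst (z (0, 0)))) (ts (Suc k) + real k) + \<nu>"
      using e[rule_format, THEN conjunct2, rule_format, OF \<epsilon>(1) small path] z0 ts \<open>s \<le> T\<close> by simp
    then show False using bad ts by simp
  qed
  ultimately show ?thesis by (intro exI[of _ \<epsilon>0]) auto
qed

text \<open>The decay condition at \<open>r\<close> brings solutions from \<open>S\<close> down to
  \<open>\<rho>\<close>, the one at \<open>\<rho>\<close> does so again after each restart. All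
  restarts begin in \<open>K0\<close>, hence a single threshold for \<open>\<epsilon>\<close> serves
  arbitrarily many of them.\<close>

lemma infinite_horizon:
  assumes T: "1 \<le> T" and S: "S \<subseteq> K0" "\<And>x. x \<in> S \<Longrightarrow> W x \<le> r" and small_in: "{x \<in> B. W x \<le> \<rho>} \<subseteq> K0"
    and decay: "0 \<le> r" "0 \<le> \<rho>" "\<beta> r T + \<nu> \<le> \<rho>" "\<beta> \<rho> T + \<nu> \<le> \<rho>" and "\<rho> \<le> M" "\<nu> \<le> \<rho>"
  shows "\<exists>\<epsilon>0>0. \<forall>\<epsilon> E z t j. 0 < \<epsilon> \<longrightarrow> \<epsilon> < \<epsilon>0 \<longrightarrow> sp_solution \<epsilon> E z \<longrightarrow> fst (z (0, 0)) \<in> S \<longrightarrow>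
    (t, j) \<in> E \<longrightarrow> W (fst (z (t, j))) \<le> \<beta> (W (fst (z (0, 0)))) (t + real j) + \<rho>"
proof -
  \<comment> \<open>Beyond hybrid time \<open>2 * T + 2\<close>, a point at most
    \<open>T + 1\<close> earlier is still later than \<open>T\<close>, where the level
    \<open>\<rho>\<close> has already been reached.\<close>
  obtain \<epsilon>0 where "\<epsilon>0 > 0" and horizon: "\<forall>\<epsilon> E z t j. 0 < \<epsilon> \<longrightarrow> \<epsilon> < \<epsilon>0 \<longrightarrow> sp_solution \<epsilon> E z \<longrightarrow> fst (z (0, 0)) \<in> K0 \<longrightarrow>
    (t, j) \<in> E \<longrightarrow> t + real j \<le> 2 * T + 2 \<longrightarrow> W (fst (z (t, j))) \<le> \<beta> (W (fst (z (0, 0)))) (t + real j) + \<nu>"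
    using finite_horizon[of "2 * T + 2"] by (elim exE conjE)
  have decayed: "W (fst (z (t, j))) \<le> \<rho>"
    if \<epsilon>: "0 < \<epsilon>" "\<epsilon> < \<epsilon>0" and sol: "sp_solution \<epsilon> E z" and z0: "fst (z (0, 0)) \<in> K0"
      and q: "W (fst (z (0, 0))) \<le> q" "0 \<le> q" "\<beta> q T + \<nu> \<le> \<rho>"
      and tj: "(t, j) \<in> E" "T \<le> t + real j" "t + real j \<le> 2 * T + 2" for \<epsilon> E z q t j
  proof -
    have nonneg: "0 \<le> W (fst (z (0, 0)))" using W_nonneg z0 K0(2) by blast
    have "W (fst (z (t, j))) \<le> \<beta> (W (fst (z (0, 0)))) (t + real j) + \<nu>"
      using horizon \<epsilon> sol z0 tj by blast
    also have "\<beta> (W (fst (z (0, 0)))) (t + real j) \<le> \<beta> (W (fst (z (0, 0)))) T"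
      using T tj by (intro class_KL_antimono[OF KL nonneg]) auto
    also have "\<dots> \<le> \<beta> q T" using T q by (intro class_KL_mono[OF KL nonneg]) auto
    finally show ?thesis using q(3) by simp
  qed
  have "W (fst (z (t, j))) \<le> \<beta> (W (fst (z (0, 0)))) (t + real j) + \<rho>"
    if \<epsilon>: "0 < \<epsilon>" "\<epsilon> < \<epsilon>0" and sol: "sp_solution \<epsilon> E z" and z0: "fst (z (0, 0)) \<in> S" and tj: "(t, j) \<in> E"
    for \<epsilon> E z t j
  proof -
    have dom: "hybrid_time_domain E" by (rule sp_solution_domain[OF sol])
    have z0': "fst (z (0, 0)) \<in> K0" using z0 S(1) by blast
    have late: "W (fst (z (t, j))) \<le> \<rho>" if "(t, j) \<in> E" "T \<le> t + real j" "t + real j \<le> 2 * T + 2 + real n" for n t j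
      using that
    proof (induction n arbitrary: t j)
      case 0
      then show ?case using decayed[OF \<epsilon> sol z0' S(2)[OF z0] decay(1,3)] by simp
    next
      case (Suc n)
      show ?case
      proof (cases "t + real j \<le> 2 * T + 2")
        case True
        then show ?thesis using decayed[OF \<epsilon> sol z0' S(2)[OF z0] decay(1,3)] Suc.prems by simp
      next
        case False
        \<comment> \<open>The restart happens at \<open>c\<close> or up to 1 later. Because
          \<open>T\<close> is at least 1, that is at least 1 before \<open>(t, j)\<close>, so the
          induction hypothesis covers the restart point and it is not the terminal one.\<close>
        define c where "c = t + real j - T - 1"
        have c: "0 \<le> c" "c \<le> t + real j" using False T by (auto simp: c_def)
        obtain s k where sk: "(s, k) \<in> E" "s \<le> t" "k \<le> j" "c \<le> s + real k" "s + real k \<le> c + 1"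
          by (rule hybrid_time_domain_intermediate[OF dom Suc.prems(1) c])
        have W_sk: "W (fst (z (s, k))) \<le> \<rho>"
          using sk False T Suc.prems by (intro Suc.IH) (auto simp: c_def)
        have "fst (z (s, k)) \<in> B" using W_outside[of "fst (z (s, k))"] W_sk \<open>\<rho> \<le> M\<close> by force
        then have in_K0: "fst (z (s, k)) \<in> K0" using W_sk small_in by blast
        have ne: "(s, k) \<noteq> (t, j)" using sk(5) T by (auto simp: c_def)
        let ?E = "{(\<tau>, i). 0 \<le> \<tau> \<and> (s + \<tau>, k + i) \<in> E}" and ?z = "\<lambda>(\<tau>, i). z (s + \<tau>, k + i)"
        have "sp_solution \<epsilon> ?E ?z" by (rule sp_solution_shift[OF sol sk(1) Suc.prems(1) sk(2,3) ne])
        from decayed[OF \<epsilon> this _ _ decay(2,4), of "t - s" "j - k"] show ?thesis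
          using in_K0 W_sk sk Suc.prems(1) T by (simp add: c_def of_nat_diff)
      qed
    qed
    have "0 \<le> t" using dom tj unfolding hybrid_time_domain_def by auto
    have nonneg: "0 \<le> \<beta> (W (fst (z (0, 0)))) (t + real j)"
      using KL W_nonneg z0' K0(2) \<open>0 \<le> t\<close> unfolding class_KL_def class_L_def by auto
    show ?thesis
    proof (cases "t + real j \<le> T")
      case True
      then have "W (fst (z (t, j))) \<le> \<beta> (W (fst (z (0, 0)))) (t + real j) + \<nu>"
        using horizon \<epsilon> sol z0' tj T by auto
      then show ?thesis using \<open>\<nu> \<le> \<rho>\<close> by simp
    next
      case False
      obtain n where "t + real j \<le> real n" using real_arch_simple by blast
      then show ?thesis using late[OF tj, of n] False nonneg T by simp
    qed
  qed
  then show ?thesis using \<open>\<epsilon>0 > 0\<close> by blast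
qed

end

section \<open>Proper indicators and the stability theorem\<close>

lemma proper_indicator_continuous_limit:
  assumes "proper_indicator \<omega> A B" "open B" "xs \<longlonglongrightarrow> l" "l \<in> B"
  shows "(\<lambda>n. \<omega> (xs n)) \<longlonglongrightarrow> \<omega> l"
  using assms unfolding proper_indicator_def
  by (intro isCont_tendsto_compose[of l \<omega>]) (auto simp: continuous_on_eq_continuous_at)

text \<open>A sequence in a sublevel set can neither escape to infinity nor converge to the boundary
  of \<open>B\<close>, as \<open>\<omega>\<close> would blow up along it. Since \<open>B\<close> is
  open, a limit outside \<open>B\<close> would lie on that boundary.\<close>

lemma proper_indicator_compact_sublevel:
  fixes B :: "'a::euclidean_space set"
  assumes \<omega>: "proper_indicator \<omega> A B" and "open B"
  shows "compact {x \<in> B. \<omega> x \<le> c}"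
proof -
  have blow_up: False if xs: "\<And>n. xs n \<in> {x \<in> B. \<omega> x \<le> c}"
    and lim: "filterlim (\<lambda>i. norm (xs i)) at_top sequentially \<or> (\<exists>p\<in>frontier B. xs \<longlonglongrightarrow> p)" for xs
  proof -
    have "filterlim (\<lambda>i. \<omega> (xs i)) at_top sequentially"
      using \<omega> xs lim unfolding proper_indicator_def by blast
    then have "\<forall>\<^sub>F i in sequentially. \<omega> (xs i) \<ge> c + 1" unfolding filterlim_at_top by blast
    then obtain i where "\<omega> (xs i) \<ge> c + 1" using eventually_happens trivial_limit_sequentially by blast
    then show False using xs[of i] by simp
  qed
  have "bounded {x \<in> B. \<omega> x \<le> c}"
  proof (rule ccontr)
    assume "\<not> ?thesis"
    then have "\<forall>n. \<exists>x\<in>{x \<in> B. \<omega> x \<le> c}. real n < norm x"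
      unfolding bounded_iff by (metis not_le)
    then obtain xs where xs: "\<And>n. xs n \<in> {x \<in> B. \<omega> x \<le> c}" "\<And>n. real n < norm (xs n)" by metis
    have "filterlim (\<lambda>i. norm (xs i)) at_top sequentially"
      by (rule filterlim_at_top_mono[OF filterlim_real_sequentially])
        (use xs(2) less_imp_le in \<open>auto intro!: always_eventually\<close>)
    then show False using blow_up xs(1) by blast
  qed
  moreover have "closed {x \<in> B. \<omega> x \<le> c}"
    unfolding closed_sequential_limits
  proof (intro allI impI)
    fix xs l assume xs: "(\<forall>n. xs n \<in> {x \<in> B. \<omega> x \<le> c}) \<and> xs \<longlonglongrightarrow> l"
    have "l \<in> B"
    proof (rule ccontr)
      assume "l \<notin> B"
      moreover have "l \<in> closure B" using xs unfolding closure_sequential by blast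
      ultimately have "l \<in> frontier B" using \<open>open B\<close> by (simp add: frontier_def interior_open)
      then show False using blow_up[of xs] xs by blast
    qed
    moreover have "\<omega> l \<le> c"
      by (rule LIMSEQ_le_const2[OF proper_indicator_continuous_limit[OF \<omega> \<open>open B\<close> _ \<open>l \<in> B\<close>]]) (use xs in auto)
    ultimately show "l \<in> {x \<in> B. \<omega> x \<le> c}" by simp
  qed
  ultimately show ?thesis by (simp add: compact_eq_bounded_closed)
qed

text \<open>Licenses the redefinition of an indicator outside \<open>B\<close>.\<close>

lemma proper_indicator_cong:
  assumes "proper_indicator \<omega> A B" "\<And>x. x \<in> B \<Longrightarrow> \<omega>' x = \<omega> x"
  shows "proper_indicator \<omega>' A B"
proof -
  have "continuous_on B \<omega>'" using assms continuous_on_cong[of B B \<omega>' \<omega>] unfolding proper_indicator_def by auto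
  moreover have "(\<lambda>i. \<omega>' (xs i)) = (\<lambda>i. \<omega> (xs i))" if "\<forall>i. xs i \<in> B" for xs :: "nat \<Rightarrow> 'a"
    using that assms(2) by auto
  ultimately show ?thesis using assms unfolding proper_indicator_def by simp
qed

theorem theorem5:
  fixes C D :: "(real ^ 'n1) set"
    and \<Psi> :: "(real ^ 'n2) set"
    and f_phi :: "real \<Rightarrow> real ^ 'n1 \<Rightarrow> real ^ 'n2 \<Rightarrow> real ^ 'n1"
    and f_chi :: "real ^ 'n1 \<Rightarrow> real ^ 'n2 \<Rightarrow> real ^ 'n2"
    and G_phi :: "real ^ 'n1 \<Rightarrow> real ^ 'n2 \<Rightarrow> (real ^ 'n1) set"
    and f_A :: "real \<Rightarrow> real ^ 'n1 \<Rightarrow> real ^ 'n1"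
    and A_phi B :: "(real ^ 'n1) set"
    and \<beta> :: "real \<Rightarrow> real \<Rightarrow> real"
  assumes A1_closed: "closed C" "closed D"
    and A1_cont: "\<And>\<delta>. \<delta> > 0 \<Longrightarrow> continuous_on (C \<times> \<Psi>) (\<lambda>(p, q). f_phi \<delta> p q)"
    and A1_cont_chi: "continuous_on (C \<times> \<Psi>) (\<lambda>(p, q). f_chi p q)"
    and A1_osc: "outer_semicontinuous (\<lambda>(p, q). G_phi p q)"
    and A1_lb: "locally_bounded (\<lambda>(p, q). G_phi p q)"
    and A1_compact: "compact \<Psi>"
    and A1_nonempty: "\<And>p q. p \<in> D \<Longrightarrow> q \<in> \<Psi> \<Longrightarrow> G_phi p q \<noteq> {}"
    and A2_cont: "\<And>\<delta>. \<delta> > 0 \<Longrightarrow> continuous_on UNIV (f_A \<delta>)"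
    and A2_avg: "\<And>\<delta> K. \<delta> > 0 \<Longrightarrow> compact K \<Longrightarrow>
        \<exists>\<sigma>. class_L \<sigma> \<and>
          (\<forall>L>0. \<forall>p\<in>C \<inter> K. \<forall>chi_bl :: real \<Rightarrow> real ^ 'n2.
             (\<forall>s\<in>{0..L}. chi_bl s \<in> \<Psi> \<and>
                 (chi_bl has_vector_derivative f_chi p (chi_bl s)) (at s within {0..L})) \<longrightarrow>
             norm ((1 / L) *\<^sub>R integral {0..L} (\<lambda>s. f_phi \<delta> p (chi_bl s) - f_A \<delta> p)) \<le> \<sigma> L)"
    and A3_set: "A_phi \<noteq> {}" "compact A_phi" "open B" "A_phi \<subseteq> B"
    and A3_KL: "class_KL \<beta>"
    and A3_stab: "\<And>\<omega> K0 \<nu>. proper_indicator \<omega> A_phi B \<Longrightarrow> compact K0 \<Longrightarrow> K0 \<subseteq> B \<Longrightarrow> \<nu> > 0 \<Longrightarrow>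
        \<exists>\<delta>s>0. \<forall>\<delta>. 0 < \<delta> \<and> \<delta> < \<delta>s \<longrightarrow>
          (\<forall>E (y :: real \<times> nat \<Rightarrow> real ^ 'n1).
             is_hybrid_solution C (\<lambda>z. {f_A \<delta> z}) D (avg_jump G_phi \<Psi>) E y \<longrightarrow> y (0, 0) \<in> K0 \<longrightarrow>
             (\<forall>t j. (t, j) \<in> E \<longrightarrow> \<omega> (y (t, j)) \<le> \<beta> (\<omega> (y (0, 0))) (t + real j) + \<nu>))"
  shows "\<forall>\<omega> K0 \<nu>. proper_indicator \<omega> A_phi B \<longrightarrow> compact K0 \<longrightarrow> K0 \<subseteq> B \<longrightarrow> \<nu> > 0 \<longrightarrow>
        (\<exists>\<delta>s>0. \<forall>\<delta>. 0 < \<delta> \<and> \<delta> < \<delta>s \<longrightarrow>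
          (\<exists>\<epsilon>s>0. \<forall>\<epsilon>. 0 < \<epsilon> \<and> \<epsilon> < \<epsilon>s \<longrightarrow>
            (\<forall>E (z :: real \<times> nat \<Rightarrow> (real ^ 'n1) \<times> (real ^ 'n2)).
               is_hybrid_solution (C \<times> \<Psi>) (sp_flow f_phi f_chi \<delta> \<epsilon>) (D \<times> \<Psi>) (sp_jump G_phi) E z \<longrightarrow>
               fst (z (0, 0)) \<in> K0 \<longrightarrow>
               (\<forall>t j. (t, j) \<in> E \<longrightarrow>
                  \<omega> (fst (z (t, j))) \<le> \<beta> (\<omega> (fst (z (0, 0)))) (t + real j) + \<nu>))))"
proof (intro allI impI)
  fix \<omega> and K0 :: "(real ^ 'n1) set" and \<nu> :: real
  assume \<omega>: "proper_indicator \<omega> A_phi B" and cK0: "compact K0" "K0 \<subseteq> B" and "\<nu> > 0"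
  have cont_\<omega>: "continuous_on B \<omega>" and \<omega>_nonneg: "\<And>x. x \<in> B \<Longrightarrow> 0 \<le> \<omega> x"
    using \<omega> unfolding proper_indicator_def by auto
  have "bounded (\<omega> ` K0)"
    using cK0 cont_\<omega> by (intro compact_imp_bounded compact_continuous_image) (auto intro: continuous_on_subset)
  then obtain r where r: "r > 0" "\<forall>x\<in>\<omega> ` K0. norm x \<le> r" unfolding bounded_pos by blast
  then have r_bound: "\<omega> x \<le> r" if "x \<in> K0" for x using that by force
  \<comment> \<open>Contains the given starts and all restart points, so that one
    \<open>\<delta>s\<close> serves both.\<close>
  define K1 where "K1 = K0 \<union> {x \<in> B. \<omega> x \<le> \<nu>}"
  have K1: "compact K1" "K1 \<subseteq> B"
    unfolding K1_def using cK0 proper_indicator_compact_sublevel[OF \<omega> A3_set(3)] by (auto intro: compact_Un)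
  define q where "q = max r \<nu>"
  have \<beta>q: "0 \<le> \<beta> q 0" using A3_KL \<open>\<nu> > 0\<close> unfolding class_KL_def class_L_def q_def by auto
  have K1_q: "\<omega> x \<le> q" if "x \<in> K1" for x using that r_bound unfolding K1_def q_def by force
  \<comment> \<open>Dominates \<open>W\<close> on \<open>K1\<close>, every level that the estimate
    permits from there, and the restart level \<open>\<nu>\<close>.\<close>
  define M where "M = \<beta> q 0 + \<nu> + q"
  have M_ge: "q \<le> M" "\<nu> \<le> M" "\<beta> q 0 + \<nu> \<le> M" using \<beta>q \<open>\<nu> > 0\<close> r unfolding M_def q_def by auto
  define W where "W x = (if x \<in> B then \<omega> x else M + 1)" for x
  have W: "proper_indicator W A_phi B" by (rule proper_indicator_cong[OF \<omega>]) (simp add: W_def)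
  have "\<nu> / 4 > 0" using \<open>\<nu> > 0\<close> by simp
  obtain \<delta>s where "\<delta>s > 0" and avg: "\<forall>\<delta>. 0 < \<delta> \<and> \<delta> < \<delta>s \<longrightarrow>
          (\<forall>E (y :: real \<times> nat \<Rightarrow> real ^ 'n1).
             is_hybrid_solution C (\<lambda>z. {f_A \<delta> z}) D (avg_jump G_phi \<Psi>) E y \<longrightarrow> y (0, 0) \<in> K1 \<longrightarrow>
             (\<forall>t j. (t, j) \<in> E \<longrightarrow> W (y (t, j)) \<le> \<beta> (W (y (0, 0))) (t + real j) + \<nu> / 4))"
    using A3_stab[OF W K1 \<open>\<nu> / 4 > 0\<close>] by (elim exE conjE)
  have decay: "\<forall>\<^sub>F T in at_top. \<beta> p T < \<nu> / 2" if "0 \<le> p" for p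
    using A3_KL that \<open>\<nu> > 0\<close> unfolding class_KL_def class_L_def by (intro order_tendstoD(2)[of _ 0]) auto
  \<comment> \<open>\<open>T\<close> is chosen from \<open>\<beta>\<close> alone, before delta and
    \<open>\<epsilon>\<close>. After \<open>T\<close> both the initial level \<open>r\<close> and
    the restart level \<open>\<nu>\<close> have decayed below \<open>\<nu> / 2\<close>, which leaves
    \<open>\<nu> / 2\<close> for the finite-horizon error.\<close>
  have "\<forall>\<^sub>F T in at_top. \<beta> r T < \<nu> / 2 \<and> \<beta> \<nu> T < \<nu> / 2 \<and> 1 \<le> T"
    using decay[of r] decay[of \<nu>] r \<open>\<nu> > 0\<close> by (intro eventually_conj eventually_ge_at_top) auto
  then obtain T where T: "\<beta> r T < \<nu> / 2" "\<beta> \<nu> T < \<nu> / 2" "1 \<le> T"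
    using eventually_happens[of _ "at_top :: real filter"] by auto
  show "\<exists>\<delta>s>0. \<forall>\<delta>. 0 < \<delta> \<and> \<delta> < \<delta>s \<longrightarrow>
          (\<exists>\<epsilon>s>0. \<forall>\<epsilon>. 0 < \<epsilon> \<and> \<epsilon> < \<epsilon>s \<longrightarrow>
            (\<forall>E (z :: real \<times> nat \<Rightarrow> (real ^ 'n1) \<times> (real ^ 'n2)).
               is_hybrid_solution (C \<times> \<Psi>) (sp_flow f_phi f_chi \<delta> \<epsilon>) (D \<times> \<Psi>) (sp_jump G_phi) E z \<longrightarrow>
               fst (z (0, 0)) \<in> K0 \<longrightarrow>
               (\<forall>t j. (t, j) \<in> E \<longrightarrow>
                  \<omega> (fst (z (t, j))) \<le> \<beta> (\<omega> (fst (z (0, 0)))) (t + real j) + \<nu>)))"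
  proof (rule exI[of _ \<delta>s], intro conjI \<open>\<delta>s > 0\<close> allI impI; elim conjE)
    fix \<delta> assume \<delta>: "0 < \<delta>" "\<delta> < \<delta>s"
    interpret hybrid_averaging C \<Psi> "f_phi \<delta>" f_chi "f_A \<delta>" D G_phi
      using A1_closed A1_compact A1_cont[OF \<delta>(1)] A1_cont_chi A2_cont[OF \<delta>(1)] A2_avg[OF \<delta>(1)] A1_osc A1_lb
      by unfold_locales
    interpret average_stable C \<Psi> "f_phi \<delta>" f_chi "f_A \<delta>" D G_phi B K1 W \<beta> M "\<nu> / 4" "\<nu> / 2"
    proof
      show "continuous_on B W" using W unfolding proper_indicator_def by blast
      show "0 \<le> W x" if "x \<in> B" for x using \<omega>_nonneg[OF that] that by (simp add: W_def)
      show "compact {x \<in> B. W x \<le> c}" for c by (rule proper_indicator_compact_sublevel[OF W A3_set(3)])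
      show "W x \<le> M" if "x \<in> K1" for x using K1_q[OF that] K1(2) that M_ge by (auto simp: W_def)
      show "\<beta> (W x) 0 + \<nu> / 2 \<le> M" if x: "x \<in> K1" for x
      proof -
        have "\<beta> (W x) 0 \<le> \<beta> q 0"
          using K1_q[OF x] K1(2) x \<omega>_nonneg by (intro class_KL_mono[OF A3_KL]) (auto simp: W_def)
        then show ?thesis using M_ge \<open>\<nu> > 0\<close> by simp
      qed
      fix J ts y assume path: "avg_path J ts y" and y0: "y 0 0 \<in> K1"
      let ?E = "\<Union>j<Suc J. {ts j..ts (Suc j)} \<times> {j}"
      have "ts J \<le> ts (Suc J)" using path unfolding avg_path_def by blast
      then have "(ts (Suc J), J) \<in> ?E" by auto
      then show "W (y J (ts (Suc J))) \<le> \<beta> (W (y 0 0)) (ts (Suc J) + real J) + \<nu> / 4"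
        using avg[rule_format, OF conjI[OF \<delta>] avg_path_is_hybrid_solution[OF path]] y0 by auto
    qed (use A3_set A3_KL K1 \<open>\<nu> > 0\<close> in \<open>auto simp: W_def\<close>)
    have "{x \<in> B. W x \<le> \<nu>} \<subseteq> K1" unfolding K1_def W_def by auto
    moreover have "W x \<le> r" if "x \<in> K0" for x using r_bound that cK0(2) by (auto simp: W_def)
    ultimately obtain \<epsilon>s where "\<epsilon>s > 0" and bound: "\<forall>\<epsilon> E z t j. 0 < \<epsilon> \<longrightarrow> \<epsilon> < \<epsilon>s \<longrightarrow> sp_solution \<epsilon> E z \<longrightarrow>
        fst (z (0, 0)) \<in> K0 \<longrightarrow> (t, j) \<in> E \<longrightarrow> W (fst (z (t, j))) \<le> \<beta> (W (fst (z (0, 0)))) (t + real j) + \<nu>"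
      using infinite_horizon[OF T(3), of K0 r \<nu>] T r(1) \<open>\<nu> > 0\<close> M_ge by (auto simp: K1_def)
    show "\<exists>\<epsilon>s>0. \<forall>\<epsilon>. 0 < \<epsilon> \<and> \<epsilon> < \<epsilon>s \<longrightarrow>
            (\<forall>E (z :: real \<times> nat \<Rightarrow> (real ^ 'n1) \<times> (real ^ 'n2)).
               is_hybrid_solution (C \<times> \<Psi>) (sp_flow f_phi f_chi \<delta> \<epsilon>) (D \<times> \<Psi>) (sp_jump G_phi) E z \<longrightarrow>
               fst (z (0, 0)) \<in> K0 \<longrightarrow>
               (\<forall>t j. (t, j) \<in> E \<longrightarrow>
                  \<omega> (fst (z (t, j))) \<le> \<beta> (\<omega> (fst (z (0, 0)))) (t + real j) + \<nu>))"
    proof (intro exI[of _ \<epsilon>s] conjI \<open>\<epsilon>s > 0\<close> allI impI; elim conjE)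
      fix \<epsilon> E t j and z :: "real \<times> nat \<Rightarrow> (real ^ 'n1) \<times> (real ^ 'n2)"
      assume \<epsilon>: "0 < \<epsilon>" "\<epsilon> < \<epsilon>s"
        and sol: "is_hybrid_solution (C \<times> \<Psi>) (sp_flow f_phi f_chi \<delta> \<epsilon>) (D \<times> \<Psi>) (sp_jump G_phi) E z"
        and z0: "fst (z (0, 0)) \<in> K0" and tj: "(t, j) \<in> E"
      have "sp_flow f_phi f_chi \<delta> \<epsilon> = (\<lambda>z. {sp_field \<epsilon> z})"
        by (simp add: fun_eq_iff sp_flow_def sp_field_def)
      then have sol': "sp_solution \<epsilon> E z" using sol unfolding sp_solution_def by simp
      have z0_B: "fst (z (0, 0)) \<in> B" using z0 cK0(2) by blast
      have est: "W (fst (z (t, j))) \<le> \<beta> (\<omega> (fst (z (0, 0)))) (t + real j) + \<nu>"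
        using bound[rule_format, OF \<epsilon> sol' z0 tj] z0_B unfolding W_def by simp
      have "0 \<le> t" using sp_solution_domain[OF sol'] tj unfolding hybrid_time_domain_def by auto
      \<comment> \<open>The estimate so far concerns \<open>W\<close>. It transfers to
        \<open>\<omega>\<close> only at points of \<open>B\<close>, and a level of at most
        \<open>M\<close> certifies that the point is one.\<close>
      have "\<beta> (\<omega> (fst (z (0, 0)))) (t + real j) \<le> \<beta> (\<omega> (fst (z (0, 0)))) 0"
        using \<omega>_nonneg[OF z0_B] \<open>0 \<le> t\<close> by (intro class_KL_antimono[OF A3_KL]) auto
      also have "\<dots> \<le> \<beta> q 0"
        using \<omega>_nonneg[OF z0_B] K1_q z0 unfolding K1_def by (intro class_KL_mono[OF A3_KL]) auto
      finally have "W (fst (z (t, j))) \<le> M" using est M_ge by simp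
      then have "fst (z (t, j)) \<in> B" by (auto simp: W_def split: if_splits)
      then show "\<omega> (fst (z (t, j))) \<le> \<beta> (\<omega> (fst (z (0, 0)))) (t + real j) + \<nu>"
        using est by (simp add: W_def)
    qed
  qed
qed

end
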